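(* Let $M\subset \mathbb{C}^{n+1}$ and $M'\subset \mathbb{C}^{N+1}$ be smooth real hypersurfaces through $p$ and $p'$ respectively, and let $H\colon (\mathbb{C}^{n+1},p)\to(\mathbb{C}^{N+1},p')$ be a germ at $p$ of a holomorphic mapping such that $H(M)\subset M'$ (as germs). Denote by $r$ the rank of the Levi form of $M'$ at $p'$ and assume that $$2N-r\le 2n-2.$$ If the germ at $p$ of the complex analytic variety $W_H=\{Z:\operatorname{rk} H_Z(Z)<n+1\}$ has codimension at least $2$, then $H$ is transversal to $M'$ at $p$.
   Context: $H_Z=(\partial H_i/\partial Z_j)_{1\le i\le N+1,\,1\le j\le n+1}$ is the holomorphic Jacobian matrix of $H$. The empty germ is regarded as having codimension at least $2$. Levi form: if $M'$ is defined near $p'$ by a smooth real-valued function $\rho'$ with $\rho'=0$, $d\rho'\neq 0$ on $M'$, the Levi form of $M'$ at $p'$ is the restriction of the Hermitian form with matrix $(\partial^2\rho'/\partial Z_i\partial\bar Z_j)(p')$ to the space $\{c\in\mathbb{C}^{N+1}:\sum_j \frac{\partial \rho'}{\partial Z_j}(p')c_j=0\}\cong T^{(1,0)}_{p'}M'$; $r$ is its rank. Transversality: $H$ is transversal to $M'$ at $p$ if $H(p)\in M'$ and $T_{H(p)}M'+dH(T_p\mathbb{C}^{n+1})=T_{H(p)}\mathbb{C}^{N+1}$ (real tangent spaces). *)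

theory Defs
  imports "HOL-Analysis.Analysis" "HOL-Library.Extended_Nat"
begin

section \<open>Smooth real hypersurfaces\<close>

fun higher_differentiable_on ::
    "'a::real_normed_vector set \<Rightarrow> ('a \<Rightarrow> 'b::real_normed_vector) \<Rightarrow> nat \<Rightarrow> bool" where
  "higher_differentiable_on S f 0 \<longleftrightarrow> continuous_on S f"
| "higher_differentiable_on S f (Suc k) \<longleftrightarrow>
     (\<forall>x\<in>S. f differentiable (at x)) \<and>
     (\<forall>v. higher_differentiable_on S (\<lambda>x. frechet_derivative f (at x) v) k)"

text \<open>The class \<open>C\<^sup>\<infinity>\<close> on an open set. The derivatives are real ones, also on complex spaces.\<close>

definition smooth_on ::
    "'a::real_normed_vector set \<Rightarrow> ('a \<Rightarrow> 'b::real_normed_vector) \<Rightarrow> bool" where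
  "smooth_on S f \<longleftrightarrow> (\<forall>k. higher_differentiable_on S f k)"

definition local_defining_function ::
    "(complex^'n) set \<Rightarrow> complex^'n \<Rightarrow> (complex^'n) set \<Rightarrow> (complex^'n \<Rightarrow> real) \<Rightarrow> bool" where
  "local_defining_function M q U \<rho> \<longleftrightarrow>
     open U \<and> q \<in> U \<and> smooth_on U \<rho> \<and> M \<inter> U = {z \<in> U. \<rho> z = 0} \<and>
     (\<forall>z \<in> M \<inter> U. \<exists>v. frechet_derivative \<rho> (at z) v \<noteq> 0)"

definition smooth_real_hypersurface :: "(complex^'n) set \<Rightarrow> bool" where
  "smooth_real_hypersurface M \<longleftrightarrow> (\<forall>q\<in>M. \<exists>U \<rho>. local_defining_function M q U \<rho>)"

text \<open>The real tangent space, as the set of velocities at \<open>q\<close> of curves in \<open>M\<close>. For a smooth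
  hypersurface it makes no difference whether the curves are required to be smooth or only
  differentiable at \<open>0\<close>: in both cases one gets the kernel of the differential of a defining
  function.\<close>

definition tangent_space :: "(complex^'n) set \<Rightarrow> complex^'n \<Rightarrow> (complex^'n) set" where
  "tangent_space M q =
     {v. \<exists>\<gamma> :: real \<Rightarrow> complex^'n. \<gamma> 0 = q \<and> (\<forall>\<^sub>F t in nhds 0. \<gamma> t \<in> M) \<and>
           (\<gamma> has_vector_derivative v) (at 0)}"

section \<open>Wirtinger derivatives and the Levi form\<close>

text \<open>\<open>\<partial>/\<partial>Z\<^sub>j = (\<partial>/\<partial>x\<^sub>j - \<i> \<partial>/\<partial>y\<^sub>j) / 2\<close> and its conjugate, where \<open>Z\<^sub>j = x\<^sub>j + \<i> y\<^sub>j\<close>.\<close>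

definition dZ :: "'n \<Rightarrow> (complex^'n \<Rightarrow> complex) \<Rightarrow> complex^'n \<Rightarrow> complex" where
  "dZ j f z = (frechet_derivative f (at z) (axis j 1)
                 - \<i> * frechet_derivative f (at z) (axis j \<i>)) / 2"

definition dZbar :: "'n \<Rightarrow> (complex^'n \<Rightarrow> complex) \<Rightarrow> complex^'n \<Rightarrow> complex" where
  "dZbar j f z = (frechet_derivative f (at z) (axis j 1)
                    + \<i> * frechet_derivative f (at z) (axis j \<i>)) / 2"

definition holomorphic_tangent_space ::
    "(complex^'n \<Rightarrow> real) \<Rightarrow> complex^'n \<Rightarrow> (complex^'n) set" where
  "holomorphic_tangent_space \<rho> q =
     {c. (\<Sum>j\<in>UNIV. dZ j (\<lambda>z. of_real (\<rho> z)) q * c $ j) = 0}"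

definition complex_hessian ::
    "(complex^'n \<Rightarrow> real) \<Rightarrow> complex^'n \<Rightarrow> complex^'n^'n" where
  "complex_hessian \<rho> q = (\<chi> i j. dZ i (dZbar j (\<lambda>z. of_real (\<rho> z))) q)"

definition levi_form ::
    "(complex^'n \<Rightarrow> real) \<Rightarrow> complex^'n \<Rightarrow> complex^'n \<Rightarrow> complex^'n \<Rightarrow> complex" where
  "levi_form \<rho> q c d =
     (\<Sum>i\<in>UNIV. \<Sum>j\<in>UNIV. complex_hessian \<rho> q $ i $ j * c $ i * cnj (d $ j))"

text \<open>The rank of a Hermitian form \<open>B\<close> on a complex linear subspace \<open>V\<close> is the codimension in \<open>V\<close>
  of the radical of the restriction of \<open>B\<close> to \<open>V\<close>; \<open>vec.dim\<close> is the complex dimension.\<close>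

definition form_rank ::
    "(complex^'n) set \<Rightarrow> (complex^'n \<Rightarrow> complex^'n \<Rightarrow> complex) \<Rightarrow> nat" where
  "form_rank V B = vec.dim V - vec.dim {c \<in> V. \<forall>d\<in>V. B c d = 0}"

definition levi_rank :: "(complex^'n \<Rightarrow> real) \<Rightarrow> complex^'n \<Rightarrow> nat" where
  "levi_rank \<rho> q = form_rank (holomorphic_tangent_space \<rho> q) (levi_form \<rho> q)"

section \<open>Holomorphic maps\<close>

text \<open>Complex differentiability at every point of an open set: the real derivative exists and is
  complex linear.\<close>

definition holomorphic_map_on ::
    "(complex^'n) set \<Rightarrow> (complex^'n \<Rightarrow> complex^'m) \<Rightarrow> bool" where
  "holomorphic_map_on S H \<longleftrightarrow>
     (\<forall>z\<in>S. \<exists>A :: complex^'n^'m. (H has_derivative (\<lambda>v. A *v v)) (at z))"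

definition holomorphic_jacobian ::
    "(complex^'n \<Rightarrow> complex^'m) \<Rightarrow> complex^'n \<Rightarrow> complex^'n^'m" where
  "holomorphic_jacobian H z = (\<chi> i j. dZ j (\<lambda>w. H w $ i) z)"

definition degeneracy_locus ::
    "(complex^'n) set \<Rightarrow> (complex^'n \<Rightarrow> complex^'m) \<Rightarrow> (complex^'n) set" where
  "degeneracy_locus S H = {z \<in> S. rank (holomorphic_jacobian H z) < CARD('n)}"

definition transversal_at ::
    "(complex^'n \<Rightarrow> complex^'m) \<Rightarrow> (complex^'m) set \<Rightarrow> complex^'n \<Rightarrow> bool" where
  "transversal_at H M' p \<longleftrightarrow> H p \<in> M' \<and>
     {u + frechet_derivative H (at p) w | u w. u \<in> tangent_space M' (H p)} = UNIV"

section \<open>Codimension of a germ of an analytic set\<close>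

definition biholomorphic_on :: "(complex^'n) set \<Rightarrow> (complex^'n \<Rightarrow> complex^'n) \<Rightarrow> bool" where
  "biholomorphic_on U \<phi> \<longleftrightarrow> inj_on \<phi> U \<and> open (\<phi> ` U) \<and> holomorphic_map_on U \<phi> \<and>
     holomorphic_map_on (\<phi> ` U) (inv_into U \<phi>)"

text \<open>\<open>q\<close> is a regular point of \<open>A\<close> of dimension \<open>d\<close>: near \<open>q\<close>, \<open>A\<close> is a complex submanifold of
  dimension \<open>d\<close>.\<close>

definition regular_point :: "(complex^'n) set \<Rightarrow> complex^'n \<Rightarrow> nat \<Rightarrow> bool" where
  "regular_point A q d \<longleftrightarrow> q \<in> A \<and>
     (\<exists>U \<phi> L. open U \<and> q \<in> U \<and> biholomorphic_on U \<phi> \<and>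
        vec.subspace L \<and> vec.dim L = d \<and> \<phi> q = 0 \<and> \<phi> ` (A \<inter> U) = \<phi> ` U \<inter> L)"

text \<open>The codimension at \<open>p\<close> of an analytic set \<open>A\<close> is the least codimension of \<open>A\<close> at regular points
  of \<open>A\<close> arbitrarily close to \<open>p\<close>, i.e. the lower limit of these codimensions. The empty germ has no
  regular points and hence codimension \<open>\<infinity>\<close>, as \<open>Inf {} = \<infinity>\<close> in \<^typ>\<open>enat\<close>.\<close>

definition germ_codim :: "(complex^'n) set \<Rightarrow> complex^'n \<Rightarrow> enat" where
  "germ_codim A p =
     Sup {Inf {enat (CARD('n) - d) | q d. q \<in> U \<and> regular_point A q d} | U. open U \<and> p \<in> U}"

end

theory Submission
  imports Defs "HOL-Complex_Analysis.Complex_Analysis"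
begin

no_notation fps_nth (infixl "$" 75)

text \<open>Let \<open>\<rho>\<close> and \<open>\<rho>'\<close> define \<open>M\<close> and \<open>M'\<close>. On \<open>M\<close> one has \<open>d(\<rho>' \<circ> H) = a d\<rho>\<close> for a smooth
  function \<open>a\<close>, and \<open>H\<close> is transversal at \<open>p\<close> iff \<open>a(p) \<noteq> 0\<close>. Modulo \<open>a\<close>, the Levi form of \<open>M'\<close>
  vanishes on the pull-back of the (1,0)-tangent space of \<open>M\<close>; the hypothesis on \<open>r\<close> then yields, by a count of ranks, that
  \<open>\<Delta>\<^sub>1 cnj \<Delta>\<^sub>2\<close> is divisible by \<open>a\<close> on \<open>M\<close> for all maximal minors \<open>\<Delta>\<^sub>1\<close>, \<open>\<Delta>\<^sub>2\<close> of the Jacobian of \<open>H\<close>.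
  Project along a complex line on which some minor does not vanish identically. If \<open>W\<^sub>H\<close> missed a
  fibre near \<open>p\<close>, then norms along the fibres would give a power of a coordinate \<open>x\<close> in the ideal of the minors;
  so \<open>a\<close> would divide a power of \<open>x cnj x\<close>, which forces \<open>a(p) \<noteq> 0\<close>. Hence if \<open>a(p) = 0\<close>, then \<open>W\<^sub>H\<close>
  meets every fibre near \<open>p\<close> and so has codimension one.\<close>

section \<open>Calculus of smooth functions\<close>

text \<open>The count of ranks: an invertible matrix of size N + 1 is obtained from the complex
  Hessian of \<open>\<rho>'\<close> by adding two terms that contain the differential of
  \<open>\<rho>'\<close> and N - r terms of rank one. Pulled back by H and reduced modulo a, on M it
  becomes a sum of 2 + (N - r) matrices of rank one. Since N - n unit columns complete the Jacobian
  to a square matrix, a null vector supported on the Jacobian columns has to solve 2 + (N - r) + (N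
  - n) linear equations in n + 1 unknowns, and 2N - r \<le> 2n - 2 says exactly that there are fewer
  equations than unknowns. The obstacle is that a is merely smooth, so that unique factorization
  says nothing about its divisors. Divisibility is kept as an identity with a smooth cofactor and
  exploited by differentiating along M. The Levi form is sesquilinear, hence the conjugate on one
  minor and the power of x cnj x. The differentiation takes place where x = 0 but away from p: there
  a is nonzero, because the chosen minor has at most an isolated zero at p on the line through p.
  Codimension is measured at regular points, so an actual submanifold piece of the degeneracy locus
  has to be exhibited.\<close>

abbreviation Dv :: "('a::real_normed_vector \<Rightarrow> 'b::real_normed_vector) \<Rightarrow> 'a \<Rightarrow> 'a \<Rightarrow> 'b" where
  "Dv f v x \<equiv> frechet_derivative f (at x) v"

lemma Dv_eqI: "(f has_derivative f') (at x) \<Longrightarrow> Dv f v x = f' v"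
  by (simp add: frechet_derivative_at[symmetric])

lemma Dv_works: "f differentiable (at x) \<Longrightarrow> (f has_derivative (\<lambda>v. Dv f v x)) (at x)"
  using frechet_derivative_works by blast

lemma Dv_cong_open:
  assumes "open S" "x \<in> S" "\<And>y. y \<in> S \<Longrightarrow> f y = g y"
  shows "Dv f v x = Dv g v x"
proof -
  have "(f has_derivative d) (at x) \<longleftrightarrow> (g has_derivative d) (at x)" for d
    using assms has_derivative_transform_within_open[of _ d x UNIV S] by metis
  then show ?thesis
    by (simp add: frechet_derivative_def)
qed

lemma differentiable_cong_open:
  assumes "open S" "x \<in> S" "\<And>y. y \<in> S \<Longrightarrow> f y = g y"
  shows "f differentiable (at x) \<longleftrightarrow> g differentiable (at x)"
  unfolding differentiable_def
  using assms has_derivative_transform_within_open[of _ _ x UNIV S] by metis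

lemma higher_differentiable_on_cong:
  assumes "open S" "\<And>x. x \<in> S \<Longrightarrow> f x = g x"
  shows "higher_differentiable_on S f k \<longleftrightarrow> higher_differentiable_on S g k"
  using assms(2)
proof (induction k arbitrary: f g)
  case 0
  then show ?case using continuous_on_cong[of S S f g] by simp
next
  case (Suc k)
  have "higher_differentiable_on S (Dv f v) k \<longleftrightarrow> higher_differentiable_on S (Dv g v) k" for v
    by (rule Suc.IH) (rule Dv_cong_open[OF assms(1)], use Suc.prems in auto)
  moreover have "f differentiable (at x) \<longleftrightarrow> g differentiable (at x)" if "x \<in> S" for x
    by (rule differentiable_cong_open[OF assms(1) that]) (use Suc.prems in auto)
  ultimately show ?case by simp
qed

lemma higher_differentiable_on_Suc_imp:
  "higher_differentiable_on S f (Suc k) \<Longrightarrow> higher_differentiable_on S f k"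
proof (induction k arbitrary: f)
  case 0
  then show ?case
    by (auto intro!: continuous_at_imp_continuous_on differentiable_imp_continuous_within)
next
  case (Suc k)
  then show ?case by (metis higher_differentiable_on.simps(2))
qed

lemma higher_differentiable_on_subset:
  "higher_differentiable_on S f k \<Longrightarrow> T \<subseteq> S \<Longrightarrow> higher_differentiable_on T f k"
  by (induction k arbitrary: f) (auto intro: continuous_on_subset)

lemma higher_differentiable_on_const: "higher_differentiable_on S (\<lambda>x. c) k"
proof (induction k arbitrary: c)
  case (Suc k)
  have "Dv (\<lambda>x. c) v = (\<lambda>x. 0)" for v :: 'a
    by (rule ext) simp
  then show ?case using Suc by simp
qed simp

lemma higher_differentiable_on_bounded_linear:
  assumes "open S" "bounded_linear L" "higher_differentiable_on S f k"
  shows "higher_differentiable_on S (\<lambda>x. L (f x)) k"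
  using assms(3)
proof (induction k arbitrary: f)
  case 0
  then show ?case
    using bounded_linear.continuous_on[OF assms(2)] by auto
next
  case (Suc k)
  have d: "((\<lambda>x. L (f x)) has_derivative (\<lambda>v. L (Dv f v x))) (at x)" if "x \<in> S" for x
    using Suc.prems that by (auto intro!: bounded_linear.has_derivative[OF assms(2)] Dv_works)
  have "higher_differentiable_on S (Dv (\<lambda>x. L (f x)) v) k" for v
    using Suc.IH[of "Dv f v"] Suc.prems
    by (subst higher_differentiable_on_cong[OF assms(1) Dv_eqI[OF d]]) auto
  then show ?case
    using d by (auto simp: differentiable_def)
qed

lemma higher_differentiable_on_add:
  assumes "open S" "higher_differentiable_on S f k" "higher_differentiable_on S g k"
  shows "higher_differentiable_on S (\<lambda>x. f x + g x) k"
  using assms(2,3)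
proof (induction k arbitrary: f g)
  case 0
  then show ?case by (auto intro: continuous_on_add)
next
  case (Suc k)
  have d: "((\<lambda>x. f x + g x) has_derivative (\<lambda>v. Dv f v x + Dv g v x)) (at x)" if "x \<in> S" for x
    using Suc.prems that by (auto intro!: has_derivative_add Dv_works)
  have "higher_differentiable_on S (Dv (\<lambda>x. f x + g x) v) k" for v
    using Suc.IH[of "Dv f v" "Dv g v"] Suc.prems
    by (subst higher_differentiable_on_cong[OF assms(1) Dv_eqI[OF d]]) auto
  then show ?case
    using d by (auto simp: differentiable_def)
qed

lemma higher_differentiable_on_bilinear:
  assumes "open S" "bounded_bilinear B" "higher_differentiable_on S f k" "higher_differentiable_on S g k"
  shows "higher_differentiable_on S (\<lambda>x. B (f x) (g x)) k"
  using assms(3,4)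
proof (induction k arbitrary: f g)
  case 0
  then show ?case using bounded_bilinear.continuous_on[OF assms(2)] by auto
next
  case (Suc k)
  have d: "((\<lambda>x. B (f x) (g x)) has_derivative (\<lambda>v. B (f x) (Dv g v x) + B (Dv f v x) (g x))) (at x)"
    if "x \<in> S" for x
    using Suc.prems that by (auto intro!: bounded_bilinear.FDERIV[OF assms(2)] Dv_works)
  have "higher_differentiable_on S f k" "higher_differentiable_on S g k"
    using Suc.prems higher_differentiable_on_Suc_imp by auto
  then have "higher_differentiable_on S (Dv (\<lambda>x. B (f x) (g x)) v) k" for v
    using Suc.prems
    by (subst higher_differentiable_on_cong[OF assms(1) Dv_eqI[OF d]])
      (auto intro!: higher_differentiable_on_add[OF assms(1)] Suc.IH)
  then show ?case
    using d by (auto simp: differentiable_def)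
qed

lemma higher_differentiable_on_sum:
  assumes "open S" "\<And>i. i \<in> I \<Longrightarrow> higher_differentiable_on S (f i) k"
  shows "higher_differentiable_on S (\<lambda>x. \<Sum>i\<in>I. f i x) k"
  using assms(2)
proof (induction I rule: infinite_finite_induct)
  case (insert i I)
  then have "higher_differentiable_on S (\<lambda>x. f i x + (\<Sum>i\<in>I. f i x)) k"
    by (intro higher_differentiable_on_add[OF assms(1)]) auto
  then show ?case using insert by simp
qed (auto intro: higher_differentiable_on_const)

lemma higher_differentiable_on_inverse:
  fixes f :: "'a::real_normed_vector \<Rightarrow> 'b::real_normed_field"
  assumes "open S" "higher_differentiable_on S f k" "\<And>x. x \<in> S \<Longrightarrow> f x \<noteq> 0"
  shows "higher_differentiable_on S (\<lambda>x. inverse (f x)) k"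
  using assms(2)
proof (induction k)
  case 0
  then show ?case using assms(3) by (auto intro: continuous_on_inverse)
next
  case (Suc k)
  have d: "((\<lambda>x. inverse (f x)) has_derivative (\<lambda>v. - (inverse (f x) * Dv f v x * inverse (f x)))) (at x)"
    if "x \<in> S" for x
    using Suc.prems that assms(3) by (auto intro!: Deriv.has_derivative_inverse Dv_works)
  have *: "higher_differentiable_on S (\<lambda>x. inverse (f x)) k"
    using Suc higher_differentiable_on_Suc_imp by blast
  have "higher_differentiable_on S (\<lambda>x. - (inverse (f x) * Dv f v x * inverse (f x))) k" for v
    using Suc.prems *
    by (intro higher_differentiable_on_bounded_linear[OF assms(1) bounded_linear_minus[OF bounded_linear_ident]]
       higher_differentiable_on_bilinear[OF assms(1) bounded_bilinear_mult]) auto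
  then have "higher_differentiable_on S (Dv (\<lambda>x. inverse (f x)) v) k" for v
    by (subst higher_differentiable_on_cong[OF assms(1) Dv_eqI[OF d]]) auto
  then show ?case
    using d by (auto simp: differentiable_def)
qed

text \<open>The chain rule differentiates \<open>f\<close> in the direction \<open>Dv g v x\<close>,
  which moves with \<open>x\<close>, whereas the recursion knows only fixed directions. Expanding
  this direction over \<open>Basis\<close> leaves the functions \<open>Dv f b\<close> with fixed
  \<open>b\<close>, to which the induction hypothesis applies.\<close>

lemma higher_differentiable_on_compose:
  fixes f :: "'b::euclidean_space \<Rightarrow> 'c::real_normed_vector" and g :: "'a::real_normed_vector \<Rightarrow> 'b"
  assumes "open S" "higher_differentiable_on T f k" "higher_differentiable_on S g k" "g ` S \<subseteq> T"
  shows "higher_differentiable_on S (\<lambda>x. f (g x)) k"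
  using assms(2,3)
proof (induction k arbitrary: f)
  case 0
  then show ?case using assms(4) by (auto intro: continuous_on_compose2)
next
  case (Suc k)
  have d: "((\<lambda>x. f (g x)) has_derivative (\<lambda>v. \<Sum>b\<in>Basis. (Dv g v x \<bullet> b) *\<^sub>R Dv f b (g x))) (at x)"
    if "x \<in> S" for x
  proof -
    have df: "f differentiable (at (g x))" and dg: "g differentiable (at x)"
      using Suc.prems assms(4) that by auto
    have lin: "linear (\<lambda>v. Dv f v (g x))"
      using linear_frechet_derivative[OF df] by simp
    have "Dv f w (g x) = (\<Sum>b\<in>Basis. (w \<bullet> b) *\<^sub>R Dv f b (g x))" for w
      using euclidean_representation[of w] linear_sum[OF lin] linear_scale[OF lin] 
      by (metis (no_types, lifting) sum.cong)
    moreover have "((\<lambda>x. f (g x)) has_derivative (\<lambda>v. Dv f (Dv g v x) (g x))) (at x)"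
      using has_derivative_compose[OF Dv_works[OF dg] Dv_works[OF df]] by simp
    ultimately show ?thesis
      by (metis (no_types, lifting) has_derivative_eq_rhs ext)
  qed
  have g: "higher_differentiable_on S g k"
    using Suc.prems higher_differentiable_on_Suc_imp by auto
  have "higher_differentiable_on S (\<lambda>x. \<Sum>b\<in>Basis. (Dv g v x \<bullet> b) *\<^sub>R Dv f b (g x)) k" for v
    using Suc.prems g
    by (intro higher_differentiable_on_sum assms(1) Suc.IH
       higher_differentiable_on_bounded_linear[OF assms(1) bounded_linear_inner_left]
       higher_differentiable_on_bilinear[OF assms(1) bounded_bilinear_scaleR]) auto
  then have "higher_differentiable_on S (Dv (\<lambda>x. f (g x)) v) k" for v
    by (subst higher_differentiable_on_cong[OF assms(1) Dv_eqI[OF d]]) auto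
  then show ?case
    using d by (auto simp: differentiable_def)
qed

section \<open>Closure properties of the class of smooth functions\<close>

lemma smooth_on_subset: "smooth_on S f \<Longrightarrow> T \<subseteq> S \<Longrightarrow> smooth_on T f"
  by (auto simp: smooth_on_def intro: higher_differentiable_on_subset)

lemma smooth_on_Dv: "smooth_on S f \<Longrightarrow> smooth_on S (Dv f v)"
  unfolding smooth_on_def by (metis higher_differentiable_on.simps(2))

lemma smooth_on_differentiable: "smooth_on S f \<Longrightarrow> x \<in> S \<Longrightarrow> f differentiable (at x)"
  unfolding smooth_on_def by (metis higher_differentiable_on.simps(2))

lemma smooth_on_has_derivative: "smooth_on S f \<Longrightarrow> x \<in> S \<Longrightarrow> (f has_derivative (\<lambda>v. Dv f v x)) (at x)"
  by (simp add: Dv_works smooth_on_differentiable)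

lemma smooth_on_continuous_on: "smooth_on S f \<Longrightarrow> continuous_on S f"
  unfolding smooth_on_def by (metis higher_differentiable_on.simps(1))

lemma smooth_on_const: "smooth_on S (\<lambda>x. c)"
  by (simp add: smooth_on_def higher_differentiable_on_const)

lemma smooth_on_bounded_linear:
  "open S \<Longrightarrow> bounded_linear L \<Longrightarrow> smooth_on S f \<Longrightarrow> smooth_on S (\<lambda>x. L (f x))"
  by (simp add: smooth_on_def higher_differentiable_on_bounded_linear)

lemma smooth_on_ident:
  assumes "open S" shows "smooth_on S (\<lambda>x. x)"
proof -
  have "higher_differentiable_on S (\<lambda>x. x) k" for k
  proof (cases k)
    case (Suc l)
    have "Dv (\<lambda>x. x) v = (\<lambda>x. v)" for v :: 'a
      by (rule ext) simp
    then show ?thesis using Suc by (simp add: higher_differentiable_on_const)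
  qed auto
  then show ?thesis by (simp add: smooth_on_def)
qed

lemma smooth_on_linear: "open S \<Longrightarrow> bounded_linear L \<Longrightarrow> smooth_on S L"
  using smooth_on_bounded_linear[OF _ _ smooth_on_ident] .

lemma smooth_on_add: "open S \<Longrightarrow> smooth_on S f \<Longrightarrow> smooth_on S g \<Longrightarrow> smooth_on S (\<lambda>x. f x + g x)"
  by (simp add: smooth_on_def higher_differentiable_on_add)

lemma smooth_on_minus: "open S \<Longrightarrow> smooth_on S f \<Longrightarrow> smooth_on S (\<lambda>x. - f x)"
  by (rule smooth_on_bounded_linear[OF _ bounded_linear_minus[OF bounded_linear_ident]])

lemma smooth_on_diff: "open S \<Longrightarrow> smooth_on S f \<Longrightarrow> smooth_on S g \<Longrightarrow> smooth_on S (\<lambda>x. f x - g x)"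
  using smooth_on_add[of S f "\<lambda>x. - g x"] smooth_on_minus[of S g] by simp

lemma smooth_on_mult:
  fixes f g :: "'a::real_normed_vector \<Rightarrow> 'b::real_normed_algebra"
  shows "open S \<Longrightarrow> smooth_on S f \<Longrightarrow> smooth_on S g \<Longrightarrow> smooth_on S (\<lambda>x. f x * g x)"
  by (simp add: smooth_on_def higher_differentiable_on_bilinear[OF _ bounded_bilinear_mult])

lemma smooth_on_sum:
  "open S \<Longrightarrow> (\<And>i. i \<in> I \<Longrightarrow> smooth_on S (f i)) \<Longrightarrow> smooth_on S (\<lambda>x. \<Sum>i\<in>I. f i x)"
  by (simp add: smooth_on_def higher_differentiable_on_sum)

lemma smooth_on_prod:
  fixes f :: "'i \<Rightarrow> 'a::real_normed_vector \<Rightarrow> 'b::real_normed_field"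
  assumes "open S" "\<And>i. i \<in> I \<Longrightarrow> smooth_on S (f i)"
  shows "smooth_on S (\<lambda>x. \<Prod>i\<in>I. f i x)"
  using assms(2)
proof (induction I rule: infinite_finite_induct)
  case (insert i I)
  then have "smooth_on S (\<lambda>x. f i x * (\<Prod>i\<in>I. f i x))"
    by (intro smooth_on_mult[OF assms(1)]) auto
  then show ?case using insert by simp
qed (auto intro: smooth_on_const)

lemma smooth_on_power:
  fixes f :: "'a::real_normed_vector \<Rightarrow> 'b::real_normed_field"
  assumes "open S" "smooth_on S f"
  shows "smooth_on S (\<lambda>x. f x ^ k)"
  by (induction k) (auto intro: smooth_on_const smooth_on_mult assms)

lemma smooth_on_inverse:
  fixes f :: "'a::real_normed_vector \<Rightarrow> 'b::real_normed_field"
  shows "open S \<Longrightarrow> smooth_on S f \<Longrightarrow> (\<And>x. x \<in> S \<Longrightarrow> f x \<noteq> 0) \<Longrightarrow> smooth_on S (\<lambda>x. inverse (f x))"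
  by (simp add: smooth_on_def higher_differentiable_on_inverse)

lemma smooth_on_divide:
  fixes f g :: "'a::real_normed_vector \<Rightarrow> 'b::real_normed_field"
  shows "open S \<Longrightarrow> smooth_on S f \<Longrightarrow> smooth_on S g \<Longrightarrow> (\<And>x. x \<in> S \<Longrightarrow> g x \<noteq> 0) \<Longrightarrow> smooth_on S (\<lambda>x. f x / g x)"
  by (simp add: divide_inverse smooth_on_mult smooth_on_inverse)

lemma smooth_on_compose:
  fixes f :: "'b::euclidean_space \<Rightarrow> 'c::real_normed_vector" and g :: "'a::real_normed_vector \<Rightarrow> 'b"
  shows "open S \<Longrightarrow> smooth_on T f \<Longrightarrow> smooth_on S g \<Longrightarrow> g ` S \<subseteq> T \<Longrightarrow> smooth_on S (\<lambda>x. f (g x))"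
  by (auto simp: smooth_on_def intro: higher_differentiable_on_compose)

lemma smooth_on_of_real: "open S \<Longrightarrow> smooth_on S f \<Longrightarrow> smooth_on S (\<lambda>x. complex_of_real (f x))"
  by (rule smooth_on_bounded_linear[OF _ bounded_linear_of_real])

lemma smooth_on_cnj: "open S \<Longrightarrow> smooth_on S f \<Longrightarrow> smooth_on S (\<lambda>x. cnj (f x))"
  by (rule smooth_on_bounded_linear[OF _ bounded_linear_cnj])

lemma smooth_on_nth: "open S \<Longrightarrow> smooth_on S f \<Longrightarrow> smooth_on S (\<lambda>x. f x $ i)"
  by (rule smooth_on_bounded_linear[OF _ bounded_linear_vec_nth])

text \<open>Meant for the class of holomorphic functions, which is closed under directional
  derivatives by Cauchy's formula.\<close>

lemma smooth_on_coinduct: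
  assumes "f \<in> C" "\<And>f x. f \<in> C \<Longrightarrow> x \<in> S \<Longrightarrow> f differentiable (at x)"
    and "\<And>f v. f \<in> C \<Longrightarrow> Dv f v \<in> C"
  shows "smooth_on S f"
proof -
  have "higher_differentiable_on S f k" for k
    using assms(1)
  proof (induction k arbitrary: f)
    case 0
    then show ?case
      using assms(2) by (simp add: continuous_at_imp_continuous_on differentiable_imp_continuous_within)
  next
    case (Suc k)
    then show ?case using assms(2,3) by simp
  qed
  then show ?thesis by (simp add: smooth_on_def)
qed

lemmas smooth_intros = smooth_on_const smooth_on_ident smooth_on_add smooth_on_minus smooth_on_diff
  smooth_on_mult smooth_on_sum smooth_on_prod smooth_on_power smooth_on_divide smooth_on_of_real
  smooth_on_cnj smooth_on_nth

section \<open>Tangent vectors of a level set\<close>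

text \<open>On the segment with parameters between \<open>- \<eta> * \<bar>t\<bar>\<close> and
  \<open>\<eta> * \<bar>t\<bar>\<close> in direction \<open>e\<close>, the linear part of
  \<open>\<rho>\<close> takes values of both signs at the ends, as \<open>D v = 0\<close>. The
  remainder is too small to change these signs, so the intermediate value theorem gives a
  zero.\<close>

lemma zero_near_tangent:
  fixes \<rho> :: "'a::real_normed_vector \<Rightarrow> real"
  assumes "open U" "q \<in> U" "continuous_on U \<rho>" "(\<rho> has_derivative D) (at q)" "\<rho> q = 0"
    and De: "D e \<noteq> 0" and "D v = 0" and \<eta>: "\<eta> > 0"
  obtains \<delta> where "\<delta> > 0"
    "\<And>t. \<bar>t\<bar> < \<delta> \<Longrightarrow> \<exists>\<tau>. \<bar>\<tau>\<bar> \<le> \<eta> * \<bar>t\<bar> \<and> q + t *\<^sub>R v + \<tau> *\<^sub>R e \<in> U \<and> \<rho> (q + t *\<^sub>R v + \<tau> *\<^sub>R e) = 0"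
proof -
  define C where "C = norm v + \<eta> * norm e + 1"
  have C: "C > 0" unfolding C_def using \<eta> by (simp add: add_nonneg_pos)
  \<comment> \<open>\<open>C * \<bar>t\<bar>\<close> bounds the displacements, so this
    \<open>\<epsilon>\<close> makes the remainder at most half of the linear part at the ends of the
    segment.\<close>
  define \<epsilon> where "\<epsilon> = \<eta> * \<bar>D e\<bar> / (2 * C)"
  have \<epsilon>: "\<epsilon> > 0" unfolding \<epsilon>_def using \<eta> De C by simp
  obtain d1 where d1: "d1 > 0" "ball q d1 \<subseteq> U"
    using assms(1,2) open_contains_ball by blast
  obtain d2 where d2: "d2 > 0"
    "\<And>y. norm (y - q) < d2 \<Longrightarrow> norm (\<rho> y - \<rho> q - D (y - q)) \<le> \<epsilon> * norm (y - q)"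
    using assms(4) \<epsilon> unfolding has_derivative_at_alt by blast
  have lin: "linear D" using assms(4) has_derivative_linear by blast
  define \<delta> where "\<delta> = min d1 d2 / C"
  have \<delta>: "\<delta> > 0" unfolding \<delta>_def using d1 d2 C by simp
  have "\<exists>\<tau>. \<bar>\<tau>\<bar> \<le> \<eta> * \<bar>t\<bar> \<and> q + t *\<^sub>R v + \<tau> *\<^sub>R e \<in> U \<and> \<rho> (q + t *\<^sub>R v + \<tau> *\<^sub>R e) = 0"
    if t: "\<bar>t\<bar> < \<delta>" for t
  proof (cases "t = 0")
    case True
    then show ?thesis using assms(2,5) by (intro exI[of _ 0]) simp
  next
    case False
    define h where "h = (\<lambda>s. \<rho> (q + t *\<^sub>R v + s *\<^sub>R e))"
    have nrm: "norm (t *\<^sub>R v + s *\<^sub>R e) \<le> \<bar>t\<bar> * (C - 1)" if "\<bar>s\<bar> \<le> \<eta> * \<bar>t\<bar>" for s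
    proof -
      have "norm (t *\<^sub>R v + s *\<^sub>R e) \<le> \<bar>t\<bar> * norm v + \<bar>s\<bar> * norm e"
        by (metis norm_scaleR norm_triangle_ineq)
      also have "\<bar>s\<bar> * norm e \<le> (\<eta> * \<bar>t\<bar>) * norm e"
        using that by (intro mult_right_mono) auto
      finally show ?thesis by (simp add: C_def algebra_simps)
    qed
    have tC: "\<bar>t\<bar> * (C - 1) < min d1 d2"
    proof -
      have "\<bar>t\<bar> * (C - 1) \<le> \<bar>t\<bar> * C" by (intro mult_left_mono) auto
      also have "\<dots> < min d1 d2" using t C unfolding \<delta>_def by (simp add: field_simps)
      finally show ?thesis .
    qed
    have inU: "q + t *\<^sub>R v + s *\<^sub>R e \<in> U" if "\<bar>s\<bar> \<le> \<eta> * \<bar>t\<bar>" for s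
    proof -
      have "dist q (q + t *\<^sub>R v + s *\<^sub>R e) = norm (t *\<^sub>R v + s *\<^sub>R e)"
        by (metis add.assoc dist_add_cancel dist_0_norm add_0_right)
      then show ?thesis using nrm[OF that] tC d1(2) by (auto simp: subset_iff)
    qed
    have est: "\<bar>h s - s * D e\<bar> < \<eta> * \<bar>D e\<bar> * \<bar>t\<bar>" if "\<bar>s\<bar> \<le> \<eta> * \<bar>t\<bar>" for s
    proof -
      let ?y = "q + t *\<^sub>R v + s *\<^sub>R e"
      have y: "?y - q = t *\<^sub>R v + s *\<^sub>R e" by simp
      have "\<bar>h s - s * D e\<bar> \<le> \<epsilon> * norm (t *\<^sub>R v + s *\<^sub>R e)"
        using d2(2)[of ?y] nrm[OF that] tC assms(5,7) unfolding y
        by (simp add: h_def linear_add[OF lin] linear_scale[OF lin])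
      also have "\<dots> \<le> \<epsilon> * (\<bar>t\<bar> * C)"
        using nrm[OF that] \<epsilon> by (intro mult_left_mono) (auto simp: algebra_simps)
      also have "\<dots> = \<eta> * \<bar>D e\<bar> * \<bar>t\<bar> / 2" unfolding \<epsilon>_def using C by (simp add: field_simps)
      also have "\<dots> < \<eta> * \<bar>D e\<bar> * \<bar>t\<bar>" using \<eta> De False by simp
      finally show ?thesis .
    qed
    define m where "m = \<eta> * \<bar>t\<bar>"
    have m: "m > 0" unfolding m_def using \<eta> False by simp
    have cont: "continuous_on {- m..m} h"
      unfolding h_def
      by (rule continuous_on_compose2[OF assms(3)]) (auto intro!: continuous_intros inU simp: m_def)
    have e1: "\<bar>h m - m * D e\<bar> < m * \<bar>D e\<bar>" and e2: "\<bar>h (- m) + m * D e\<bar> < m * \<bar>D e\<bar>"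
      using est[of m] est[of "- m"] m by (auto simp: m_def algebra_simps)
    have "\<exists>s\<ge>- m. s \<le> m \<and> h s = 0"
    proof (cases "D e > 0")
      case True
      then show ?thesis using e1 e2 m cont by (intro IVT') auto
    next
      case F: False
      then have "\<bar>D e\<bar> = - D e" by simp
      then show ?thesis using e1 e2 m cont by (intro IVT2') auto
    qed
    then obtain s where s: "- m \<le> s" "s \<le> m" "h s = 0" by blast
    then have "\<bar>s\<bar> \<le> m" by linarith
    with s show ?thesis using inU by (auto simp: h_def m_def)
  qed
  then show thesis using that \<delta> by blast
qed

text \<open>By \<open>zero_near_tangent\<close> there are zeros of \<open>\<rho>\<close> at
  displacement \<open>t *\<^sub>R v\<close> from \<open>q\<close>, up to an error
  \<open>\<epsilon> * t\<close> in direction \<open>e\<close>. Since \<open>F\<close> vanishes there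
  and at \<open>q\<close>, its derivative along the displacement is small compared with
  \<open>t\<close>; dividing by \<open>t\<close> bounds \<open>L v\<close> by a multiple of
  \<open>\<epsilon>\<close>.\<close>

lemma derivative_eq_0_of_vanishing:
  fixes \<rho> :: "'a::real_normed_vector \<Rightarrow> real" and F :: "'a \<Rightarrow> 'b::real_normed_vector"
  assumes "open U" "q \<in> U" "continuous_on U \<rho>" "(\<rho> has_derivative D) (at q)" "\<rho> q = 0"
    and De: "D e \<noteq> 0" and Dv: "D v = 0"
    and F: "(F has_derivative L) (at q)" "\<And>y. y \<in> U \<Longrightarrow> \<rho> y = 0 \<Longrightarrow> F y = 0"
  shows "L v = 0"
proof -
  have lin: "linear L" using F(1) has_derivative_linear by blast
  have bound: "norm (L v) \<le> \<epsilon> * (norm (L e) + norm v + norm e)" if \<epsilon>: "0 < \<epsilon>" "\<epsilon> \<le> 1" for \<epsilon>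
  proof -
    obtain d where d: "d > 0"
      "\<And>y. norm (y - q) < d \<Longrightarrow> norm (F y - F q - L (y - q)) \<le> \<epsilon> * norm (y - q)"
      using F(1) \<epsilon> unfolding has_derivative_at_alt by blast
    obtain \<delta> where \<delta>: "\<delta> > 0"
      "\<And>t. \<bar>t\<bar> < \<delta> \<Longrightarrow> \<exists>\<tau>. \<bar>\<tau>\<bar> \<le> \<epsilon> * \<bar>t\<bar> \<and> q + t *\<^sub>R v + \<tau> *\<^sub>R e \<in> U \<and> \<rho> (q + t *\<^sub>R v + \<tau> *\<^sub>R e) = 0"
      using zero_near_tangent[OF assms(1-7) \<epsilon>(1)] by blast
    define t where "t = min (\<delta> / 2) (d / (2 * (norm v + norm e + 1)))"
    have pos: "norm v + norm e + 1 > 0" by (simp add: add_nonneg_pos)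
    have t: "t > 0" "\<bar>t\<bar> < \<delta>" "t * (norm v + norm e + 1) < d"
    proof -
      show "t > 0" "\<bar>t\<bar> < \<delta>" unfolding t_def using \<delta>(1) d(1) pos by auto
      have "t * (norm v + norm e + 1) \<le> (d / (2 * (norm v + norm e + 1))) * (norm v + norm e + 1)"
        unfolding t_def using pos by (intro mult_right_mono) auto
      also have "\<dots> = d / 2" using pos by (simp add: field_simps)
      finally show "t * (norm v + norm e + 1) < d" using d by simp
    qed
    obtain \<tau> where \<tau>: "\<bar>\<tau>\<bar> \<le> \<epsilon> * t" "q + t *\<^sub>R v + \<tau> *\<^sub>R e \<in> U" "\<rho> (q + t *\<^sub>R v + \<tau> *\<^sub>R e) = 0"
      using \<delta>(2)[OF t(2)] t(1) by auto
    let ?y = "q + t *\<^sub>R v + \<tau> *\<^sub>R e"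
    have y: "?y - q = t *\<^sub>R v + \<tau> *\<^sub>R e" by simp
    have \<tau>t: "\<bar>\<tau>\<bar> \<le> t" using \<tau>(1) \<epsilon> t(1) by (meson mult_left_le_one_le less_eq_real_def order_trans)
    have n: "norm (?y - q) \<le> t * (norm v + norm e)"
    proof -
      have "norm (?y - q) \<le> \<bar>t\<bar> * norm v + \<bar>\<tau>\<bar> * norm e"
        unfolding y by (metis norm_scaleR norm_triangle_ineq)
      also have "\<bar>\<tau>\<bar> * norm e \<le> t * norm e" using \<tau>t by (intro mult_right_mono) auto
      finally show ?thesis using t(1) by (simp add: algebra_simps)
    qed
    also have "\<dots> \<le> t * (norm v + norm e + 1)" using t(1) by simp
    finally have "norm (?y - q) < d" using t(3) by simp
    from d(2)[OF this] have "norm (L (?y - q)) \<le> \<epsilon> * norm (?y - q)"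
      using F(2)[OF \<tau>(2,3)] F(2)[OF assms(2,5)] by simp
    also have "\<dots> \<le> \<epsilon> * (t * (norm v + norm e))" using n \<epsilon> by (intro mult_left_mono) auto
    finally have a: "norm (L (?y - q)) \<le> \<epsilon> * (t * (norm v + norm e))" .
    have "t *\<^sub>R L v = L (?y - q) - \<tau> *\<^sub>R L e"
      unfolding y by (simp add: linear_add[OF lin] linear_scale[OF lin])
    then have "t * norm (L v) \<le> norm (L (?y - q)) + \<bar>\<tau>\<bar> * norm (L e)"
      using norm_triangle_ineq4[of "L (?y - q)" "\<tau> *\<^sub>R L e"] t(1)
      by (metis abs_of_pos norm_scaleR)
    also have "\<dots> \<le> \<epsilon> * (t * (norm v + norm e)) + \<epsilon> * t * norm (L e)"
      using a \<tau>(1) by (intro add_mono mult_right_mono) auto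
    finally have "t * norm (L v) \<le> t * (\<epsilon> * (norm (L e) + norm v + norm e))"
      by (simp add: algebra_simps)
    then show ?thesis using t(1) by simp
  qed
  define K where "K = norm (L e) + norm v + norm e"
  have K: "K \<ge> 0" unfolding K_def by simp
  have "norm (L v) \<le> 0 + \<epsilon>" if \<epsilon>: "\<epsilon> > 0" for \<epsilon>
  proof -
    define \<epsilon>' where "\<epsilon>' = min 1 (\<epsilon> / (K + 1))"
    have "\<epsilon>' > 0" "\<epsilon>' \<le> 1" unfolding \<epsilon>'_def using \<epsilon> K by auto
    then have "norm (L v) \<le> \<epsilon>' * K" using bound K_def by blast
    also have "\<dots> \<le> (\<epsilon> / (K + 1)) * K" unfolding \<epsilon>'_def using K by (intro mult_right_mono) auto
    also have "\<dots> \<le> \<epsilon>" using K \<epsilon> by (simp add: field_simps)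
    finally show ?thesis by simp
  qed
  then have "norm (L v) \<le> 0" by (rule field_le_epsilon)
  then show ?thesis by simp
qed

lemma tangent_curve_exists:
  fixes \<rho> :: "'a::real_normed_vector \<Rightarrow> real"
  assumes "open U" "q \<in> U" "continuous_on U \<rho>" "(\<rho> has_derivative D) (at q)" "\<rho> q = 0"
    and De: "D e \<noteq> 0" and Dv: "D v = 0"
  shows "\<exists>\<gamma>. \<gamma> 0 = q \<and> (\<forall>\<^sub>F t in nhds 0. \<gamma> t \<in> U \<and> \<rho> (\<gamma> t) = 0) \<and> (\<gamma> has_vector_derivative v) (at 0)"
proof -
  define G where "G t \<tau> \<longleftrightarrow> q + t *\<^sub>R v + \<tau> *\<^sub>R e \<in> U \<and> \<rho> (q + t *\<^sub>R v + \<tau> *\<^sub>R e) = 0" for t \<tau> :: real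
  have G: "\<exists>\<delta>>0. \<forall>t. \<bar>t\<bar> < \<delta> \<longrightarrow> (\<exists>\<tau>. \<bar>\<tau>\<bar> \<le> \<eta> * \<bar>t\<bar> \<and> G t \<tau>)" if "\<eta> > 0" for \<eta>
    using zero_near_tangent[OF assms that] unfolding G_def by metis
  define I where "I t = Inf {\<bar>\<tau>\<bar> | \<tau>. G t \<tau>}" for t
  have bdd: "bdd_below {\<bar>\<tau>\<bar> | \<tau>. G t \<tau>}" for t
    by (rule bdd_belowI[of _ 0]) auto
  have ex: "\<exists>\<tau>. G t \<tau> \<and> \<bar>\<tau>\<bar> \<le> I t + t\<^sup>2" if "\<exists>\<tau>. G t \<tau>" "t \<noteq> 0" for t
  proof -
    have "Inf {\<bar>\<tau>\<bar> | \<tau>. G t \<tau>} < I t + t\<^sup>2" using that by (simp add: I_def)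
    then have "\<exists>x\<in>{\<bar>\<tau>\<bar> | \<tau>. G t \<tau>}. x < I t + t\<^sup>2"
      using cInf_less_iff[OF _ bdd] that by blast
    then show ?thesis by auto
  qed
  obtain \<delta>1 where \<delta>1: "\<delta>1 > 0" "\<And>t. \<bar>t\<bar> < \<delta>1 \<Longrightarrow> \<exists>\<tau>. G t \<tau>"
    using G[of 1] by (metis zero_less_one)
  \<comment> \<open>\<open>zero_near_tangent\<close> gives a zero for each \<eta> separately, while
    the curve needs one choice that is o(t). A zero whose parameter is within
    \<open>t\<^sup>2\<close> of the infimum is nearly as good as each of them, and the infimum does
    not have to be attained.\<close>
  define \<tau> where "\<tau> t = (if t = 0 then 0 else SOME \<tau>. G t \<tau> \<and> \<bar>\<tau>\<bar> \<le> I t + t\<^sup>2)" for t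
  have \<tau>: "G t (\<tau> t) \<and> \<bar>\<tau> t\<bar> \<le> I t + t\<^sup>2" if "\<bar>t\<bar> < \<delta>1" "t \<noteq> 0" for t
    using someI_ex[OF ex[OF \<delta>1(2)]] that by (simp add: \<tau>_def)
  have "(\<tau> has_real_derivative 0) (at 0)"
    unfolding has_field_derivative_def has_derivative_at_alt
  proof (intro conjI allI impI)
    fix \<epsilon> :: real assume \<epsilon>: "\<epsilon> > 0"
    obtain \<delta> where \<delta>: "\<delta> > 0" "\<And>t. \<bar>t\<bar> < \<delta> \<Longrightarrow> \<exists>\<tau>. \<bar>\<tau>\<bar> \<le> \<epsilon> / 2 * \<bar>t\<bar> \<and> G t \<tau>"
      using G[of "\<epsilon> / 2"] \<epsilon> by auto
    show "\<exists>d>0. \<forall>y. norm (y - 0) < d \<longrightarrow> norm (\<tau> y - \<tau> 0 - 0 * (y - 0)) \<le> \<epsilon> * norm (y - 0)"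
    proof (intro exI[of _ "min \<delta> (min \<delta>1 (\<epsilon> / 2))"] conjI allI impI)
      fix t :: real assume "norm (t - 0) < min \<delta> (min \<delta>1 (\<epsilon> / 2))"
      then have t: "\<bar>t\<bar> < \<delta>" "\<bar>t\<bar> < \<delta>1" "\<bar>t\<bar> < \<epsilon> / 2" by auto
      show "norm (\<tau> t - \<tau> 0 - 0 * (t - 0)) \<le> \<epsilon> * norm (t - 0)"
      proof (cases "t = 0")
        case False
        obtain s where s: "\<bar>s\<bar> \<le> \<epsilon> / 2 * \<bar>t\<bar>" "G t s" using \<delta>(2)[OF t(1)] by auto
        have "I t \<le> \<bar>s\<bar>" unfolding I_def using s(2) by (intro cInf_lower bdd) auto
        then have "\<bar>\<tau> t\<bar> \<le> \<epsilon> / 2 * \<bar>t\<bar> + t\<^sup>2" using \<tau>[OF t(2) False] s by linarith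
        also have "t\<^sup>2 = \<bar>t\<bar> * \<bar>t\<bar>" by (simp add: power2_eq_square)
        also have "\<dots> \<le> \<epsilon> / 2 * \<bar>t\<bar>" using t(3) by (intro mult_right_mono) auto
        finally show ?thesis by (simp add: \<tau>_def)
      qed (simp add: \<tau>_def)
    qed (use \<delta> \<delta>1 \<epsilon> in auto)
  qed (rule bounded_linear_mult_right)
  then have \<tau>': "(\<tau> has_vector_derivative 0) (at 0)"
    by (simp add: has_real_derivative_iff_has_vector_derivative)
  define \<gamma> where "\<gamma> t = q + t *\<^sub>R v + \<tau> t *\<^sub>R e" for t
  have "\<gamma> 0 = q" by (simp add: \<gamma>_def \<tau>_def)
  moreover have "(\<gamma> has_vector_derivative (0 + 1 *\<^sub>R v) + 0 *\<^sub>R e) (at 0)"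
    unfolding \<gamma>_def
    by (intro has_vector_derivative_add has_vector_derivative_const)
      (auto simp: has_vector_derivative_def \<tau>'[unfolded has_vector_derivative_def]
        intro!: derivative_eq_intros \<tau>'[unfolded has_vector_derivative_def])
  moreover have "\<forall>\<^sub>F t in nhds (0::real). \<gamma> t \<in> U \<and> \<rho> (\<gamma> t) = 0"
    unfolding eventually_nhds_metric
  proof (intro exI[of _ \<delta>1] conjI allI impI)
    fix t :: real assume "dist t 0 < \<delta>1"
    then have "\<gamma> t \<in> U \<and> \<rho> (\<gamma> t) = 0"
      using \<tau>[of t] assms(2,5) by (cases "t = 0") (auto simp: \<gamma>_def G_def \<tau>_def)
    then show "\<gamma> t \<in> U" "\<rho> (\<gamma> t) = 0" by auto
  qed (rule \<delta>1)
  ultimately show ?thesis by (intro exI[of _ \<gamma>]) simp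
qed

section \<open>Holomorphic functions of several variables\<close>

text \<open>Real linearity of \<open>D\<close> is part of \<open>has_derivative\<close>, so
  homogeneity over the complex scalars is all that has to be added.\<close>

definition hol :: "(complex^'n) set \<Rightarrow> (complex^'n \<Rightarrow> complex) \<Rightarrow> bool" where
  "hol S f \<longleftrightarrow> (\<forall>z\<in>S. \<exists>D. (f has_derivative D) (at z) \<and> (\<forall>c v. D (c *s v) = c * D v))"

lemma hol_has_derivative: "hol S f \<Longrightarrow> z \<in> S \<Longrightarrow> (f has_derivative (\<lambda>v. Dv f v z)) (at z)"
  unfolding hol_def by (metis Dv_works differentiable_def)

lemma hol_Dv_scale: "hol S f \<Longrightarrow> z \<in> S \<Longrightarrow> Dv f (c *s v) z = c * Dv f v z"
  unfolding hol_def by (metis Dv_eqI)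

lemma hol_differentiable: "hol S f \<Longrightarrow> z \<in> S \<Longrightarrow> f differentiable (at z)"
  using hol_has_derivative by (auto simp: differentiable_def)

lemma hol_continuous_on: "hol S f \<Longrightarrow> continuous_on S f"
  by (simp add: continuous_at_imp_continuous_on differentiable_imp_continuous_within hol_differentiable)

lemma hol_subset: "hol S f \<Longrightarrow> T \<subseteq> S \<Longrightarrow> hol T f"
  by (auto simp: hol_def)

lemma hol_cong:
  assumes "open S" "\<And>z. z \<in> S \<Longrightarrow> f z = g z" "hol S f"
  shows "hol S g"
  unfolding hol_def
proof
  fix z assume z: "z \<in> S"
  then obtain D where "(f has_derivative D) (at z)" "\<forall>c v. D (c *s v) = c * D v"
    using assms(3) by (auto simp: hol_def)
  then show "\<exists>D. (g has_derivative D) (at z) \<and> (\<forall>c v. D (c *s v) = c * D v)"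
    using has_derivative_transform_within_open[of f D z UNIV S g] assms z by blast
qed

lemma hol_const: "hol S (\<lambda>z. c)"
  unfolding hol_def by (auto intro!: exI[of _ "\<lambda>v. 0"])

lemma hol_nth: "hol S (\<lambda>z. z $ i)"
  unfolding hol_def
  by (auto intro!: exI[of _ "\<lambda>v. v $ i"] bounded_linear_imp_has_derivative bounded_linear_vec_nth)

lemma hol_add: "hol S f \<Longrightarrow> hol S g \<Longrightarrow> hol S (\<lambda>z. f z + g z)"
  unfolding hol_def
proof
  fix z assume "z \<in> S" "\<forall>z\<in>S. \<exists>D. (f has_derivative D) (at z) \<and> (\<forall>c v. D (c *s v) = c * D v)"
    "\<forall>z\<in>S. \<exists>D. (g has_derivative D) (at z) \<and> (\<forall>c v. D (c *s v) = c * D v)"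
  then obtain D E where "(f has_derivative D) (at z)" "\<forall>c v. D (c *s v) = c * D v"
    "(g has_derivative E) (at z)" "\<forall>c v. E (c *s v) = c * E v" by blast
  then show "\<exists>D. ((\<lambda>z. f z + g z) has_derivative D) (at z) \<and> (\<forall>c v. D (c *s v) = c * D v)"
    by (intro exI[of _ "\<lambda>v. D v + E v"]) (auto intro!: has_derivative_add simp: distrib_left)
qed

lemma hol_mult: "hol S f \<Longrightarrow> hol S g \<Longrightarrow> hol S (\<lambda>z. f z * g z)"
  unfolding hol_def
proof
  fix z assume "z \<in> S" "\<forall>z\<in>S. \<exists>D. (f has_derivative D) (at z) \<and> (\<forall>c v. D (c *s v) = c * D v)"
    "\<forall>z\<in>S. \<exists>D. (g has_derivative D) (at z) \<and> (\<forall>c v. D (c *s v) = c * D v)"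
  then obtain D E where "(f has_derivative D) (at z)" "\<forall>c v. D (c *s v) = c * D v"
    "(g has_derivative E) (at z)" "\<forall>c v. E (c *s v) = c * E v" by blast
  then show "\<exists>D. ((\<lambda>z. f z * g z) has_derivative D) (at z) \<and> (\<forall>c v. D (c *s v) = c * D v)"
    by (intro exI[of _ "\<lambda>v. f z * E v + D v * g z"] conjI has_derivative_mult)
      (auto simp: algebra_simps)
qed

lemma hol_inverse:
  assumes "hol S f" "\<And>z. z \<in> S \<Longrightarrow> f z \<noteq> 0"
  shows "hol S (\<lambda>z. inverse (f z))"
  unfolding hol_def
proof
  fix z assume z: "z \<in> S"
  then obtain D where "(f has_derivative D) (at z)" "\<forall>c v. D (c *s v) = c * D v"
    using assms by (auto simp: hol_def)
  then show "\<exists>D. ((\<lambda>z. inverse (f z)) has_derivative D) (at z) \<and> (\<forall>c v. D (c *s v) = c * D v)"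
    using assms(2)[OF z]
    by (intro exI[of _ "\<lambda>v. - (inverse (f z) * D v * inverse (f z))"])
      (auto intro!: Deriv.has_derivative_inverse)
qed

lemma hol_divide: "hol S f \<Longrightarrow> hol S g \<Longrightarrow> (\<And>z. z \<in> S \<Longrightarrow> g z \<noteq> 0) \<Longrightarrow> hol S (\<lambda>z. f z / g z)"
  by (simp add: divide_inverse hol_mult hol_inverse)

lemma hol_diff: "hol S f \<Longrightarrow> hol S g \<Longrightarrow> hol S (\<lambda>z. f z - g z)"
  using hol_add[of S f "\<lambda>z. (- 1) * g z"] hol_mult[OF hol_const[of S "- 1"], of g] by simp

lemma hol_sum: "(\<And>i. i \<in> I \<Longrightarrow> hol S (f i)) \<Longrightarrow> hol S (\<lambda>z. \<Sum>i\<in>I. f i z)"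
proof (induction I rule: infinite_finite_induct)
  case (insert i I)
  then have "hol S (\<lambda>z. f i z + (\<Sum>i\<in>I. f i z))" by (intro hol_add) auto
  then show ?case using insert by simp
qed (auto intro: hol_const)

lemma hol_prod: "(\<And>i. i \<in> I \<Longrightarrow> hol S (f i)) \<Longrightarrow> hol S (\<lambda>z. \<Prod>i\<in>I. f i z)"
proof (induction I rule: infinite_finite_induct)
  case (insert i I)
  then have "hol S (\<lambda>z. f i z * (\<Prod>i\<in>I. f i z))" by (intro hol_mult) auto
  then show ?case using insert by simp
qed (auto intro: hol_const)

lemma hol_power: "hol S f \<Longrightarrow> hol S (\<lambda>z. f z ^ k)"
  by (induction k) (auto intro: hol_const hol_mult)

lemmas hol_intros = hol_const hol_nth hol_add hol_diff hol_mult hol_sum hol_prod hol_power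

lemma hol_compose:
  assumes "hol T f" "g ` S \<subseteq> T"
    and g: "\<And>z. z \<in> S \<Longrightarrow> \<exists>D. (g has_derivative D) (at z) \<and> (\<forall>c v. D (c *s v) = c *s D v)"
  shows "hol S (\<lambda>z. f (g z))"
  unfolding hol_def
proof
  fix z assume z: "z \<in> S"
  obtain D where D: "(g has_derivative D) (at z)" "\<forall>c v. D (c *s v) = c *s D v"
    using g[OF z] by blast
  have gz: "g z \<in> T" using z assms(2) by auto
  have "((\<lambda>z. f (g z)) has_derivative (\<lambda>v. Dv f (D v) (g z))) (at z)"
    using has_derivative_compose[OF D(1) hol_has_derivative[OF assms(1) gz]] .
  then show "\<exists>D. ((\<lambda>z. f (g z)) has_derivative D) (at z) \<and> (\<forall>c v. D (c *s v) = c * D v)"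
    using D(2) hol_Dv_scale[OF assms(1) gz] by (intro exI[of _ "\<lambda>v. Dv f (D v) (g z)"]) simp
qed

lemma hol_translate: "hol T f \<Longrightarrow> (\<lambda>z. z + a) ` S \<subseteq> T \<Longrightarrow> hol S (\<lambda>z. f (z + a))"
  by (rule hol_compose[of T f "\<lambda>z. z + a"])
    (auto intro!: exI[of _ "\<lambda>v. v"] derivative_eq_intros)

lemma bounded_linear_vector_scale: "bounded_linear (\<lambda>t. t *s (e :: complex^'n))"
  by (rule linear_conv_bounded_linear[THEN iffD1], rule linearI)
    (auto simp: vec_eq_iff distrib_right)

lemma bounded_linear_vector_scale_nth: "bounded_linear (\<lambda>z. z $ i *s (e :: complex^'n))"
  by (rule bounded_linear_compose[OF bounded_linear_vector_scale bounded_linear_vec_nth])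

lemma hol_line:
  assumes "hol S f" "z + t *s e \<in> S"
  shows "((\<lambda>t. f (z + t *s e)) has_field_derivative Dv f e (z + t *s e)) (at t)"
proof -
  have "((\<lambda>t. z + t *s e) has_derivative (\<lambda>h. h *s e)) (at t)"
    using has_derivative_add[OF has_derivative_const
        bounded_linear_imp_has_derivative[OF bounded_linear_vector_scale]] by simp
  from has_derivative_compose[OF this hol_has_derivative[OF assms]]
  have "((\<lambda>t. f (z + t *s e)) has_derivative (\<lambda>h. Dv f (h *s e) (z + t *s e))) (at t)" .
  moreover have "(\<lambda>h. Dv f (h *s e) (z + t *s e)) = (*) (Dv f e (z + t *s e))"
    by (rule ext) (simp add: hol_Dv_scale[OF assms])
  ultimately show ?thesis
    unfolding has_field_derivative_def by simp
qed

lemma hol_line_holomorphic: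
  assumes "hol S f" "\<And>t. t \<in> T \<Longrightarrow> z + t *s e \<in> S"
  shows "(\<lambda>t. f (z + t *s e)) holomorphic_on T"
  unfolding holomorphic_on_def field_differentiable_def
  using hol_line[OF assms(1) assms(2)] has_field_derivative_at_within by blast

section \<open>Cauchy's formula along complex lines\<close>

abbreviation E1 :: "real \<Rightarrow> complex" where
  "E1 s \<equiv> exp (2 * of_real pi * \<i> * of_real s)"

lemma norm_E1: "cmod (E1 s) = 1"
proof -
  have "2 * of_real pi * \<i> * of_real s = \<i> * of_real (2 * pi * s)" by simp
  then show ?thesis by (metis norm_exp_i_times)
qed

lemma continuous_on_E1: "continuous_on S (\<lambda>x. E1 (g x))" if "continuous_on S g"
  using that by (intro continuous_intros)

text \<open>Contour integrals are moved to the fixed interval \<open>{0..1}\<close>, where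
  \<open>hol_integral\<close> controls the dependence on parameters.\<close>

lemma contour_integral_circlepath_eq:
  "contour_integral (circlepath 0 r) g = integral {0..1} (\<lambda>s. g (r * E1 s) * (2 * of_real pi * \<i> * r * E1 s))"
proof -
  have "contour_integral (circlepath 0 r) g
    = integral {0..1} (\<lambda>t. g (circlepath 0 r t) * vector_derivative (circlepath 0 r) (at t within {0..1}))"
    by (simp add: contour_integral_def has_contour_integral_def integral_def contour_integrable_on_def
        integrable_on_def)
  also have "\<dots> = integral {0..1} (\<lambda>s. g (r * E1 s) * (2 * of_real pi * \<i> * r * E1 s))"
  proof (intro integral_cong)
    fix t :: real assume "t \<in> {0..1}"
    then have "vector_derivative (circlepath 0 r) (at t within {0..1}) = 2 * of_real pi * \<i> * r * E1 t"
      using vector_derivative_circlepath01[of t 0 r] by simp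
    then show "g (circlepath 0 r t) * vector_derivative (circlepath 0 r) (at t within {0..1})
        = g (r * E1 t) * (2 * of_real pi * \<i> * r * E1 t)"
      by (simp only: circlepath) simp
  qed
  finally show ?thesis .
qed

lemma deriv_eq_circle_integral:
  assumes "r > 0" "continuous_on (cball 0 r) f" "f holomorphic_on (ball 0 r)"
  shows "deriv f 0 = integral {0..1} (\<lambda>s. f (r * E1 s) / (r * E1 s))"
proof -
  have "contour_integral (circlepath 0 r) (\<lambda>u. f u / (u - 0)^2) = (2 * pi * \<i>) * deriv f 0"
    using assms by (intro Cauchy_contour_integral_circlepath_2) auto
  also have "contour_integral (circlepath 0 r) (\<lambda>u. f u / (u - 0)^2)
     = integral {0..1} (\<lambda>s. (2 * of_real pi * \<i>) * (f (r * E1 s) / (r * E1 s)))"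
    unfolding contour_integral_circlepath_eq
    using assms(1) by (intro integral_cong) (simp add: power2_eq_square field_simps)
  also have "\<dots> = (2 * of_real pi * \<i>) * integral {0..1} (\<lambda>s. f (r * E1 s) / (r * E1 s))"
    by (rule integral_mult_right)
  finally show ?thesis by simp
qed

lemma vector_scale_norm: "norm (t *s (e :: complex^'n)) = cmod t * norm e"
  by (simp add: norm_vec_def L2_set_def norm_mult power_mult_distrib sum_distrib_left[symmetric]
      real_sqrt_mult)

lemma hol_Dv_eq_integral:
  fixes f :: "complex^'n \<Rightarrow> complex"
  assumes "hol S f" "r > 0" "\<And>t. t \<in> cball 0 r \<Longrightarrow> z + t *s e \<in> S"
  shows "Dv f e z = integral {0..1} (\<lambda>s. f (z + (r * E1 s) *s e) / (r * E1 s))"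
proof -
  have h: "(\<lambda>t. f (z + t *s e)) holomorphic_on cball 0 r"
    by (rule hol_line_holomorphic[OF assms(1,3)])
  have "((\<lambda>t. f (z + t *s e)) has_field_derivative Dv f e (z + 0 *s e)) (at 0)"
    using assms(2) assms(3)[of 0] by (intro hol_line[OF assms(1)]) auto
  then have "Dv f e z = deriv (\<lambda>t. f (z + t *s e)) 0"
    by (simp add: DERIV_imp_deriv)
  then show ?thesis
    using deriv_eq_circle_integral[OF assms(2) holomorphic_on_imp_continuous_on[OF h]]
      holomorphic_on_subset[OF h ball_subset_cball] by simp
qed

text \<open>Integration in a parameter preserves holomorphy; the continuity of the derivative in both
  variables, needed to differentiate under the integral, comes from Cauchy's formula.\<close>

lemma hol_integral:
  fixes h :: "complex^'n \<Rightarrow> real \<Rightarrow> complex"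
  assumes S: "open S" and h: "\<And>t. t \<in> {0..1} \<Longrightarrow> hol S (\<lambda>z. h z t)"
    and cont: "continuous_on (S \<times> {0..1}) (\<lambda>(z, t). h z t)"
  shows "hol S (\<lambda>z. integral {0..1} (h z))"
  unfolding hol_def
proof
  fix z0 assume z0: "z0 \<in> S"
  obtain R where R: "R > 0" "ball z0 (2 * R) \<subseteq> S"
  proof -
    obtain R where "R > 0" "ball z0 R \<subseteq> S" using S z0 open_contains_ball by blast
    then show thesis using that[of "R / 2"] by simp
  qed
  let ?U = "ball z0 R"
  define r where "r = R / 2"
  have r: "r > 0" "r < R" unfolding r_def using R by auto
  define D where "D z t = Blinfun (\<lambda>v. Dv (\<lambda>z. h z t) v z)" for z t
  have US: "?U \<subseteq> S" using R by (auto simp: subset_iff)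
  have bl: "bounded_linear (\<lambda>v. Dv (\<lambda>z. h z t) v z)" if "z \<in> S" "t \<in> {0..1}" for z t
    using hol_has_derivative[OF h[OF that(2)] that(1)] has_derivative_bounded_linear by blast
  have D: "blinfun_apply (D z t) v = Dv (\<lambda>z. h z t) v z" if "z \<in> S" "t \<in> {0..1}" for z t v
    using bl[OF that] by (simp add: D_def bounded_linear_Blinfun_apply)
  have contD: "continuous_on (?U \<times> {0..1}) (\<lambda>(z, t). D z t)"
  proof (rule continuous_on_blinfun_componentwise)
    fix b :: "complex^'n" assume b: "b \<in> Basis"
    have in2: "z + (\<tau> *s b) \<in> ball z0 (2 * R)" if "z \<in> ?U" "cmod \<tau> \<le> r" for z \<tau>
    proof -
      have "dist z0 (z + \<tau> *s b) \<le> dist z0 z + norm (\<tau> *s b)"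
        by (metis dist_norm dist_triangle add_diff_cancel_left' dist_commute)
      also have "norm (\<tau> *s b) \<le> r" using that(2) b by (simp add: vector_scale_norm)
      finally show ?thesis using that r by simp
    qed
    have eq: "blinfun_apply (D z t) b = integral (cbox 0 1) (\<lambda>s. h (z + (r * E1 s) *s b) t / (r * E1 s))"
      if "z \<in> ?U" "t \<in> {0..1}" for z t
    proof -
      have z: "z \<in> S" using that US by blast
      have "z + \<tau> *s b \<in> S" if "\<tau> \<in> cball 0 r" for \<tau>
        using in2[OF \<open>z \<in> ?U\<close>, of \<tau>] that R by auto
      from hol_Dv_eq_integral[OF h[OF that(2)] r(1) this]
      show ?thesis using D[OF z that(2), of b] by simp
    qed
    have c: "continuous_on ((?U \<times> {0..1}) \<times> cbox 0 1)
       (\<lambda>(p, s). h (fst p + (r * E1 s) *s b) (snd p) / (r * E1 s))"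
      unfolding case_prod_beta
    proof (intro continuous_on_divide)
      show "continuous_on ((?U \<times> {0..1}) \<times> cbox 0 (1::real))
         (\<lambda>x. h (fst (fst x) + (r * E1 (snd x)) *s b) (snd (fst x)))"
      proof (rule continuous_on_compose2[OF cont,
           of _ "\<lambda>x. (fst (fst x) + (r * E1 (snd x)) *s b, snd (fst x))", simplified case_prod_conv])
        show "continuous_on ((?U \<times> {0..1}) \<times> cbox 0 1)
          (\<lambda>x. (fst (fst x) + (r * E1 (snd x)) *s b, snd (fst x :: (complex^'n) \<times> real)))"
          by (intro continuous_intros bounded_linear.continuous_on[OF bounded_linear_vector_scale])
        show "(\<lambda>x. (fst (fst x) + (r * E1 (snd x)) *s b, snd (fst x))) ` ((?U \<times> {0..1}) \<times> cbox 0 1)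
            \<subseteq> S \<times> {0..1}"
          using in2 R r by (auto simp: norm_mult norm_E1 subset_iff)
      qed
    qed (use r in \<open>auto intro!: continuous_intros\<close>)
    have "continuous_on (?U \<times> {0..1}) (\<lambda>p. integral (cbox 0 1)
        (\<lambda>s. h (fst p + (r * E1 s) *s b) (snd p) / (r * E1 s)))"
      by (rule integral_continuous_on_param[OF c])
    then show "continuous_on (?U \<times> {0..1}) (\<lambda>x. blinfun_apply (case x of (z, t) \<Rightarrow> D z t) b)"
      by (rule continuous_on_eq) (use eq in auto)
  qed
  have contt: "continuous_on {0..1} (h z)" if "z \<in> S" for z
  proof -
    have "continuous_on {0..1} (\<lambda>t. (z, t))" by (intro continuous_intros)
    then show ?thesis using continuous_on_compose2[OF cont, of "{0..1}" "\<lambda>t. (z, t)"] that by auto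
  qed
  have z0U: "z0 \<in> ?U" using R by simp
  have "((\<lambda>z. integral (cbox 0 1) (h z)) has_derivative integral (cbox 0 1) (D z0)) (at z0 within ?U)"
  proof (rule leibniz_rule)
    show "((\<lambda>z. h z t) has_derivative blinfun_apply (D z t)) (at z within ?U)"
      if "z \<in> ?U" "t \<in> cbox 0 1" for z t
    proof -
      have zt: "z \<in> S" "t \<in> {0..1}" using that US by auto
      have "blinfun_apply (D z t) = (\<lambda>v. Dv (\<lambda>z. h z t) v z)" using D[OF zt] by auto
      then show ?thesis using has_derivative_at_withinI[OF hol_has_derivative[OF h[OF zt(2)] zt(1)]] by simp
    qed
    show "h z integrable_on cbox 0 1" if "z \<in> ?U" for z
      using contt[of z] US that by (auto intro!: integrable_continuous_real)
    show "continuous_on (?U \<times> cbox 0 1) (\<lambda>(z, t). D z t)" using contD by simp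
  qed (use z0U in auto)
  then have "((\<lambda>z. integral {0..1} (h z)) has_derivative integral {0..1} (D z0)) (at z0)"
    using at_within_open[OF z0U open_ball] by simp
  moreover have "integral {0..1} (D z0) (c *s v) = c * integral {0..1} (D z0) v" for c v
  proof -
    have "continuous_on {0..1} (\<lambda>t. (z0, t))" by (intro continuous_intros)
    then have cD: "continuous_on {0..1} (D z0)"
    proof -
      have "(\<lambda>t. (z0, t)) ` {0..1} \<subseteq> ?U \<times> {0..1}" using z0U by blast
      from continuous_on_compose2[OF contD \<open>continuous_on {0..1} (\<lambda>t. (z0, t))\<close> this]
      show ?thesis by simp
    qed
    have *: "integral {0..1} (D z0) w = integral {0..1} (\<lambda>t. D z0 t w)" for w
      using blinfun_apply_integral[of "D z0" "cbox 0 1" w] cD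
      by (simp add: integrable_continuous_real)
    have "integral {0..1} (\<lambda>t. D z0 t (c *s v)) = integral {0..1} (\<lambda>t. c * D z0 t v)"
      by (intro integral_cong) (simp add: D[OF z0] hol_Dv_scale[OF h z0])
    then show ?thesis by (simp add: *)
  qed
  ultimately show "\<exists>D. ((\<lambda>z. integral {0..1} (h z)) has_derivative D) (at z0) \<and>
      (\<forall>c v. D (c *s v) = c * D v)"
    by blast
qed

text \<open>Near each point, Cauchy's formula writes \<open>Dv f e\<close> as an integral over a
  circle of translates of \<open>f\<close>, with the base point as a holomorphic parameter;
  \<open>hol_integral\<close> then applies.\<close>

lemma hol_Dv:
  fixes f :: "complex^'n \<Rightarrow> complex"
  assumes S: "open S" and f: "hol S f"
  shows "hol S (Dv f e)"
proof -
  have "\<exists>U. open U \<and> z0 \<in> U \<and> hol U (Dv f e)" if z0: "z0 \<in> S" for z0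
  proof -
    obtain R where R: "R > 0" "ball z0 (2 * R) \<subseteq> S"
    proof -
      obtain R where "R > 0" "ball z0 R \<subseteq> S" using S z0 open_contains_ball by blast
      then show thesis using that[of "R / 2"] by simp
    qed
    let ?U = "ball z0 R"
    define r where "r = R / (norm e + 1)"
    have ne: "norm e + 1 > 0" by (simp add: add_nonneg_pos)
    have r: "r > 0" "r * norm e \<le> R"
    proof -
      show "r > 0" using R ne by (simp add: r_def)
      have "r * norm e \<le> r * (norm e + 1)" using \<open>r > 0\<close> by simp
      then show "r * norm e \<le> R" using ne by (simp add: r_def)
    qed
    have in2: "z + t *s e \<in> S" if "z \<in> ?U" "cmod t \<le> r" for z t
    proof -
      have "dist z0 (z + t *s e) \<le> dist z0 z + norm (t *s e)"
        by (metis dist_norm dist_triangle add_diff_cancel_left' dist_commute)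
      also have "norm (t *s e) \<le> r * norm e" using that(2) by (simp add: vector_scale_norm mult_right_mono)
      finally have "z + t *s e \<in> ball z0 (2 * R)" using that r by simp
      then show ?thesis using R by blast
    qed
    have "hol ?U (\<lambda>z. integral {0..1} (\<lambda>s. f (z + (r * E1 s) *s e) / (r * E1 s)))"
    proof (rule hol_integral)
      show "hol ?U (\<lambda>z. f (z + (r * E1 s) *s e) / (r * E1 s))" for s
        using in2 r by (intro hol_divide hol_translate[OF f] hol_const) (auto simp: norm_mult norm_E1)
      show "continuous_on (?U \<times> {0..1}) (\<lambda>(z, s). f (z + (r * E1 s) *s e) / (r * E1 s))"
        unfolding case_prod_beta
      proof (intro continuous_on_divide)
        show "continuous_on (?U \<times> {0..1}) (\<lambda>x. f (fst x + (r * E1 (snd x)) *s e))"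
          by (rule continuous_on_compose2[OF hol_continuous_on[OF f]])
            (auto intro!: continuous_intros bounded_linear.continuous_on[OF bounded_linear_vector_scale] in2
              simp: norm_mult norm_E1 r less_imp_le)
      qed (use r in \<open>auto intro!: continuous_intros\<close>)
    qed auto
    then have "hol ?U (Dv f e)"
    proof (rule hol_cong[OF open_ball, rotated])
      fix z assume "z \<in> ?U"
      then show "integral {0..1} (\<lambda>s. f (z + (r * E1 s) *s e) / (r * E1 s)) = Dv f e z"
        using in2 r by (intro hol_Dv_eq_integral[OF f, symmetric]) auto
    qed
    then show ?thesis using R by (intro exI[of _ ?U]) auto
  qed
  then show ?thesis unfolding hol_def by meson
qed

lemma hol_smooth_on: "open S \<Longrightarrow> hol S f \<Longrightarrow> smooth_on S f"
  by (rule smooth_on_coinduct[of f "{f. hol S f}"]) (auto intro: hol_differentiable hol_Dv)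

section \<open>Smooth factors of a power of a coordinate\<close>

text \<open>Identities are required on \<open>W\<close> only: off \<open>W\<close> the functions of
  \<open>A\<close> may fail to be differentiable and \<open>X\<close> is then a default value.
  Therefore \<open>X_cong\<close> has to carry equalities on \<open>W\<close> through the iterates
  of \<open>X\<close>.\<close>

locale derivation =
  fixes A :: "('a \<Rightarrow> complex) set" and X :: "('a \<Rightarrow> complex) \<Rightarrow> 'a \<Rightarrow> complex" and W :: "'a set"
  assumes X_closed: "h \<in> A \<Longrightarrow> X h \<in> A"
    and mult_closed: "h \<in> A \<Longrightarrow> k \<in> A \<Longrightarrow> (\<lambda>z. h z * k z) \<in> A"
    and X_cong: "(\<And>z. z \<in> W \<Longrightarrow> h z = k z) \<Longrightarrow> z \<in> W \<Longrightarrow> X h z = X k z"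
    and X_add: "h \<in> A \<Longrightarrow> k \<in> A \<Longrightarrow> z \<in> W \<Longrightarrow> X (\<lambda>z. h z + k z) z = X h z + X k z"
    and X_mult: "h \<in> A \<Longrightarrow> k \<in> A \<Longrightarrow> z \<in> W \<Longrightarrow> X (\<lambda>z. h z * k z) z = X h z * k z + h z * X k z"
begin

lemma funpow_cong: "(\<And>z. z \<in> W \<Longrightarrow> h z = k z) \<Longrightarrow> z \<in> W \<Longrightarrow> (X ^^ i) h z = (X ^^ i) k z"
  by (induction i arbitrary: z) (auto intro: X_cong)

lemma funpow_closed: "h \<in> A \<Longrightarrow> (X ^^ i) h \<in> A"
  by (induction i) (auto intro: X_closed)

lemma funpow_add:
  assumes "h \<in> A" "k \<in> A" "z \<in> W"
  shows "(X ^^ i) (\<lambda>z. h z + k z) z = (X ^^ i) h z + (X ^^ i) k z"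
  using assms(3)
proof (induction i arbitrary: z)
  case (Suc i)
  have "X ((X ^^ i) (\<lambda>z. h z + k z)) z = X (\<lambda>z. (X ^^ i) h z + (X ^^ i) k z) z"
    by (rule X_cong) (use Suc in auto)
  then show ?case using X_add[OF funpow_closed funpow_closed] assms Suc.prems by simp
qed simp

lemma funpow_mult:
  assumes "h \<in> A" "k \<in> A" "z \<in> W"
  shows "(X ^^ Suc i) (\<lambda>z. h z * k z) z = (X ^^ i) (\<lambda>z. X h z * k z) z + (X ^^ i) (\<lambda>z. h z * X k z) z"
proof -
  have "(X ^^ Suc i) (\<lambda>z. h z * k z) z = (X ^^ i) (X (\<lambda>z. h z * k z)) z"
    by (simp add: funpow_swap1)
  also have "\<dots> = (X ^^ i) (\<lambda>z. X h z * k z + h z * X k z) z"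
    by (rule funpow_cong) (use X_mult assms in auto)
  also have "\<dots> = (X ^^ i) (\<lambda>z. X h z * k z) z + (X ^^ i) (\<lambda>z. h z * X k z) z"
    by (intro funpow_add mult_closed X_closed assms)
  finally show ?thesis .
qed

text \<open>In the Leibniz rule every term with fewer than \<open>i\<close> derivatives on
  \<open>h\<close> vanishes at \<open>q\<close>, so only the term with all derivatives on
  \<open>h\<close> survives.\<close>

lemma leading_coefficient_mult:
  assumes "h \<in> A" "k \<in> A" "q \<in> W" "\<And>l. l < i \<Longrightarrow> (X ^^ l) h q = 0"
  shows "(X ^^ i) (\<lambda>z. h z * k z) q = (X ^^ i) h q * k q"
  using assms
proof (induction i arbitrary: h k)
  case (Suc i)
  have "(X ^^ l) (X h) q = 0" if "l < i" for l
    using Suc.prems(4)[of "Suc l"] that by (simp add: funpow_swap1)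
  then have "(X ^^ i) (\<lambda>z. X h z * k z) q = (X ^^ i) (X h) q * k q"
    by (intro Suc.IH X_closed Suc.prems) auto
  moreover have "(X ^^ i) (\<lambda>z. h z * X k z) q = (X ^^ i) h q * X k q"
    by (intro Suc.IH X_closed Suc.prems(1-3)) (use Suc.prems(4) in auto)
  ultimately show ?case
    using Suc.prems(4)[of i] funpow_mult[OF Suc.prems(1-3)] by (simp add: funpow_swap1)
qed simp

text \<open>As \<open>y\<close> vanishes at \<open>q\<close> and \<open>X y = 1\<close>, the Leibniz
  terms that survive have exactly one derivative on \<open>y\<close>. The truncated
  \<open>i - 1\<close> at \<open>i = 0\<close> is harmless because of the factor
  \<open>of_nat i\<close>.\<close>

lemma funpow_coordinate_mult:
  assumes "h \<in> A" "y \<in> A" "q \<in> W" "y q = 0" "\<And>z. z \<in> W \<Longrightarrow> X y z = 1"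
  shows "(X ^^ i) (\<lambda>z. y z * h z) q = of_nat i * (X ^^ (i - 1)) h q"
  using assms(1)
proof (induction i arbitrary: h)
  case 0
  then show ?case using assms(4) by simp
next
  case (Suc i)
  have "(X ^^ i) (\<lambda>z. X y z * h z) q = (X ^^ i) h q"
    by (rule funpow_cong) (use assms in auto)
  then have "(X ^^ Suc i) (\<lambda>z. y z * h z) q = (X ^^ i) h q + (X ^^ i) (\<lambda>z. y z * X h z) q"
    using funpow_mult[OF assms(2) Suc.prems assms(3)] by simp
  moreover have "(X ^^ i) (\<lambda>z. y z * X h z) q = of_nat i * (X ^^ (i - 1)) (X h) q"
    by (intro Suc.IH X_closed Suc.prems)
  moreover have "(X ^^ (i - 1)) (X h) q = (X ^^ i) h q" if "i \<noteq> 0"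
    using that by (cases i) (auto simp: funpow_swap1)
  ultimately show ?case by (cases "i = 0") (auto simp: algebra_simps)
qed

text \<open>Each factor raises the order of vanishing along \<open>X\<close> by one and multiplies
  the leading coefficient by the new order, which accounts for the factorial.\<close>

lemma funpow_coordinates_mult:
  assumes "u \<in> A" "q \<in> W" "\<And>y. y \<in> set ys \<Longrightarrow> y \<in> A \<and> y q = 0 \<and> (\<forall>z\<in>W. X y z = 1)"
  shows "(\<lambda>z. (\<Prod>y\<leftarrow>ys. y z) * u z) \<in> A \<and>
    (\<forall>i<length ys. (X ^^ i) (\<lambda>z. (\<Prod>y\<leftarrow>ys. y z) * u z) q = 0) \<and>
    (X ^^ length ys) (\<lambda>z. (\<Prod>y\<leftarrow>ys. y z) * u z) q = fact (length ys) * u q"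
  using assms(3)
proof (induction ys)
  case Nil
  then show ?case using assms(1) by simp
next
  case (Cons y ys)
  let ?h = "\<lambda>z. (\<Prod>y\<leftarrow>ys. y z) * u z"
  have y: "y \<in> A" "y q = 0" "\<And>z. z \<in> W \<Longrightarrow> X y z = 1" using Cons.prems by auto
  have h: "?h \<in> A" "\<And>i. i < length ys \<Longrightarrow> (X ^^ i) ?h q = 0"
    "(X ^^ length ys) ?h q = fact (length ys) * u q"
    using Cons.IH Cons.prems by auto
  have z: "(X ^^ i) (\<lambda>z. y z * ?h z) q = of_nat i * (X ^^ (i - 1)) ?h q" for i
    by (rule funpow_coordinate_mult[OF h(1) y(1) assms(2) y(2,3)])
  have "(X ^^ i) (\<lambda>z. y z * ?h z) q = 0" if "i \<le> length ys" for i
    unfolding z using h(2)[of "i - 1"] that by (cases i) auto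
  moreover have "(X ^^ Suc (length ys)) (\<lambda>z. y z * ?h z) q = fact (Suc (length ys)) * u q"
    unfolding z using h(3) by (simp add: algebra_simps)
  moreover have "(\<lambda>z. (\<Prod>y\<leftarrow>(y # ys). y z) * u z) = (\<lambda>z. y z * ?h z)"
    by (simp add: mult.assoc)
  ultimately show ?case using mult_closed[OF y(1) h(1)] by (simp del: funpow.simps)
qed

text \<open>Where \<open>a\<close> is nonzero, \<open>g\<close> inherits the order of vanishing of
  the product of coordinates, and the leading coefficients can be compared. The result is left
  undivided by \<open>a q\<close>, so that it survives a limit in which \<open>a\<close> may tend to
  zero.\<close>

lemma smooth_factor_of_coordinates:
  assumes "u \<in> A" "a \<in> A" "g \<in> A" "q \<in> W"
    and ys: "\<And>y. y \<in> set ys \<Longrightarrow> y \<in> A \<and> y q = 0 \<and> (\<forall>z\<in>W. X y z = 1)"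
    and eq: "\<And>i. (X ^^ i) (\<lambda>z. g z * a z) q = (X ^^ i) (\<lambda>z. (\<Prod>y\<leftarrow>ys. y z) * u z) q"
    and a: "a q \<noteq> 0"
  shows "(X ^^ length ys) g q * a q = fact (length ys) * u q"
proof -
  have u: "\<And>i. i < length ys \<Longrightarrow> (X ^^ i) (\<lambda>z. (\<Prod>y\<leftarrow>ys. y z) * u z) q = 0"
    "(X ^^ length ys) (\<lambda>z. (\<Prod>y\<leftarrow>ys. y z) * u z) q = fact (length ys) * u q"
    using funpow_coordinates_mult[OF assms(1,4) ys] by auto
  have z: "(X ^^ i) g q = 0" if "i < length ys" for i
    using that
  proof (induction i rule: less_induct)
    case (less i)
    have "(X ^^ i) (\<lambda>z. g z * a z) q = (X ^^ i) g q * a q"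
      by (rule leading_coefficient_mult) (use less assms in auto)
    then show ?case using eq[of i] u(1)[OF less.prems] a by simp
  qed
  have "(X ^^ length ys) (\<lambda>z. g z * a z) q = (X ^^ length ys) g q * a q"
    by (rule leading_coefficient_mult) (use z assms in auto)
  then show ?thesis using eq u(2) by simp
qed

end

text \<open>The derivation \<open>X\<close> below is tangent to the level set of \<open>\<rho>\<close> and maps the first coordinate
  and its conjugate to \<open>1\<close>. Differentiating \<open>a g = (x cnj x)\<^sup>k u\<close> along \<open>X\<close> at the
  points with \<open>x = 0\<close> and letting these tend to \<open>0\<close> shows that \<open>a\<close> divides \<open>u 0\<close>.\<close>

lemma nonzero_at_0_of_dvd_coordinate_power:
  fixes \<rho> :: "complex^2 \<Rightarrow> real" and a g u :: "complex^2 \<Rightarrow> complex"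
  assumes W: "open W" "0 \<in> W" and \<rho>: "smooth_on W \<rho>" "\<rho> 0 = 0"
    and d2: "\<And>z. z \<in> W \<Longrightarrow> Dv \<rho> (axis 2 1) z \<noteq> 0"
    and sm: "smooth_on W a" "smooth_on W g" "smooth_on W u" and u: "u 0 \<noteq> 0"
    and eq: "\<And>z. z \<in> W \<Longrightarrow> \<rho> z = 0 \<Longrightarrow> a z * g z = (z $ 1 * cnj (z $ 1)) ^ k * u z"
    and nz: "\<And>z. z \<in> W \<Longrightarrow> \<rho> z = 0 \<Longrightarrow> z $ 1 = 0 \<Longrightarrow> z \<noteq> 0 \<Longrightarrow> a z \<noteq> 0"
  shows "a 0 \<noteq> 0"
proof -
  \<comment> \<open>The real vector \<open>axis 1 1 - c z *s axis 2 1\<close> is in the kernel of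
    the differential of \<rho>. Its first component is the real number 1, so both z $ 1 and its
    conjugate have derivative 1 along it.\<close>
  define c where "c z = complex_of_real (Dv \<rho> (axis 1 1) z / Dv \<rho> (axis 2 1) z)" for z
  have c: "smooth_on W c"
    unfolding c_def using W d2 by (intro smooth_intros smooth_on_Dv \<rho>) auto
  define X where "X h z = Dv h (axis 1 1) z - c z * Dv h (axis 2 1) z" for h :: "complex^2 \<Rightarrow> complex" and z
  have Xsm: "smooth_on W (X h)" if "smooth_on W h" for h
    unfolding X_def using W by (intro smooth_intros smooth_on_Dv that c)
  interpret derivation "{h. smooth_on W h}" X W
  proof
    show "(\<lambda>z. h z * k z) \<in> {h. smooth_on W h}" if "h \<in> {h. smooth_on W h}" "k \<in> {h. smooth_on W h}"
      for h k :: "complex^2 \<Rightarrow> complex"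
      using that smooth_on_mult[OF W(1), of h k] by simp
    show "X h z = X k z" if "\<And>z. z \<in> W \<Longrightarrow> h z = k z" "z \<in> W" for h k z
    proof -
      have "Dv h v z = Dv k v z" for v by (rule Dv_cong_open[OF W(1) that(2,1)])
      then show ?thesis by (simp add: X_def)
    qed
    fix h k :: "complex^2 \<Rightarrow> complex" and z
    assume hk: "h \<in> {h. smooth_on W h}" "k \<in> {h. smooth_on W h}" and z: "z \<in> W"
    have h: "(h has_derivative (\<lambda>v. Dv h v z)) (at z)" and k: "(k has_derivative (\<lambda>v. Dv k v z)) (at z)"
      using smooth_on_has_derivative hk z by blast+
    show "X (\<lambda>z. h z + k z) z = X h z + X k z"
      unfolding X_def Dv_eqI[OF has_derivative_add[OF h k]] by (simp add: algebra_simps)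
    show "X (\<lambda>z. h z * k z) z = X h z * k z + h z * X k z"
      unfolding X_def Dv_eqI[OF has_derivative_mult[OF h k]] by (simp add: algebra_simps)
  qed (auto intro: Xsm)
  define ys :: "(complex^2 \<Rightarrow> complex) list"
    where "ys = concat (replicate k [\<lambda>z. z $ 1, \<lambda>z. cnj (z $ 1)])"
  have ys_prod: "(\<Prod>y\<leftarrow>ys. y z) = (z $ 1 * cnj (z $ 1)) ^ k" for z
    unfolding ys_def by (induction k) auto
  have ys: "y \<in> {h. smooth_on W h} \<and> (\<forall>q. q $ 1 = 0 \<longrightarrow> y q = 0) \<and> (\<forall>z\<in>W. X y z = 1)" if "y \<in> set ys" for y
  proof -
    have "Dv (\<lambda>z. z $ 1) v z = v $ 1" for v z :: "complex^2"
      by (rule Dv_eqI[OF bounded_linear_imp_has_derivative[OF bounded_linear_vec_nth]])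
    moreover have "Dv (\<lambda>z. cnj (z $ 1)) v z = cnj (v $ 1)" for v z :: "complex^2"
      by (rule Dv_eqI[OF bounded_linear_imp_has_derivative[OF
            bounded_linear_compose[OF bounded_linear_cnj bounded_linear_vec_nth]]])
    moreover have "y = (\<lambda>z. z $ 1) \<or> y = (\<lambda>z. cnj (z $ 1))"
      using that unfolding ys_def by (auto split: if_splits)
    ultimately show ?thesis
      using W by (auto simp: X_def axis_def intro!: smooth_intros)
  qed
  have cont_W: "continuous_on W \<rho>" by (rule smooth_on_continuous_on[OF \<rho>(1)])
  have d\<rho>: "(\<rho> has_derivative (\<lambda>v. Dv \<rho> v z)) (at z)" if "z \<in> W" for z
    by (rule smooth_on_has_derivative[OF \<rho>(1) that])
  have tangent: "X h z = 0" if h: "smooth_on W h" and "\<And>z. z \<in> W \<Longrightarrow> \<rho> z = 0 \<Longrightarrow> h z = 0" and z: "z \<in> W" "\<rho> z = 0" for h z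
  proof -
    let ?r = "Dv \<rho> (axis 1 1) z / Dv \<rho> (axis 2 1) z"
    let ?v = "axis 1 1 - ?r *\<^sub>R axis 2 1 :: complex^2"
    have lr: "linear (\<lambda>v. Dv \<rho> v z)" and lh: "linear (\<lambda>v. Dv h v z)"
      using d\<rho>[OF z(1)] smooth_on_has_derivative[OF h z(1)] has_derivative_linear by blast+
    have "Dv \<rho> ?v z = 0"
      using d2[OF z(1)] by (simp add: linear_diff[OF lr] linear_scale[OF lr])
    then have "Dv h ?v z = 0"
      using derivative_eq_0_of_vanishing[OF W(1) z(1) cont_W d\<rho>[OF z(1)] z(2) d2[OF z(1)] _
        smooth_on_has_derivative[OF h z(1)]] that(2) by blast
    moreover have "Dv h ?v z = Dv h (axis 1 1) z - ?r *\<^sub>R Dv h (axis 2 1) z"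
      by (simp only: linear_diff[OF lh] linear_scale[OF lh])
    ultimately show ?thesis
      by (simp add: X_def c_def scaleR_conv_of_real)
  qed
  have tangent_pow: "(X ^^ i) h z = 0"
    if "smooth_on W h" "\<And>z. z \<in> W \<Longrightarrow> \<rho> z = 0 \<Longrightarrow> h z = 0" "z \<in> W" "\<rho> z = 0" for i h z
    using that(3,4)
  proof (induction i arbitrary: z)
    case (Suc i)
    then show ?case using tangent[of "(X ^^ i) h" z] funpow_closed[of h i] that(1) by simp
  qed (use that in simp)
  have main: "(X ^^ length ys) g q * a q = fact (length ys) * u q"
    if q: "q \<in> W" "\<rho> q = 0" "q $ 1 = 0" "q \<noteq> 0" for q
  proof (rule smooth_factor_of_coordinates)
    show "(X ^^ i) (\<lambda>z. g z * a z) q = (X ^^ i) (\<lambda>z. (\<Prod>y\<leftarrow>ys. y z) * u z) q" for i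
    proof -
      let ?P = "\<lambda>z. (\<Prod>y\<leftarrow>ys. y z) * u z"
      \<comment> \<open>Two functions agreeing on the level set have a difference that vanishes
        there. The difference is written as a sum because the locale provides additivity
        only.\<close>
      let ?n = "\<lambda>z. (- 1) * ?P z"
      have P: "smooth_on W ?P" unfolding ys_prod using W by (intro smooth_intros sm)
      have n: "smooth_on W ?n" using W by (intro smooth_on_mult smooth_on_const P)
      have ag: "smooth_on W (\<lambda>z. g z * a z)" using W by (intro smooth_on_mult sm)
      have "(X ^^ i) (\<lambda>z. g z * a z + ?n z) q = 0"
        using eq q unfolding ys_prod
        by (intro tangent_pow smooth_intros sm W) (auto simp: mult.commute)
      then have e1: "(X ^^ i) (\<lambda>z. g z * a z) q + (X ^^ i) ?n q = 0"
        using funpow_add[of "\<lambda>z. g z * a z" ?n q i] ag n q by simp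
      have "(X ^^ i) (\<lambda>z. ?P z + ?n z) q = 0"
        using q unfolding ys_prod by (intro tangent_pow smooth_intros sm W) auto
      then have "(X ^^ i) ?P q + (X ^^ i) ?n q = 0"
        using funpow_add[of ?P ?n q i] P n q by simp
      from add_right_imp_eq[OF trans[OF e1 sym[OF this]]] show ?thesis .
    qed
  qed (use sm q ys nz in auto)
  have Xg: "smooth_on W ((X ^^ length ys) g)" using funpow_closed sm by auto
  \<comment> \<open>By \<open>main\<close>, \<open>h\<close> vanishes at all points of the level set
    other than 0 with first coordinate 0. These accumulate at 0, so \<open>h 0 = 0\<close>, and
    \<open>a 0 = 0\<close> would force \<open>u 0 = 0\<close>.\<close>
  define h where "h z = (X ^^ length ys) g z * a z - fact (length ys) * u z" for z
  have h: "continuous_on W h"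
    unfolding h_def
    by (intro smooth_on_continuous_on smooth_intros W Xg sm)
  have "h 0 = 0"
  proof (rule ccontr)
    assume h0: "h 0 \<noteq> 0"
    have "\<forall>\<^sub>F z in nhds 0. h z \<noteq> 0"
    proof -
      have "isCont h 0" using h W continuous_on_eq_continuous_at by blast
      then have "(h \<longlongrightarrow> h 0) (nhds 0)" by (simp add: isCont_def tendsto_at_iff_tendsto_nhds)
      then show ?thesis using h0 by (rule tendsto_imp_eventually_ne)
    qed
    then obtain \<epsilon> where \<epsilon>: "\<epsilon> > 0" "\<And>z. dist z 0 < \<epsilon> \<Longrightarrow> h z \<noteq> 0"
      unfolding eventually_nhds_metric by blast
    \<comment> \<open>The tangent direction is built from \<i> in the second coordinate. Its
      correction and the later displacement \<open>\<tau>\<close> are both real multiples of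
      \<open>axis 2 1\<close>, so the point found keeps imaginary part t in that coordinate and
      cannot be 0.\<close>
    let ?r = "Dv \<rho> (axis 2 \<i>) 0 / Dv \<rho> (axis 2 1) 0"
    let ?v = "axis 2 \<i> - ?r *\<^sub>R axis 2 1 :: complex^2"
    have lr: "linear (\<lambda>v. Dv \<rho> v 0)"
      using d\<rho>[OF W(2)] has_derivative_linear by blast
    have v0: "Dv \<rho> ?v 0 = 0"
      using d2[OF W(2)] by (simp add: linear_diff[OF lr] linear_scale[OF lr])
    obtain \<delta> where \<delta>: "\<delta> > 0" "\<And>t. \<bar>t\<bar> < \<delta> \<Longrightarrow> \<exists>\<tau>. \<bar>\<tau>\<bar> \<le> 1 * \<bar>t\<bar> \<and> 0 + t *\<^sub>R ?v + \<tau> *\<^sub>R axis 2 1 \<in> W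
        \<and> \<rho> (0 + t *\<^sub>R ?v + \<tau> *\<^sub>R axis 2 1) = 0"
      using zero_near_tangent[OF W cont_W d\<rho>[OF W(2)] \<rho>(2) d2[OF W(2)] v0, of 1] by auto
    define t where "t = min (\<delta> / 2) (\<epsilon> / (2 * (norm ?v + 1)))"
    have p: "norm ?v + 1 > 0" by (simp add: add_nonneg_pos)
    have t: "t > 0" "\<bar>t\<bar> < \<delta>" "t * (norm ?v + 1) < \<epsilon>"
    proof -
      show "t > 0" "\<bar>t\<bar> < \<delta>" unfolding t_def using \<delta>(1) \<epsilon>(1) p by auto
      have "t * (norm ?v + 1) \<le> (\<epsilon> / (2 * (norm ?v + 1))) * (norm ?v + 1)"
        unfolding t_def using p by (intro mult_right_mono) auto
      also have "\<dots> = \<epsilon> / 2" using p by (simp add: field_simps)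
      finally show "t * (norm ?v + 1) < \<epsilon>" using \<epsilon>(1) by simp
    qed
    obtain \<tau> where \<tau>: "\<bar>\<tau>\<bar> \<le> t" "t *\<^sub>R ?v + \<tau> *\<^sub>R axis 2 1 \<in> W" "\<rho> (t *\<^sub>R ?v + \<tau> *\<^sub>R axis 2 1) = 0"
      using \<delta>(2)[OF t(2)] t(1) by auto
    let ?q = "t *\<^sub>R ?v + \<tau> *\<^sub>R axis 2 1 :: complex^2"
    have "norm ?q \<le> \<bar>t\<bar> * norm ?v + \<bar>\<tau>\<bar> * norm (axis 2 1 :: complex^2)"
      by (metis norm_scaleR norm_triangle_ineq)
    also have "\<dots> \<le> t * norm ?v + t" using \<tau>(1) t(1) by simp
    also have "\<dots> < \<epsilon>" using t(3) by (simp add: algebra_simps)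
    finally have "h ?q \<noteq> 0" using \<epsilon>(2) by simp
    moreover have "?q $ 1 = 0" by (simp add: axis_def)
    moreover have "?q \<noteq> 0"
    proof -
      have "Im (?q $ 2) = t" by (simp add: axis_def)
      moreover have "Im ((0 :: complex^2) $ 2) = 0" by simp
      ultimately show ?thesis using t(1) by (metis less_irrefl)
    qed
    ultimately show False using main[OF \<tau>(2,3)] by (simp add: h_def)
  qed
  then show ?thesis using u by (auto simp: h_def)
qed

section \<open>Zeros in the fibres of a projection along a complex line\<close>

text \<open>The weight \<open>h\<close> turns the count of zeros into sums of values of
  \<open>h\<close> over the zeros; powers as weights give the power sums needed for Newton's
  identities.\<close>

lemma argument_principle_disc:
  assumes \<eta>: "0 < \<eta>" "\<eta> < R" and f: "f holomorphic_on ball 0 R" and h: "h holomorphic_on ball 0 R"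
    and nz: "\<And>t. cmod t = \<eta> \<Longrightarrow> f t \<noteq> 0"
  shows "finite {t. cmod t < \<eta> \<and> f t = 0}"
    "\<And>t. cmod t < \<eta> \<Longrightarrow> \<exists>w\<in>ball 0 R. f w \<noteq> 0"
    "(\<Sum>t\<in>{t. cmod t < \<eta> \<and> f t = 0}. h t * of_int (zorder f t))
      = integral {0..1} (\<lambda>s. deriv f (\<eta> * E1 s) * h (\<eta> * E1 s) / f (\<eta> * E1 s) * (\<eta> * E1 s))"
proof -
  \<comment> \<open>Zeros could accumulate at the boundary of the disc of radius \<open>R\<close>;
    in the closed disc of the intermediate radius there are finitely many.\<close>
  obtain R' where R': "\<eta> < R'" "R' < R" using \<eta> dense by blast
  have nc: "\<not> f constant_on ball 0 R" if "t \<in> ball 0 R" "f t = 0" for t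
  proof
    assume "f constant_on ball 0 R"
    then have "f \<eta> = f t" using that \<eta> unfolding constant_on_def by force
    then show False using nz[of \<eta>] that \<eta> by simp
  qed
  have fin: "finite {t \<in> cball 0 R'. f t = 0}"
  proof (cases "\<exists>t\<in>ball 0 R. f t = 0")
    case True
    then show ?thesis
      using nc R' by (intro holomorphic_compact_finite_zeros[OF f]) auto
  next
    case False
    then have "{t \<in> cball 0 R'. f t = 0} = {}" using R' by (auto simp: dist_norm)
    then show ?thesis by (simp only: finite.emptyI)
  qed
  have fin': "finite {t\<in>ball 0 R'. f t = 0}"
    by (rule finite_subset[OF _ fin]) auto
  show "finite {t. cmod t < \<eta> \<and> f t = 0}"
    by (rule finite_subset[OF _ fin]) (use R' in auto)
  have "complex_of_real \<eta> \<in> ball 0 R" "f \<eta> \<noteq> 0" using \<eta> nz[of "of_real \<eta>"] by simp_all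
  then show "\<exists>w\<in>ball 0 R. f w \<noteq> 0" by (intro bexI)
  have img: "path_image (circlepath 0 \<eta>) = {t. cmod t = \<eta>}"
    using \<eta> by (simp add: path_image_circlepath sphere_def)
  let ?pz = "{w\<in>ball 0 R'. f w = 0 \<or> w \<in> {}}"
  have "contour_integral (circlepath 0 \<eta>) (\<lambda>x. deriv f x * h x / f x) = 2 * pi * \<i> *
          (\<Sum>p\<in>?pz. winding_number (circlepath 0 \<eta>) p * h p * zorder f p)"
  proof (rule argument_principle)
    show "\<forall>z. z \<notin> ball 0 R' \<longrightarrow> winding_number (circlepath 0 \<eta>) z = 0"
      using R' \<eta> by (intro allI impI winding_number_zero_outside[of _ "cball 0 \<eta>"])
        (auto simp: path_image_circlepath sphere_cball)
  qed (use fin' R' nz f h img in \<open>auto intro: holomorphic_on_subset\<close>)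
  also have "(\<Sum>p\<in>?pz. winding_number (circlepath 0 \<eta>) p * h p * zorder f p)
     = (\<Sum>t\<in>{t. cmod t < \<eta> \<and> f t = 0}. h t * of_int (zorder f t))"
  proof (rule sum.mono_neutral_cong_right)
    show "\<forall>p\<in>?pz - {t. cmod t < \<eta> \<and> f t = 0}. winding_number (circlepath 0 \<eta>) p * h p * zorder f p = 0"
    proof
      fix p assume p: "p \<in> ?pz - {t. cmod t < \<eta> \<and> f t = 0}"
      then have "cmod p > \<eta>" using nz[of p] by force
      then have "winding_number (circlepath 0 \<eta>) p = 0"
        using \<eta> by (intro winding_number_zero_outside[of _ "cball 0 \<eta>"])
          (auto simp: path_image_circlepath sphere_cball)
      then show "winding_number (circlepath 0 \<eta>) p * h p * zorder f p = 0" by simp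
    qed
  qed (use fin' R' in \<open>auto simp: winding_number_circlepath\<close>)
  finally have "2 * pi * \<i> * (\<Sum>t\<in>{t. cmod t < \<eta> \<and> f t = 0}. h t * of_int (zorder f t))
     = contour_integral (circlepath 0 \<eta>) (\<lambda>x. deriv f x * h x / f x)" by simp
  also have "\<dots> = integral {0..1} (\<lambda>s. (2 * pi * \<i>) *
      (deriv f (\<eta> * E1 s) * h (\<eta> * E1 s) / f (\<eta> * E1 s) * (\<eta> * E1 s)))"
    unfolding contour_integral_circlepath_eq by (intro integral_cong) (simp add: algebra_simps)
  also have "\<dots> = 2 * pi * \<i> * integral {0..1} (\<lambda>s. deriv f (\<eta> * E1 s) * h (\<eta> * E1 s) / f (\<eta> * E1 s) * (\<eta> * E1 s))"
    by (rule integral_mult_right)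
  finally show "(\<Sum>t\<in>{t. cmod t < \<eta> \<and> f t = 0}. h t * of_int (zorder f t))
      = integral {0..1} (\<lambda>s. deriv f (\<eta> * E1 s) * h (\<eta> * E1 s) / f (\<eta> * E1 s) * (\<eta> * E1 s))"
    by simp
qed

text \<open>The base \<open>B\<close> is open in the whole space instead of lying in a hyperplane
  transversal to \<open>e\<close>. Different base points may share a line, but no coordinates have
  to be chosen, functions of the base point are holomorphic in the same sense as \<open>f\<close>,
  and a disc can be recentred by translating the base along \<open>e\<close>.\<close>

locale fibre_zeros =
  fixes \<Omega> B :: "(complex^'n) set" and f :: "complex^'n \<Rightarrow> complex" and e :: "complex^'n" and \<eta> R :: real
  assumes open_\<Omega>: "open \<Omega>" and hol_f: "hol \<Omega> f" and open_B: "open B" and \<eta>: "0 < \<eta>" "\<eta> < R"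
    and fibre: "\<And>Z t. Z \<in> B \<Longrightarrow> cmod t < R \<Longrightarrow> Z + t *s e \<in> \<Omega>"
    and boundary: "\<And>Z t. Z \<in> B \<Longrightarrow> cmod t = \<eta> \<Longrightarrow> f (Z + t *s e) \<noteq> 0"
begin

definition zeros :: "complex^'n \<Rightarrow> complex set" where
  "zeros Z = {t. cmod t < \<eta> \<and> f (Z + t *s e) = 0}"

definition mult :: "complex^'n \<Rightarrow> complex \<Rightarrow> nat" where
  "mult Z t = nat (zorder (\<lambda>t. f (Z + t *s e)) t)"

definition count :: "complex^'n \<Rightarrow> nat" where
  "count Z = (\<Sum>t\<in>zeros Z. mult Z t)"

lemma holomorphic_fibre: "hol \<Omega> h \<Longrightarrow> Z \<in> B \<Longrightarrow> (\<lambda>t. h (Z + t *s e)) holomorphic_on ball 0 R"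
  by (rule hol_line_holomorphic) (auto intro: fibre)

lemma finite_zeros:
  assumes "Z \<in> B" shows "finite (zeros Z)"
  unfolding zeros_def
  by (rule argument_principle_disc(1)[OF \<eta> holomorphic_fibre[OF hol_f assms]
        holomorphic_fibre[OF hol_f assms] boundary[OF assms]])

lemma local_factor:
  assumes "Z \<in> B" "t0 \<in> zeros Z"
  obtains r g where "r > 0" "cball t0 r \<subseteq> ball 0 R" "g holomorphic_on cball t0 r"
    "\<forall>t\<in>cball t0 r. f (Z + t *s e) = g t * (t - t0) ^ mult Z t0 \<and> g t \<noteq> 0"
    "mult Z t0 > 0" "zorder (\<lambda>t. f (Z + t *s e)) t0 > 0"
proof -
  let ?F = "\<lambda>t. f (Z + t *s e)"
  have t0: "t0 \<in> ball 0 R" "?F t0 = 0" "cmod t0 < \<eta>" using assms(2) \<eta> by (auto simp: zeros_def)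
  have "\<exists>w\<in>ball 0 R. ?F w \<noteq> 0"
    using argument_principle_disc(2)[OF \<eta> holomorphic_fibre[OF hol_f assms(1)]
        holomorphic_fibre[OF hol_f assms(1)] boundary[OF assms(1)] t0(3)] by simp
  from zorder_exist_zero[OF holomorphic_fibre[OF hol_f assms(1)] open_ball convex_connected[OF convex_ball] t0(1) this]
  show thesis using t0(2) that[of _ "zor_poly ?F t0"] unfolding mult_def by auto
qed

lemma mult_pos: "Z \<in> B \<Longrightarrow> t \<in> zeros Z \<Longrightarrow> mult Z t > 0"
  using local_factor by metis

lemma of_nat_mult: "Z \<in> B \<Longrightarrow> t \<in> zeros Z \<Longrightarrow> of_nat (mult Z t) = of_int (zorder (\<lambda>t. f (Z + t *s e)) t)"
  using local_factor[of Z t] unfolding mult_def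
  by (metis of_int_of_nat_eq order_less_imp_le int_nat_eq)

lemma in_fibre: "Z \<in> B \<Longrightarrow> Z + (\<eta> * E1 s) *s e \<in> \<Omega>"
  using \<eta> by (intro fibre) (auto simp: norm_mult norm_E1)

lemma nonzero_circle: "Z \<in> B \<Longrightarrow> f (Z + (\<eta> * E1 s) *s e) \<noteq> 0"
  using \<eta> by (intro boundary) (auto simp: norm_mult norm_E1)

lemma continuous_on_circle_fibre:
  assumes "continuous_on \<Omega> h"
  shows "continuous_on (B \<times> {0..1}) (\<lambda>x. h (fst x + (\<eta> * E1 (snd x)) *s e))"
  by (rule continuous_on_compose2[OF assms])
    (auto intro!: continuous_intros bounded_linear.continuous_on[OF bounded_linear_vector_scale] in_fibre)

text \<open>Single zeros need not depend holomorphically on the base point. Their weighted sum does: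
  the argument principle writes it as an integral over a fixed circle on which \<open>f\<close> has
  no zeros.\<close>

lemma hol_power_sum:
  assumes h: "hol \<Omega> h"
  shows "hol B (\<lambda>Z. \<Sum>t\<in>zeros Z. of_nat (mult Z t) * h (Z + t *s e))"
proof -
  have "hol B (\<lambda>Z. integral {0..1} (\<lambda>s. Dv f e (Z + (\<eta> * E1 s) *s e) * h (Z + (\<eta> * E1 s) *s e)
     / f (Z + (\<eta> * E1 s) *s e) * (\<eta> * E1 s)))"
  proof (rule hol_integral[OF open_B])
    show "hol B (\<lambda>Z. Dv f e (Z + (\<eta> * E1 s) *s e) * h (Z + (\<eta> * E1 s) *s e)
     / f (Z + (\<eta> * E1 s) *s e) * (\<eta> * E1 s))" for s
      using in_fibre nonzero_circle
      by (intro hol_divide hol_mult hol_const hol_translate[OF hol_f] hol_translate[OF h]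
          hol_translate[OF hol_Dv[OF open_\<Omega> hol_f]]) auto
    show "continuous_on (B \<times> {0..1}) (\<lambda>(Z, s). Dv f e (Z + (\<eta> * E1 s) *s e) * h (Z + (\<eta> * E1 s) *s e)
     / f (Z + (\<eta> * E1 s) *s e) * (\<eta> * E1 s))"
      unfolding case_prod_beta using nonzero_circle
      by (intro continuous_on_mult continuous_on_divide continuous_on_circle_fibre hol_continuous_on
          hol_f h hol_Dv open_\<Omega> continuous_on_const continuous_on_E1 continuous_on_snd continuous_on_id) auto
  qed
  then show ?thesis
  proof (rule hol_cong[OF open_B, rotated])
    fix Z assume Z: "Z \<in> B"
    let ?F = "\<lambda>t. f (Z + t *s e)"
    have d: "deriv ?F (\<eta> * E1 s) = Dv f e (Z + (\<eta> * E1 s) *s e)" for s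
      by (rule DERIV_imp_deriv, rule hol_line[OF hol_f in_fibre[OF Z]])
    have "(\<Sum>t\<in>zeros Z. of_nat (mult Z t) * h (Z + t *s e))
      = (\<Sum>t\<in>zeros Z. h (Z + t *s e) * of_int (zorder ?F t))"
      by (intro sum.cong) (auto simp: of_nat_mult[OF Z])
    also have "\<dots> = integral {0..1} (\<lambda>s. deriv ?F (\<eta> * E1 s) * h (Z + (\<eta> * E1 s) *s e)
      / f (Z + (\<eta> * E1 s) *s e) * (\<eta> * E1 s))"
      unfolding zeros_def
      by (rule argument_principle_disc(3)[OF \<eta> holomorphic_fibre[OF hol_f Z] holomorphic_fibre[OF h Z]
            boundary[OF Z]])
    finally show "integral {0..1} (\<lambda>s. Dv f e (Z + (\<eta> * E1 s) *s e) * h (Z + (\<eta> * E1 s) *s e)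
     / f (Z + (\<eta> * E1 s) *s e) * (\<eta> * E1 s)) = (\<Sum>t\<in>zeros Z. of_nat (mult Z t) * h (Z + t *s e))"
      by (simp add: d)
  qed
qed

text \<open>With weight 1, \<open>hol_power_sum\<close> shows that the count is continuous, and
  distinct integers have distance at least 1.\<close>

lemma count_constant:
  assumes "connected B" "Z \<in> B" "Z' \<in> B"
  shows "count Z = count Z'"
proof -
  have c: "continuous_on B (\<lambda>Z. of_nat (count Z) :: complex)"
    using hol_continuous_on[OF hol_power_sum[OF hol_const[of _ 1]]] by (simp add: count_def)
  have "(\<lambda>Z. of_nat (count Z) :: complex) constant_on B"
  proof (rule continuous_discrete_range_constant[OF assms(1) c])
    fix Z assume "Z \<in> B"
    show "\<exists>e>0. \<forall>y. y \<in> B \<and> of_nat (count y) \<noteq> (of_nat (count Z) :: complex)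
        \<longrightarrow> e \<le> norm (of_nat (count y) - (of_nat (count Z) :: complex))"
    proof (intro exI[of _ 1] conjI allI impI)
      fix y assume "y \<in> B \<and> of_nat (count y) \<noteq> (of_nat (count Z) :: complex)"
      then have "count y \<noteq> count Z" by auto
      then have "1 \<le> \<bar>int (count y) - int (count Z)\<bar>" by linarith
      then have "1 \<le> \<bar>real (count y) - real (count Z)\<bar>" by linarith
      also have "\<dots> = norm (of_real (real (count y) - real (count Z)) :: complex)"
        by (simp only: norm_of_real)
      finally show "1 \<le> norm (of_nat (count y) - (of_nat (count Z) :: complex))" by simp
    qed simp
  qed
  then show ?thesis using assms(2,3) unfolding constant_on_def by (metis of_nat_eq_iff)
qed

end

section \<open>Norms along the fibres\<close>

text \<open>As a formal power series, \<open>Q\<close> has logarithmic derivative minus the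
  generating series of the power sums, because each factor 1 - c X is inverse to the geometric
  series of c. Comparing coefficients in Q' = - Q P gives Newton's recursion.\<close>

lemma newton_identity:
  fixes g :: "'i \<Rightarrow> complex" and m :: "'i \<Rightarrow> nat"
  assumes "finite T"
  defines "Q \<equiv> (\<Prod>t\<in>T. [:1, - g t:] ^ m t)"
  shows "of_nat (Suc j) * coeff Q (Suc j)
    = - (\<Sum>i\<le>j. coeff Q (j - i) * (\<Sum>t\<in>T. of_nat (m t) * g t ^ Suc i))"
proof -
  define L where "L c = fps_of_poly [:1, - c:]" for c :: complex
  define P where "P T = Abs_fps (\<lambda>i. \<Sum>t\<in>T. of_nat (m t) * g t ^ Suc i)" for T
  have geo: "L c * Abs_fps (\<lambda>i. c ^ i) = 1" for c
  proof (rule fps_ext)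
    show "fps_nth (L c * Abs_fps (\<lambda>i. c ^ i)) k = fps_nth 1 k" for k
      by (cases k) (auto simp: L_def fps_of_poly_pCons algebra_simps)
  qed
  have dL: "fps_deriv (L c) = - fps_const c" for c
    by (simp add: L_def fps_of_poly_pCons)
  have dLm: "fps_deriv (L c ^ k) = - (L c ^ k * Abs_fps (\<lambda>i. of_nat k * c ^ Suc i))" for c k
  proof -
    have a: "Abs_fps (\<lambda>i. of_nat k * c ^ Suc i) = of_nat k * fps_const c * Abs_fps (\<lambda>i. c ^ i)"
      by (rule fps_ext) (simp add: fps_of_nat[symmetric] mult.assoc)
    show ?thesis
    proof (cases k)
      case 0
      then show ?thesis by (simp add: fps_zero_def[symmetric])
    next
      case (Suc l)
      have "fps_deriv (L c ^ k) = of_nat k * (- fps_const c) * L c ^ l"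
        unfolding Suc by (subst fps_deriv_power) (simp add: dL fps_of_nat del: of_nat_Suc fps_const_neg)
      also have "\<dots> = - (L c ^ l * (L c * Abs_fps (\<lambda>i. c ^ i)) * (of_nat k * fps_const c))"
        unfolding geo by (simp add: mult.commute del: fps_const_neg)
      also have "\<dots> = - (L c ^ k * Abs_fps (\<lambda>i. of_nat k * c ^ Suc i))"
        unfolding a unfolding Suc by (simp only: power_Suc mult_ac)
      finally show ?thesis .
    qed
  qed
  have "fps_deriv (\<Prod>t\<in>T. L (g t) ^ m t) = - ((\<Prod>t\<in>T. L (g t) ^ m t) * P T)"
    using assms(1)
  proof (induction T rule: finite_induct)
    case empty
    then show ?case by (simp add: P_def fps_zero_def[symmetric])
  next
    case (insert t T)
    have p: "P (insert t T) = Abs_fps (\<lambda>i. of_nat (m t) * g t ^ Suc i) + P T"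
      unfolding P_def by (rule fps_ext) (simp add: insert.hyps)
    show ?case
      by (simp add: insert.hyps insert.IH p dLm algebra_simps)
  qed
  moreover have "(\<Prod>t\<in>T. L (g t) ^ m t) = fps_of_poly Q"
    unfolding Q_def L_def by (simp add: fps_of_poly_prod fps_of_poly_power)
  ultimately have "fps_nth (fps_deriv (fps_of_poly Q)) j = fps_nth (- (fps_of_poly Q * P T)) j"
    by simp
  then have "of_nat (Suc j) * coeff Q (Suc j)
      = - (\<Sum>i\<le>j. coeff Q i * (\<Sum>t\<in>T. of_nat (m t) * g t ^ Suc (j - i)))"
    by (simp add: fps_mult_nth P_def atLeast0AtMost mult.commute del: of_nat_Suc power_Suc)
  also have "(\<Sum>i\<le>j. coeff Q i * (\<Sum>t\<in>T. of_nat (m t) * g t ^ Suc (j - i)))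
      = (\<Sum>i\<le>j. coeff Q (j - i) * (\<Sum>t\<in>T. of_nat (m t) * g t ^ Suc i))"
    by (rule sum.reindex_bij_witness[of _ "\<lambda>i. j - i" "\<lambda>i. j - i"]) auto
  finally show ?thesis .
qed

text \<open>Newton's recursion starts from a constant coefficient 1, so it runs on the reflected
  polynomial; the degree is needed to reflect back.\<close>

lemma char_poly_reflect:
  fixes g :: "'i \<Rightarrow> complex" and m :: "'i \<Rightarrow> nat"
  assumes "finite T"
  defines "P \<equiv> (\<Prod>t\<in>T. [:- g t, 1:] ^ m t)"
  shows "reflect_poly P = (\<Prod>t\<in>T. [:1, - g t:] ^ m t)" "degree P = (\<Sum>t\<in>T. m t)"
proof -
  have "reflect_poly [:- c, 1:] = [:1, - c:]" for c :: complex
    by (simp add: reflect_poly_def)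
  then show "reflect_poly P = (\<Prod>t\<in>T. [:1, - g t:] ^ m t)"
    unfolding P_def by (simp add: reflect_poly_prod reflect_poly_power)
  show "degree P = (\<Sum>t\<in>T. m t)"
    unfolding P_def by (subst degree_prod_sum_eq) (auto simp: degree_power_eq)
qed

context fibre_zeros
begin

text \<open>The characteristic polynomial of multiplication by \<open>G\<close> on the holomorphic
  functions on the fibre disc modulo \<open>f\<close>: its roots are the values of \<open>G\<close>
  at the zeros of \<open>f\<close>, and its constant coefficient is, up to sign, the norm of
  \<open>G\<close>.\<close>

definition char_poly :: "(complex^'n \<Rightarrow> complex) \<Rightarrow> complex^'n \<Rightarrow> complex poly" where
  "char_poly G Z = (\<Prod>t\<in>zeros Z. [:- G (Z + t *s e), 1:] ^ mult Z t)"

lemma degree_char_poly: "Z \<in> B \<Longrightarrow> degree (char_poly G Z) = count Z"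
  unfolding char_poly_def count_def by (rule char_poly_reflect(2)[OF finite_zeros])

text \<open>By Newton's identities the coefficients are polynomials in the power sums of the values
  of \<open>G\<close>. Connectedness of \<open>B\<close> fixes the degree, so reflection uses the
  same index over all of \<open>B\<close>.\<close>

lemma hol_coeff_char_poly:
  assumes G: "hol \<Omega> G" and "connected B"
  shows "hol B (\<lambda>Z. coeff (char_poly G Z) k)"
proof (cases "B = {}")
  case False
  then obtain Z0 where Z0: "Z0 \<in> B" by blast
  define N where "N = count Z0"
  have N: "count Z = N" if "Z \<in> B" for Z
    unfolding N_def by (rule count_constant[OF assms(2) that Z0])
  have r: "reflect_poly (char_poly G Z) = (\<Prod>t\<in>zeros Z. [:1, - G (Z + t *s e):] ^ mult Z t)"
    if "Z \<in> B" for Z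
    unfolding char_poly_def by (rule char_poly_reflect(1)[OF finite_zeros[OF that]])
  have refl: "hol B (\<lambda>Z. coeff (reflect_poly (char_poly G Z)) j)" for j
  proof (induction j rule: less_induct)
    case (less j)
    show ?case
    proof (cases j)
      case 0
      show ?thesis
      proof (rule hol_cong[OF open_B _ hol_const[of B 1]])
        show "1 = coeff (reflect_poly (char_poly G Z)) j" if "Z \<in> B" for Z
          unfolding r[OF that] 0 by (simp add: poly_0_coeff_0[symmetric] poly_prod)
      qed
    next
      case (Suc l)
      have "hol B (\<lambda>Z. (- 1 / of_nat (Suc l)) *
          (\<Sum>i\<le>l. coeff (reflect_poly (char_poly G Z)) (l - i) *
            (\<Sum>t\<in>zeros Z. of_nat (mult Z t) * G (Z + t *s e) ^ Suc i)))"
        using Suc by (intro hol_mult hol_sum hol_const less hol_power_sum hol_power G) auto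
      then show ?thesis
      proof (rule hol_cong[OF open_B, rotated])
        fix Z assume Z: "Z \<in> B"
        show "(- 1 / of_nat (Suc l)) *
          (\<Sum>i\<le>l. coeff (reflect_poly (char_poly G Z)) (l - i) *
            (\<Sum>t\<in>zeros Z. of_nat (mult Z t) * G (Z + t *s e) ^ Suc i))
          = coeff (reflect_poly (char_poly G Z)) j"
          using newton_identity[OF finite_zeros[OF Z], of l "\<lambda>t. G (Z + t *s e)" "mult Z"]
          unfolding Suc r[OF Z] by (simp add: field_simps del: of_nat_Suc power_Suc)
      qed
    qed
  qed
  show ?thesis
  proof (cases "k \<le> N")
    case True
    show ?thesis
    proof (rule hol_cong[OF open_B _ refl[of "N - k"]])
      show "coeff (reflect_poly (char_poly G Z)) (N - k) = coeff (char_poly G Z) k" if "Z \<in> B" for Z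
        using True by (simp add: coeff_reflect_poly degree_char_poly[OF that] N[OF that])
    qed
  next
    case False
    show ?thesis
    proof (rule hol_cong[OF open_B _ hol_const[of B 0]])
      show "0 = coeff (char_poly G Z) k" if "Z \<in> B" for Z
        using False by (intro coeff_eq_0[symmetric]) (simp add: degree_char_poly[OF that] N[OF that])
    qed
  qed
qed (simp add: hol_def)

lemma coeff_0_char_poly:
  assumes "Z \<in> B"
  shows "coeff (char_poly G Z) 0 \<noteq> 0 \<longleftrightarrow> (\<forall>t\<in>zeros Z. G (Z + t *s e) \<noteq> 0)"
  using finite_zeros[OF assms] mult_pos[OF assms]
  by (auto simp: char_poly_def poly_0_coeff_0[symmetric] poly_prod)

text \<open>The Cayley-Hamilton theorem for multiplication by \<open>G\<close> modulo \<open>f\<close> on a fibre.\<close>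

lemma char_poly_dvd:
  assumes Z: "Z \<in> B" and G: "hol \<Omega> G"
  obtains q R' where "q holomorphic_on ball 0 R'" "\<eta> < R'"
    "\<And>t. cmod t \<le> \<eta> \<Longrightarrow> poly (char_poly G Z) (G (Z + t *s e)) = f (Z + t *s e) * q t"
proof -
  let ?F = "\<lambda>t. f (Z + t *s e)" and ?G = "\<lambda>t. G (Z + t *s e)"
  let ?K = "\<lambda>t. poly (char_poly G Z) (?G t)"
  have F: "?F holomorphic_on ball 0 R" and Gh: "?G holomorphic_on ball 0 R"
    using holomorphic_fibre Z hol_f G by auto
  have K: "?K holomorphic_on ball 0 R"
    unfolding poly_altdef by (intro holomorphic_intros Gh)
  have fin: "finite (zeros Z)" by (rule finite_zeros[OF Z])
  \<comment> \<open>The quotient has to be holomorphic on a disc larger than the circle of radius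
    \<open>\<eta>\<close> for Cauchy's formula. Zeros beyond this circle keep a positive distance
    from it, by compactness of the annulus.\<close>
  obtain R' where R': "\<eta> < R'" "R' \<le> R" "\<And>t. cmod t < R' \<Longrightarrow> ?F t = 0 \<Longrightarrow> t \<in> zeros Z"
  proof -
    obtain R1 where R1: "\<eta> < R1" "R1 < R" using \<eta> dense by blast
    let ?C = "{t. \<eta> \<le> cmod t \<and> cmod t \<le> R1}"
    have C: "compact {t \<in> ?C. ?F t = 0}"
    proof -
      have "closed (cball (0::complex) R1 - ball 0 \<eta>)" by (intro closed_Diff) auto
      moreover have "cball (0::complex) R1 - ball 0 \<eta> = ?C" by (auto simp: dist_norm)
      ultimately have cl: "closed ?C" by argo
      have "continuous_on ?C ?F"
        using R1 by (intro holomorphic_on_imp_continuous_on holomorphic_on_subset[OF F]) auto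
      then have "closed {t \<in> ?C. ?F t = 0}"
        using continuous_closed_preimage_constant[OF _ cl] by blast
      moreover have "bounded {t \<in> ?C. ?F t = 0}"
        by (rule bounded_subset[OF bounded_cball[of 0 R1]]) auto
      ultimately show ?thesis by (simp add: compact_eq_bounded_closed)
    qed
    show thesis
    proof (cases "{t \<in> ?C. ?F t = 0} = {}")
      case True
      then show ?thesis using that[of R1] R1 by (force simp: zeros_def)
    next
      case False
      obtain s where s: "s \<in> {t \<in> ?C. ?F t = 0}" "\<And>t. t \<in> {t \<in> ?C. ?F t = 0} \<Longrightarrow> cmod s \<le> cmod t"
        using continuous_attains_inf[OF C False continuous_on_norm_id] by blast
      have "\<eta> < cmod s" using s(1) boundary[OF Z, of s] by force
      then show ?thesis
        using that[of "cmod s"] s R1 by (force simp: zeros_def not_less[symmetric])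
    qed
  qed
  have lim: "\<exists>l. ((\<lambda>t. ?K t / ?F t) \<longlongrightarrow> l) (at t0)" if t0: "t0 \<in> zeros Z" for t0
  proof -
    obtain r g where r: "r > 0" "cball t0 r \<subseteq> ball 0 R" "g holomorphic_on cball t0 r"
      "\<forall>t\<in>cball t0 r. ?F t = g t * (t - t0) ^ mult Z t0 \<and> g t \<noteq> 0"
      by (rule local_factor[OF Z t0])
    \<comment> \<open>Near \<open>t0\<close> the zero of \<open>f\<close> of order
      \<open>mult Z t0\<close> is cancelled by the equally many factors of the polynomial with root
      \<open>?G t0\<close>; the difference quotient tends to the derivative of
      \<open>?G\<close>.\<close>
    let ?D = "\<lambda>t. ((?G t - ?G t0) / (t - t0)) ^ mult Z t0 *
       (\<Prod>s\<in>zeros Z - {t0}. (?G t - ?G s) ^ mult Z s) / g t"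
    have t0R: "t0 \<in> ball 0 R" using t0 \<eta> by (auto simp: zeros_def)
    have "(?G has_field_derivative deriv ?G t0) (at t0)"
      by (rule holomorphic_derivI[OF Gh open_ball t0R])
    then have d: "((\<lambda>t. (?G t - ?G t0) / (t - t0)) \<longlongrightarrow> deriv ?G t0) (at t0)"
      by (simp add: has_field_derivative_iff)
    have cG: "(?G \<longlongrightarrow> ?G t0) (at t0)"
      using holomorphic_on_imp_continuous_on[OF Gh] t0R open_ball
      by (metis continuous_on_eq_continuous_at isCont_def)
    have "continuous_on (ball t0 r) g"
      using r(3) by (meson ball_subset_cball continuous_on_subset holomorphic_on_imp_continuous_on)
    then have cg: "(g \<longlongrightarrow> g t0) (at t0)"
      using r(1) by (metis centre_in_ball continuous_on_eq_continuous_at isCont_def open_ball)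
    have g0: "g t0 \<noteq> 0" using r(1,4) by auto
    have "(?D \<longlongrightarrow> deriv ?G t0 ^ mult Z t0 * (\<Prod>s\<in>zeros Z - {t0}. (?G t0 - ?G s) ^ mult Z s) / g t0) (at t0)"
      by (intro tendsto_intros d cG cg g0)
    moreover have "\<forall>\<^sub>F t in at t0. ?D t = ?K t / ?F t"
      unfolding eventually_at
    proof (intro exI[of _ r] conjI ballI impI)
      fix t assume t: "t \<noteq> t0 \<and> dist t t0 < r"
      have "?K t = (\<Prod>s\<in>zeros Z. (?G t - ?G s) ^ mult Z s)"
        by (simp add: char_poly_def poly_prod)
      also have "\<dots> = (?G t - ?G t0) ^ mult Z t0 * (\<Prod>s\<in>zeros Z - {t0}. (?G t - ?G s) ^ mult Z s)"
        by (rule prod.remove[OF fin t0])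
      finally show "?D t = ?K t / ?F t"
        using t r(4)[rule_format, of t] by (simp add: dist_commute power_divide)
    qed (use r in auto)
    ultimately show ?thesis by (intro exI) (rule Lim_transform_eventually)
  qed
  define q where "q t = (if t \<in> zeros Z then Lim (at t) (\<lambda>t. ?K t / ?F t) else ?K t / ?F t)" for t
  have nzq: "\<forall>\<^sub>F t in at t0. q t = ?K t / ?F t" for t0
  proof -
    have "\<forall>\<^sub>F t in at t0. t \<in> - (zeros Z - {t0})"
      by (rule eventually_at_in_open'[OF open_Compl[OF finite_imp_closed]]) (use fin in auto)
    then have "\<forall>\<^sub>F t in at t0. t \<notin> zeros Z"
      using eventually_neq_at_within[of t0 t0 UNIV] by eventually_elim auto
    then show ?thesis by eventually_elim (simp add: q_def)
  qed
  have q: "q holomorphic_on ball 0 R'"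
  proof (rule no_isolated_singularity')
    show "(q \<longlongrightarrow> q t0) (at t0 within ball 0 R')" if t0: "t0 \<in> zeros Z" for t0
    proof -
      obtain l where l: "((\<lambda>t. ?K t / ?F t) \<longlongrightarrow> l) (at t0)" using lim[OF t0] by blast
      then have "q t0 = l" using t0 tendsto_Lim[OF _ l] by (simp add: q_def)
      moreover have "(q \<longlongrightarrow> l) (at t0)"
        by (rule Lim_transform_eventually[OF l]) (use nzq[of t0] in eventually_elim, simp)
      ultimately show ?thesis using tendsto_within_subset by blast
    qed
    have "(\<lambda>t. ?K t / ?F t) holomorphic_on (ball 0 R' - zeros Z)"
      using R' by (intro holomorphic_on_divide holomorphic_on_subset[OF K] holomorphic_on_subset[OF F])
        (auto simp: dist_norm)
    then show "q holomorphic_on (ball 0 R' - zeros Z)"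
      by (rule holomorphic_transform) (simp add: q_def)
  qed (use fin in auto)
  show thesis
  proof (rule that[OF q R'(1)])
    fix t assume t: "cmod t \<le> \<eta>"
    show "?K t = ?F t * q t"
    proof (cases "t \<in> zeros Z")
      case True
      then have "?F t = 0" by (simp add: zeros_def)
      moreover have "?K t = 0"
        using True fin mult_pos[OF Z True] by (auto simp: char_poly_def poly_prod)
      ultimately show ?thesis by simp
    next
      case False
      then have "?F t \<noteq> 0" using t R' by force
      then show ?thesis using False by (simp add: q_def)
    qed
  qed
qed

text \<open>Cauchy's formula recovers the quotient from the boundary circle, where it is an honest
  quotient with nonzero denominator. In this form it depends holomorphically on the base point as
  well as on \<open>t\<close>.\<close>

lemma char_poly_eq_integral:
  assumes Z: "Z \<in> B" and G: "hol \<Omega> G" and t: "cmod t < \<eta>"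
  shows "poly (char_poly G Z) (G (Z + t *s e)) = f (Z + t *s e) *
    integral {0..1} (\<lambda>s. poly (char_poly G Z) (G (Z + (\<eta> * E1 s) *s e)) / f (Z + (\<eta> * E1 s) *s e)
       / (\<eta> * E1 s - t) * (\<eta> * E1 s))"
proof -
  let ?K = "\<lambda>t. poly (char_poly G Z) (G (Z + t *s e))"
  obtain q R' where q: "q holomorphic_on ball 0 R'" "\<eta> < R'"
    "\<And>t. cmod t \<le> \<eta> \<Longrightarrow> ?K t = f (Z + t *s e) * q t"
    using char_poly_dvd[OF Z G] by metis
  have "((\<lambda>u. q u/(u - t)) has_contour_integral (2 * of_real pi * \<i> * q t)) (circlepath 0 \<eta>)"
    using t q by (intro Cauchy_integral_circlepath_simple holomorphic_on_subset[OF q(1)]) auto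
  then have "2 * of_real pi * \<i> * q t = contour_integral (circlepath 0 \<eta>) (\<lambda>u. q u/(u - t))"
    by (simp add: contour_integral_unique)
  also have "\<dots> = integral {0..1} (\<lambda>s. (2 * of_real pi * \<i>) * (q (\<eta> * E1 s) / (\<eta> * E1 s - t) * (\<eta> * E1 s)))"
    unfolding contour_integral_circlepath_eq by (intro integral_cong) (simp add: algebra_simps)
  also have "\<dots> = (2 * of_real pi * \<i>) * integral {0..1} (\<lambda>s. q (\<eta> * E1 s) / (\<eta> * E1 s - t) * (\<eta> * E1 s))"
    by (rule integral_mult_right)
  finally have "q t = integral {0..1} (\<lambda>s. q (\<eta> * E1 s) / (\<eta> * E1 s - t) * (\<eta> * E1 s))"
    by simp
  also have "\<dots> = integral {0..1} (\<lambda>s. ?K (\<eta> * E1 s) / f (Z + (\<eta> * E1 s) *s e) / (\<eta> * E1 s - t) * (\<eta> * E1 s))"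
  proof (rule integral_cong)
    fix s :: real
    have "?K (\<eta> * E1 s) = f (Z + (\<eta> * E1 s) *s e) * q (\<eta> * E1 s)"
      using \<eta> by (intro q) (simp add: norm_mult norm_E1)
    then show "q (\<eta> * E1 s) / (\<eta> * E1 s - t) * (\<eta> * E1 s)
      = ?K (\<eta> * E1 s) / f (Z + (\<eta> * E1 s) *s e) / (\<eta> * E1 s - t) * (\<eta> * E1 s)"
      using nonzero_circle[OF Z, of s] by simp
  qed
  finally show ?thesis using q(3)[of t] t by simp
qed

text \<open>On a two-dimensional slice, the norm \<open>r\<close> of \<open>G\<close> modulo \<open>f\<close> lies in the ideal of \<open>f\<close> and \<open>G\<close>.\<close>

lemma norm_on_slice:
  fixes P v :: "complex^'n"
  assumes G: "hol \<Omega> G" and "connected B"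
  defines "D \<equiv> {x. P + x *s v \<in> B}"
    and "V \<equiv> {z :: complex^2. P + z $ 1 *s v \<in> B \<and> cmod (z $ 2) < \<eta>}"
  obtains \<alpha> \<beta> r where "hol V \<alpha>" "hol V \<beta>" "r holomorphic_on D"
    "\<And>x. x \<in> D \<Longrightarrow> r x \<noteq> 0 \<longleftrightarrow> (\<forall>t\<in>zeros (P + x *s v). G (P + x *s v + t *s e) \<noteq> 0)"
    "\<And>z. z \<in> V \<Longrightarrow> r (z $ 1) = f (P + z $ 1 *s v + z $ 2 *s e) * \<alpha> z
        + G (P + z $ 1 *s v + z $ 2 *s e) * \<beta> z"
proof (cases "B = {}")
  case True
  then show ?thesis
    by (intro that[of "\<lambda>_. 0" "\<lambda>_. 0" "\<lambda>_. 0"]) (auto simp: D_def V_def hol_def)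
next
  case False
  then obtain Z0 where Z0: "Z0 \<in> B" by blast
  define N where "N = count Z0"
  define c where "c k Z = coeff (char_poly G Z) k" for k Z
  have N: "degree (char_poly G Z) = N" if "Z \<in> B" for Z
    unfolding N_def using degree_char_poly[OF that] count_constant[OF assms(2) that Z0] by simp
  have c: "hol B (c k)" for k
    unfolding c_def by (rule hol_coeff_char_poly[OF G assms(2)])
  have pol: "poly (char_poly G Z) y = (\<Sum>k\<le>N. c k Z * y ^ k)" if "Z \<in> B" for Z y
    using N[OF that] by (simp add: poly_altdef c_def)
  have affine: "\<exists>D. ((\<lambda>z. P + z $ 1 *s v) has_derivative D) (at z) \<and> (\<forall>c x. D (c *s x) = c *s D x)"
    for z :: "complex^2"
    using has_derivative_add[OF has_derivative_const
        bounded_linear_imp_has_derivative[OF bounded_linear_vector_scale_nth[of 1 v]]]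
    by (intro exI[of _ "\<lambda>h. 0 + h $ 1 *s v"]) auto
  have affine2: "\<exists>D. ((\<lambda>z. P + z $ 1 *s v + z $ 2 *s e) has_derivative D) (at z) \<and> (\<forall>c x. D (c *s x) = c *s D x)"
    for z :: "complex^2"
    using has_derivative_add[OF has_derivative_add[OF has_derivative_const
        bounded_linear_imp_has_derivative[OF bounded_linear_vector_scale_nth[of 1 v]]]
        bounded_linear_imp_has_derivative[OF bounded_linear_vector_scale_nth[of 2 e]]]
    by (intro exI[of _ "\<lambda>h. 0 + h $ 1 *s v + h $ 2 *s e"]) (auto simp: vector_add_ldistrib)
  have contA: "continuous_on UNIV (\<lambda>z :: complex^2. P + z $ 1 *s v)"
    by (intro continuous_intros bounded_linear.continuous_on[OF bounded_linear_vector_scale])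
  have openV: "open V"
  proof -
    have "open ((\<lambda>z :: complex^2. P + z $ 1 *s v) -` B)"
      using contA open_B by (simp add: continuous_on_open_vimage)
    moreover have "open {z :: complex^2. cmod (z $ 2) < \<eta>}"
      by (intro open_Collect_less continuous_intros)
    moreover have "V = ((\<lambda>z. P + z $ 1 *s v) -` B) \<inter> {z. cmod (z $ 2) < \<eta>}"
      by (auto simp: V_def)
    ultimately show ?thesis by auto
  qed
  have cV: "hol V (\<lambda>z. c k (P + z $ 1 *s v))" for k
    using affine by (intro hol_compose[OF c]) (auto simp: V_def)
  have in\<Omega>: "P + z $ 1 *s v + z $ 2 *s e \<in> \<Omega>" if "z \<in> V" for z
    using that \<eta> by (auto simp: V_def intro!: fibre)
  have GV: "hol V (\<lambda>z. G (P + z $ 1 *s v + z $ 2 *s e))"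
    using affine2 in\<Omega> by (intro hol_compose[OF G]) auto
  define I where "I z s = (\<Sum>k\<le>N. c k (P + z $ 1 *s v) * G (P + z $ 1 *s v + (\<eta> * E1 s) *s e) ^ k)
      / f (P + z $ 1 *s v + (\<eta> * E1 s) *s e) / (\<eta> * E1 s - z $ 2) * (\<eta> * E1 s)" for z :: "complex^2" and s
  have ne: "\<eta> * E1 s - z $ 2 \<noteq> 0" if "z \<in> V" for z s
  proof
    assume "\<eta> * E1 s - z $ 2 = 0"
    then have "z $ 2 = \<eta> * E1 s" by simp
    then have "cmod (z $ 2) = \<eta>" using \<eta> by (simp add: norm_mult norm_E1)
    then show False using that by (simp add: V_def)
  qed
  have VB: "P + z $ 1 *s v \<in> B" if "z \<in> V" for z using that by (simp add: V_def)
  have circ: "hol V (\<lambda>z. h (P + z $ 1 *s v + (\<eta> * E1 s) *s e))" if "hol \<Omega> h" for h s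
    using has_derivative_add[OF has_derivative_add[OF has_derivative_const
        bounded_linear_imp_has_derivative[OF bounded_linear_vector_scale_nth[of 1 v]]] has_derivative_const]
      in_fibre VB
    by (intro hol_compose[OF that] exI[of _ "\<lambda>h. 0 + h $ 1 *s v + 0"]) auto
  have ccirc: "continuous_on (V \<times> {0..1}) (\<lambda>x. h (P + fst x $ 1 *s v + (\<eta> * E1 (snd x)) *s e))" if "hol \<Omega> h" for h
    by (rule continuous_on_compose2[OF hol_continuous_on[OF that]])
      (auto intro!: continuous_intros bounded_linear.continuous_on[OF bounded_linear_vector_scale] in_fibre VB)
  define \<alpha> where "\<alpha> z = integral {0..1} (I z)" for z
  have \<alpha>: "hol V \<alpha>"
    unfolding \<alpha>_def
  proof (rule hol_integral[OF openV])
    show "hol V (\<lambda>z. I z s)" for s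
      unfolding I_def using nonzero_circle ne VB
      by (intro hol_divide hol_mult hol_sum hol_power hol_diff hol_const hol_nth cV circ G hol_f) auto
    have "continuous_on (V \<times> {0..1}) (\<lambda>x. c k (P + fst x $ 1 *s v))" for k
      by (rule continuous_on_compose2[OF hol_continuous_on[OF cV[of k]], of _ fst]) (auto intro!: continuous_intros)
    then show "continuous_on (V \<times> {0..1}) (\<lambda>(z, s). I z s)"
      unfolding case_prod_beta I_def using nonzero_circle ne VB
      by (intro continuous_on_divide continuous_on_mult continuous_on_sum continuous_on_power ccirc G hol_f
          continuous_on_diff continuous_on_const continuous_on_E1 continuous_on_snd continuous_on_fst
          continuous_on_id bounded_linear.continuous_on[OF bounded_linear_vec_nth]) auto
  qed
  \<comment> \<open>The Cayley-Hamilton relation is solved for its constant term: all terms of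
    positive degree contain a factor \<open>G\<close>, and the whole polynomial is \<open>f\<close>
    times \<open>\<alpha>\<close>.\<close>
  define \<beta> where "\<beta> z = - (\<Sum>k\<in>{1..N}. c k (P + z $ 1 *s v) * G (P + z $ 1 *s v + z $ 2 *s e) ^ (k - 1))" for z :: "complex^2"
  have "hol V (\<lambda>z. (- 1) * (\<Sum>k\<in>{1..N}. c k (P + z $ 1 *s v) * G (P + z $ 1 *s v + z $ 2 *s e) ^ (k - 1)))"
    by (intro hol_mult hol_sum hol_power hol_const cV GV)
  then have \<beta>: "hol V \<beta>" by (simp add: \<beta>_def[abs_def])
  show thesis
  proof (rule that[of \<alpha> \<beta> "\<lambda>x. c 0 (P + x *s v)"])
    show "(\<lambda>x. c 0 (P + x *s v)) holomorphic_on D"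
      by (rule hol_line_holomorphic[OF c]) (simp add: D_def)
    show "c 0 (P + x *s v) \<noteq> 0 \<longleftrightarrow> (\<forall>t\<in>zeros (P + x *s v). G (P + x *s v + t *s e) \<noteq> 0)" if "x \<in> D" for x
      unfolding c_def using that by (intro coeff_0_char_poly) (simp add: D_def)
    show "c 0 (P + z $ 1 *s v) = f (P + z $ 1 *s v + z $ 2 *s e) * \<alpha> z
        + G (P + z $ 1 *s v + z $ 2 *s e) * \<beta> z" if z: "z \<in> V" for z
    proof -
      let ?Z = "P + z $ 1 *s v" and ?G = "G (P + z $ 1 *s v + z $ 2 *s e)"
      have "(\<Sum>k\<le>N. c k ?Z * ?G ^ k) = f (?Z + z $ 2 *s e) * \<alpha> z"
        using char_poly_eq_integral[OF VB[OF z] G, of "z $ 2"] z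
        unfolding pol[OF VB[OF z]] \<alpha>_def I_def by (simp add: V_def)
      moreover have "(\<Sum>k\<le>N. c k ?Z * ?G ^ k) = c 0 ?Z + (\<Sum>k\<in>{1..N}. c k ?Z * ?G ^ k)"
        by (simp add: atMost_atLeast0 sum.atLeast_Suc_atMost[of 0 N])
      moreover have "(\<Sum>k\<in>{1..N}. c k ?Z * ?G ^ k) = - (?G * \<beta> z)"
        unfolding \<beta>_def by (simp add: sum_distrib_left)
          (intro sum.cong, auto simp: power_eq_if)
      ultimately show ?thesis by (simp add: algebra_simps)
    qed
  qed (rule \<alpha> \<beta>)+
qed

end

section \<open>Regular points of codimension one\<close>

lemma complex_linear_eq_matrix:
  fixes D :: "complex^'n \<Rightarrow> complex^'m"
  assumes "linear D" "\<And>c v. D (c *s v) = c *s D v"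
  shows "D = (\<lambda>v. matrix D *v v)"
proof -
  have "Vector_Spaces.linear (*s) (*s) D"
    using linear_add[OF assms(1)] assms(2) by unfold_locales auto
  then show ?thesis using matrix_works by metis
qed

lemma holomorphic_map_onI:
  assumes "\<And>z. z \<in> S \<Longrightarrow> \<exists>D. (f has_derivative D) (at z) \<and> (\<forall>c v. D (c *s v) = c *s D v)"
  shows "holomorphic_map_on S f"
  unfolding holomorphic_map_on_def
proof
  fix z assume "z \<in> S"
  then obtain D where "(f has_derivative D) (at z)" "\<forall>c v. D (c *s v) = c *s D v"
    using assms by blast
  then show "\<exists>A. (f has_derivative (\<lambda>v. A *v v)) (at z)"
    using complex_linear_eq_matrix[of D] has_derivative_linear by metis
qed

lemma holomorphic_map_onD:
  assumes "holomorphic_map_on S f" "z \<in> S"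
  shows "\<exists>D. (f has_derivative D) (at z) \<and> (\<forall>c v. D (c *s v) = c *s D v)"
proof -
  obtain A :: "complex^'a^'b" where "(f has_derivative (\<lambda>v. A *v v)) (at z)"
    using assms unfolding holomorphic_map_on_def by blast
  then show ?thesis by (auto simp: vector_scalar_commute intro!: exI[of _ "\<lambda>v. A *v v"])
qed

lemma holomorphic_map_on_nth: "holomorphic_map_on S H \<Longrightarrow> hol S (\<lambda>z. H z $ i)"
  by (rule hol_compose[where T = UNIV and f = "\<lambda>z. z $ i" and g = H]) (auto intro: hol_nth holomorphic_map_onD)

lemma biholomorphic_on_subset:
  assumes "biholomorphic_on U \<phi>" "V \<subseteq> U" "open V"
  shows "biholomorphic_on V \<phi>"
proof -
  have inj: "inj_on \<phi> U" and op: "open (\<phi> ` U)" and h: "holomorphic_map_on U \<phi>"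
    and hi: "holomorphic_map_on (\<phi> ` U) (inv_into U \<phi>)"
    using assms(1) by (auto simp: biholomorphic_on_def)
  have "continuous_on (\<phi> ` U) (inv_into U \<phi>)"
    using hi unfolding holomorphic_map_on_def
    by (meson continuous_at_imp_continuous_on has_derivative_continuous)
  then have "open (inv_into U \<phi> -` V \<inter> \<phi> ` U)"
    using assms(3) op by (metis continuous_on_open_vimage)
  moreover have "inv_into U \<phi> -` V \<inter> \<phi> ` U = \<phi> ` V"
    using inj assms(2) by (auto simp: inv_into_f_f image_iff)
  ultimately have opV: "open (\<phi> ` V)" by simp
  have injV: "inj_on \<phi> V" using inj assms(2) inj_on_subset by blast
  have "holomorphic_map_on (\<phi> ` V) (inv_into V \<phi>)"
    unfolding holomorphic_map_on_def
  proof
    fix y assume y: "y \<in> \<phi> ` V"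
    then obtain A where A: "(inv_into U \<phi> has_derivative (\<lambda>v. A *v v)) (at y)"
      using hi assms(2) unfolding holomorphic_map_on_def by blast
    have "inv_into U \<phi> x = inv_into V \<phi> x" if "x \<in> \<phi> ` V" for x
      using that inj injV assms(2) by (auto simp: inv_into_f_f subset_iff)
    then show "\<exists>A. (inv_into V \<phi> has_derivative (\<lambda>v. A *v v)) (at y)"
      using has_derivative_transform_within_open[OF A opV y] by blast
  qed
  moreover have "holomorphic_map_on V \<phi>" using h assms(2) by (auto simp: holomorphic_map_on_def)
  ultimately show ?thesis using injV opV by (simp add: biholomorphic_on_def)
qed

text \<open>The new chart uses \<open>g\<close> as the coordinate along \<open>e\<close>. Points of
  one line in direction \<open>e\<close> with equal values of \<open>g\<close> have equal images, so
  injectivity gives the final clause: in \<open>U\<close>, such a line contains at most one zero of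
  \<open>g\<close>.\<close>

lemma biholomorphic_straightening:
  fixes g :: "complex^'n \<Rightarrow> complex"
  assumes \<Omega>: "open \<Omega>" and g: "hol \<Omega> g" and q: "q \<in> \<Omega>" "g q = 0" and nz: "Dv g e q \<noteq> 0"
  obtains U \<phi> and L :: "(complex^'n) set" where "open U" "q \<in> U" "U \<subseteq> \<Omega>" "biholomorphic_on U \<phi>" "vec.subspace L"
    "vec.dim L = CARD('n) - 1" "\<phi> q = 0" "\<forall>Y\<in>U. \<phi> Y \<in> L \<longleftrightarrow> g Y = 0"
    "\<forall>Y\<in>U. \<forall>c. Y + c *s e \<in> U \<longrightarrow> g Y = 0 \<longrightarrow> g (Y + c *s e) = 0 \<longrightarrow> c *s e = 0"
proof -
  have "e \<noteq> 0"
  proof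
    assume "e = 0"
    then have "Dv g e q = 0" using hol_Dv_scale[OF g q(1), of 0 e] by simp
    then show False using nz by simp
  qed
  then obtain j where j: "e $ j \<noteq> 0" by (auto simp: vec_eq_iff)
  \<comment> \<open>The component along \<open>e\<close>, read off in coordinate \<open>j\<close>,
    is replaced by \<open>g Y\<close>; the \<open>j\<close>-th coordinate of the image is therefore
    \<open>g Y * e $ j\<close>.\<close>
  define \<phi> where "\<phi> Y = (Y - q) + (g Y - (Y - q) $ j / e $ j) *s e" for Y
  define d where "d Y h = h + (Dv g h Y - h $ j / e $ j) *s e" for Y h
  have \<phi>': "(\<phi> has_derivative d Y) (at Y)" if "Y \<in> \<Omega>" for Y
  proof -
    have "((\<lambda>Y. g Y - (Y - q) $ j / e $ j) has_derivative (\<lambda>h. Dv g h Y - h $ j / e $ j)) (at Y)"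
      using hol_has_derivative[OF g that] j
      by (auto intro!: derivative_eq_intros bounded_linear_imp_has_derivative[OF bounded_linear_vec_nth])
    from bounded_linear.has_derivative[OF bounded_linear_vector_scale this]
    have "((\<lambda>Y. (g Y - (Y - q) $ j / e $ j) *s e) has_derivative (\<lambda>h. (Dv g h Y - h $ j / e $ j) *s e)) (at Y)" .
    moreover have "((\<lambda>Y. Y - q) has_derivative (\<lambda>h. h)) (at Y)"
      by (auto intro!: derivative_eq_intros)
    ultimately show ?thesis unfolding \<phi>_def d_def by (intro has_derivative_add)
  qed
  have d_scale: "d Y (c *s h) = c *s d Y h" if "Y \<in> \<Omega>" for Y c h
    by (simp add: d_def hol_Dv_scale[OF g that] vector_add_ldistrib algebra_simps vector_smult_assoc)
  have bl: "bounded_linear (d Y)" if "Y \<in> \<Omega>" for Y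
    using \<phi>'[OF that] has_derivative_bounded_linear by blast
  define f' where "f' Y = Blinfun (d Y)" for Y
  have f': "blinfun_apply (f' Y) = d Y" if "Y \<in> \<Omega>" for Y
    using bl[OF that] by (simp add: f'_def bounded_linear_Blinfun_apply)
  have contf': "continuous_on \<Omega> f'"
  proof (rule continuous_on_blinfun_componentwise)
    fix b :: "complex^'n"
    have "continuous_on \<Omega> (\<lambda>Y. d Y b)"
      unfolding d_def
      by (intro continuous_intros bounded_linear.continuous_on[OF bounded_linear_vector_scale]
          hol_continuous_on[OF hol_Dv[OF \<Omega> g]])
    then show "continuous_on \<Omega> (\<lambda>Y. blinfun_apply (f' Y) b)"
      by (rule continuous_on_eq) (simp add: f')
  qed
  have inj_d: "h = 0" if "d q h = 0" for h
  proof -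
    define c where "c = h $ j / e $ j - Dv g h q"
    have "h + (- c) *s e = 0" using that unfolding d_def c_def by simp
    then have h: "h = c *s e" by (simp add: vec_eq_iff)
    have e1: "Dv g h q = c * Dv g e q" by (subst h) (rule hol_Dv_scale[OF g q(1)])
    have e2: "h $ j / e $ j = c" using j by (subst h) simp
    have "c = c - c * Dv g e q" using c_def[unfolded e1 e2] .
    then have "c * Dv g e q = 0" by simp
    then have "c = 0" using nz by simp
    then show "h = 0" using h by simp
  qed
  have lind: "linear (d q)" using bl[OF q(1)] bounded_linear.linear by blast
  have "inj (d q)"
    using inj_d linear_injective_0[OF lind] by blast
  then obtain d' where d': "linear d'" "d' \<circ> d q = id"
    using linear_injective_left_inverse[OF lind] by blast
  have "bounded_linear d'" using d'(1) by (simp add: linear_conv_bounded_linear)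
  then have inv: "Blinfun d' o\<^sub>L f' q = id_blinfun"
    using d'(2) by (intro blinfun_eqI) (simp add: bounded_linear_Blinfun_apply f' q(1) o_def fun_eq_iff)
  obtain U V \<psi> \<psi>' where U: "open U" "U \<subseteq> \<Omega>" "q \<in> U" "open V" "homeomorphism U V \<phi> \<psi>"
    "\<And>y. y \<in> V \<Longrightarrow> (\<psi> has_derivative (\<psi>' y)) (at y)"
    "\<And>y. y \<in> V \<Longrightarrow> \<psi>' y = inv (blinfun_apply (f' (\<psi> y)))"
    "\<And>y. y \<in> V \<Longrightarrow> bij (blinfun_apply (f' (\<psi> y)))"
    using inverse_function_theorem[OF \<Omega> _ contf' q(1) inv, of \<phi>] \<phi>' f' by metis
  have inj: "inj_on \<phi> U" and img: "\<phi> ` U = V" and \<psi>: "\<And>x. x \<in> U \<Longrightarrow> \<psi> (\<phi> x) = x"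
    using U(5) by (auto simp: homeomorphism_def intro: inj_on_inverseI)
  have inv\<psi>: "inv_into U \<phi> y = \<psi> y" if "y \<in> V" for y
    using that img \<psi> inj by (auto simp: inv_into_f_f)
  have bihol: "biholomorphic_on U \<phi>"
    unfolding biholomorphic_on_def
  proof (intro conjI)
    show "open (\<phi> ` U)" using img U by simp
    show "holomorphic_map_on U \<phi>"
      using \<phi>' d_scale U(2) by (intro holomorphic_map_onI) blast
    show "holomorphic_map_on (\<phi> ` U) (inv_into U \<phi>)"
      unfolding img
    proof (rule holomorphic_map_onI)
      fix y assume y: "y \<in> V"
      have \<psi>\<Omega>: "\<psi> y \<in> \<Omega>" using y img \<psi> U(2) by auto
      have "(inv_into U \<phi> has_derivative (\<psi>' y)) (at y)"
        using has_derivative_transform_within_open[OF U(6)[OF y] U(4) y] inv\<psi> by simp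
      moreover have "\<psi>' y (c *s v) = c *s \<psi>' y v" for c v
      proof -
        have b: "bij (d (\<psi> y))" and e: "\<psi>' y = inv (d (\<psi> y))"
          using U(7,8)[OF y] f'[OF \<psi>\<Omega>] by auto
        have "d (\<psi> y) (c *s \<psi>' y v) = c *s v"
          using d_scale[OF \<psi>\<Omega>] b e by (simp add: bij_is_surj surj_f_inv_f)
        then show ?thesis using b e by (metis bij_inv_eq_iff)
      qed
      ultimately show "\<exists>D. (inv_into U \<phi> has_derivative D) (at y) \<and> (\<forall>c v. D (c *s v) = c *s D v)"
        by blast
    qed
  qed (rule inj)
  define L where "L = {x :: complex^'n. \<forall>i. i \<notin> UNIV - {j} \<longrightarrow> x $ i = 0}"
  have Lj: "x \<in> L \<longleftrightarrow> x $ j = 0" for x by (auto simp: L_def)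
  have "vec.subspace L" by (auto simp: vec.subspace_def Lj)
  moreover have "vec.dim L = CARD('n) - 1"
    unfolding L_def dim_substandard_cart by (simp add: card_Diff_singleton)
  moreover have "\<phi> q = 0" by (simp add: \<phi>_def q)
  moreover have "\<phi> Y \<in> L \<longleftrightarrow> g Y = 0" for Y
  proof -
    have "\<phi> Y $ j = (Y - q) $ j + (g Y * e $ j - (Y - q) $ j / e $ j * e $ j)"
      unfolding \<phi>_def by (simp only: vector_add_component vector_smult_component left_diff_distrib)
    then have "\<phi> Y $ j = g Y * e $ j" using j by simp
    then show ?thesis using j by (simp add: Lj)
  qed
  moreover have "c *s e = 0"
    if "Y \<in> U" "Y + c *s e \<in> U" "g Y = 0" "g (Y + c *s e) = 0" for Y c
  proof -
    have "\<phi> (Y + c *s e) = \<phi> Y"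
      using that j by (simp add: \<phi>_def vec_eq_iff field_simps)
    then have "Y + c *s e = Y" using inj that by (meson inj_onD)
    then show ?thesis by simp
  qed
  ultimately show thesis using that[of U \<phi> L] U bihol by blast
qed

text \<open>A tube lemma: a compact piece of a fibre inside an open set has a uniform distance from
  the complement, so nearby fibres stay inside too.\<close>

lemma fibre_tube:
  fixes Z0 e :: "complex^'n"
  assumes "compact C" "open S" "\<And>t. t \<in> C \<Longrightarrow> Z0 + t *s e \<in> S"
  obtains \<delta> where "\<delta> > 0" "\<forall>Z t. dist Z0 Z < \<delta> \<longrightarrow> t \<in> C \<longrightarrow> Z + t *s e \<in> S"
proof -
  have "compact ((\<lambda>t. Z0 + t *s e) ` C)"
    using assms(1) by (intro compact_continuous_image continuous_intros
        bounded_linear.continuous_on[OF bounded_linear_vector_scale])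
  then obtain \<delta> where \<delta>: "\<delta> > 0" "(\<Union>x\<in>(\<lambda>t. Z0 + t *s e) ` C. ball x \<delta>) \<subseteq> S"
    using compact_subset_open_imp_ball_epsilon_subset[OF _ assms(2)] assms(3) by blast
  show thesis
  proof (rule that[OF \<delta>(1)], intro allI impI)
    fix Z t assume "dist Z0 Z < \<delta>" "t \<in> C"
    then have "Z + t *s e \<in> ball (Z0 + t *s e) \<delta>" by (simp add: dist_norm)
    then show "Z + t *s e \<in> S" using \<delta>(2) \<open>t \<in> C\<close> by blast
  qed
qed

text \<open>A finite form of Baire's theorem: either the first set contains \<open>B\<close>, or
  what it misses is a nonempty open set covered by the remaining ones.\<close>

lemma finite_closed_cover_open:
  assumes "finite J" "open B" "B \<noteq> {}" "B \<subseteq> (\<Union>j\<in>J. E j)" "\<And>j. j \<in> J \<Longrightarrow> open (B - E j)"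
  shows "\<exists>j\<in>J. \<exists>B'. open B' \<and> B' \<noteq> {} \<and> B' \<subseteq> B \<inter> E j"
  using assms
proof (induction J arbitrary: B rule: finite_induct)
  case (insert j J)
  show ?case
  proof (cases "B - E j = {}")
    case True
    then show ?thesis using insert.prems by (intro bexI[of _ j] exI[of _ B]) auto
  next
    case False
    have "open (B - E j - E i)" if "i \<in> J" for i
    proof -
      have "B - E j - E i = (B - E j) \<inter> (B - E i)" by blast
      then show ?thesis using insert.prems(4)[of j] insert.prems(4)[of i] that by (simp add: open_Int)
    qed
    then have "\<exists>i\<in>J. \<exists>B'. open B' \<and> B' \<noteq> {} \<and> B' \<subseteq> (B - E j) \<inter> E i"
      using False insert.prems by (intro insert.IH) auto
    then show ?thesis by blast
  qed
qed auto

text \<open>The order of a zero is read off from derivatives because these are, by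
  \<open>higher_deriv_line\<close>, restrictions of functions holomorphic in all variables.\<close>

lemma holomorphic_order_derivs:
  assumes f: "f holomorphic_on S" "open S" "connected S" "t \<in> S" and nz: "\<exists>w\<in>S. f w \<noteq> 0"
  shows "\<forall>j<nat (zorder f t). (deriv ^^ j) f t = 0" "(deriv ^^ nat (zorder f t)) f t \<noteq> 0"
proof -
  have "\<exists>j. (deriv ^^ j) f t \<noteq> 0"
    using holomorphic_fun_eq_0_on_connected[OF f(1-3)] f(4) nz by blast
  define j where "j = (LEAST j. (deriv ^^ j) f t \<noteq> 0)"
  have j: "(deriv ^^ j) f t \<noteq> 0" "\<And>i. i < j \<Longrightarrow> (deriv ^^ i) f t = 0"
    unfolding j_def using LeastI_ex[OF \<open>\<exists>j. _\<close>] not_less_Least by blast+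
  have "f analytic_on {t}" using f analytic_at by blast
  then have "zorder f t = int j"
    using j by (intro zorder_zero_eqI') auto
  then show "\<forall>j<nat (zorder f t). (deriv ^^ j) f t = 0" "(deriv ^^ nat (zorder f t)) f t \<noteq> 0"
    using j by auto
qed

lemma hol_funpow_Dv:
  assumes "open S" "hol S f"
  shows "hol S (((\<lambda>h. Dv h e) ^^ j) f)"
  by (induction j) (auto intro: assms hol_Dv)

lemma higher_deriv_line:
  assumes S: "open S" and f: "hol S f" and "Z + t *s e \<in> S"
  shows "(deriv ^^ j) (\<lambda>t. f (Z + t *s e)) t = ((\<lambda>h. Dv h e) ^^ j) f (Z + t *s e)"
  using assms(3)
proof (induction j arbitrary: t)
  case (Suc j)
  have op: "open ((\<lambda>t. Z + t *s e) -` S)"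
    by (intro continuous_on_open_vimage[THEN iffD1, rule_format, OF open_UNIV, simplified] S continuous_intros
        bounded_linear.continuous_on[OF bounded_linear_vector_scale]) 
  have "(deriv ^^ Suc j) (\<lambda>t. f (Z + t *s e)) t = deriv ((deriv ^^ j) (\<lambda>t. f (Z + t *s e))) t" by simp
  also have "\<dots> = deriv (\<lambda>t. ((\<lambda>h. Dv h e) ^^ j) f (Z + t *s e)) t"
  proof (rule deriv_cong_ev)
    show "\<forall>\<^sub>F u in nhds t. (deriv ^^ j) (\<lambda>t. f (Z + t *s e)) u = ((\<lambda>h. Dv h e) ^^ j) f (Z + u *s e)"
      using eventually_nhds_in_open[OF op, of t] Suc.prems
      by (auto elim!: eventually_mono intro: Suc.IH)
  qed simp
  also have "\<dots> = Dv (((\<lambda>h. Dv h e) ^^ j) f) e (Z + t *s e)"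
    by (rule DERIV_imp_deriv[OF hol_line[OF hol_funpow_Dv[OF S f] Suc.prems]])
  finally show ?case by simp
qed simp

lemma finite_positive_lower_bound:
  assumes "finite S" "\<And>s. s \<in> S \<Longrightarrow> (s :: real) > 0"
  obtains \<zeta> where "\<zeta> > 0" "\<And>s. s \<in> S \<Longrightarrow> \<zeta> < s"
proof -
  define \<zeta> where "\<zeta> = Min (insert 1 S) / 2"
  have "Min (insert 1 S) > 0" using assms by (subst Min_gr_iff) auto
  moreover have "Min (insert 1 S) \<le> s" if "s \<in> S" for s using assms(1) that by simp
  ultimately show thesis using that[of \<zeta>] unfolding \<zeta>_def by fastforce
qed

context fibre_zeros
begin

lemma order_derivs:
  assumes "Z \<in> B" "t \<in> zeros Z"
  shows "\<forall>j<mult Z t. ((\<lambda>h. Dv h e) ^^ j) f (Z + t *s e) = 0"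
    "((\<lambda>h. Dv h e) ^^ mult Z t) f (Z + t *s e) \<noteq> 0"
proof -
  have t: "t \<in> ball 0 R" "cmod t < \<eta>" using assms(2) \<eta> by (auto simp: zeros_def)
  have in\<Omega>: "Z + t *s e \<in> \<Omega>" using fibre assms(1) t by simp
  have nz: "\<exists>w\<in>ball 0 R. f (Z + w *s e) \<noteq> 0"
    using argument_principle_disc(2)[OF \<eta> holomorphic_fibre[OF hol_f assms(1)]
        holomorphic_fibre[OF hol_f assms(1)] boundary[OF assms(1)] t(2)] by simp
  note * = holomorphic_order_derivs[OF holomorphic_fibre[OF hol_f assms(1)] open_ball
      convex_connected[OF convex_ball] t(1) nz, folded mult_def,
      unfolded higher_deriv_line[OF open_\<Omega> hol_f in\<Omega>]]
  show "\<forall>j<mult Z t. ((\<lambda>h. Dv h e) ^^ j) f (Z + t *s e) = 0"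
    "((\<lambda>h. Dv h e) ^^ mult Z t) f (Z + t *s e) \<noteq> 0"
    using * by auto
qed

text \<open>If every fibre has a single zero, of some fixed order \<open>k\<close>, then \<open>X\<close> is locally the zero set of
  \<open>\<partial>\<^sub>e\<^sup>k\<^sup>-\<^sup>1 f\<close>, which has a simple zero.\<close>

lemma regular_point_of_single_zeros:
  assumes X: "X \<subseteq> {z \<in> \<Omega>. f z = 0}" and k: "\<And>Z. Z \<in> B \<Longrightarrow> count Z = k"
    and single: "\<And>Z t t'. Z \<in> B \<Longrightarrow> t \<in> zeros Z \<Longrightarrow> t' \<in> zeros Z \<Longrightarrow> t = t'"
    and meets: "\<And>Z. Z \<in> B \<Longrightarrow> \<exists>t. cmod t < \<eta> \<and> Z + t *s e \<in> X"
    and "B \<noteq> {}"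
  shows "\<exists>Z\<in>B. \<exists>t. cmod t < \<eta> \<and> regular_point X (Z + t *s e) (CARD('n) - 1)"
proof -
  have zeros: "\<exists>t. zeros Z = {t} \<and> Z + t *s e \<in> X \<and> mult Z t = k \<and> cmod t < \<eta>" if Z: "Z \<in> B" for Z
  proof -
    obtain t where t: "cmod t < \<eta>" "Z + t *s e \<in> X" using meets[OF Z] by blast
    then have "t \<in> zeros Z" using X by (auto simp: zeros_def)
    then have "zeros Z = {t}" using single[OF Z] by blast
    moreover from this have "mult Z t = k" using k[OF Z] by (simp add: count_def)
    ultimately show ?thesis using t by blast
  qed
  obtain Z0 where Z0: "Z0 \<in> B" using \<open>B \<noteq> {}\<close> by blast
  obtain t0 where t0: "zeros Z0 = {t0}" "Z0 + t0 *s e \<in> X" "mult Z0 t0 = k" "cmod t0 < \<eta>"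
    using zeros[OF Z0] by blast
  have kpos: "k > 0" using mult_pos[OF Z0, of t0] t0 by simp
  define q where "q = Z0 + t0 *s e"
  define g where "g = ((\<lambda>h. Dv h e) ^^ (k - 1)) f"
  have g: "hol \<Omega> g" unfolding g_def by (rule hol_funpow_Dv[OF open_\<Omega> hol_f])
  have gz: "g (Z + t *s e) = 0" if "Z \<in> B" "t \<in> zeros Z" for Z t
  proof -
    have "mult Z t = k" using zeros[OF that(1)] that(2) by auto
    then show ?thesis using order_derivs(1)[OF that] kpos by (simp add: g_def)
  qed
  have "Dv g e q = ((\<lambda>h. Dv h e) ^^ Suc (k - 1)) f q" by (simp add: g_def)
  also have "\<dots> \<noteq> 0" using order_derivs(2)[OF Z0, of t0] t0 kpos by (simp add: q_def)
  finally have Dg: "Dv g e q \<noteq> 0" .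
  have q: "q \<in> \<Omega>" "g q = 0" using t0 X gz[OF Z0, of t0] by (auto simp: q_def)
  have e: "e \<noteq> 0"
  proof
    assume "e = 0"
    then show False using hol_Dv_scale[OF g q(1), of 0 e] Dg by simp
  qed
  obtain U \<phi> and L :: "(complex^'n) set" where U: "open U" "q \<in> U" "U \<subseteq> \<Omega>" "biholomorphic_on U \<phi>"
    "vec.subspace L" "vec.dim L = CARD('n) - 1" "\<phi> q = 0" "\<forall>Y\<in>U. \<phi> Y \<in> L \<longleftrightarrow> g Y = 0"
    "\<forall>Y\<in>U. \<forall>c. Y + c *s e \<in> U \<longrightarrow> g Y = 0 \<longrightarrow> g (Y + c *s e) = 0 \<longrightarrow> c *s e = 0"
    by (rule biholomorphic_straightening[OF open_\<Omega> g q Dg])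
  obtain \<epsilon> where \<epsilon>: "\<epsilon> > 0" "ball q \<epsilon> \<subseteq> U" using U open_contains_ball by blast
  define \<zeta> where "\<zeta> = \<epsilon> / (2 * norm e)"
  have \<zeta>: "\<zeta> > 0" "\<zeta> * norm e = \<epsilon> / 2" unfolding \<zeta>_def using \<epsilon> e by auto
  let ?C = "cball 0 \<eta> - ball t0 \<zeta>"
  have "compact ?C" by (intro compact_diff compact_cball open_ball)
  moreover have "open {z \<in> \<Omega>. f z \<noteq> 0}"
  proof -
    have "open (\<Omega> \<inter> f -` (- {0}))"
      by (intro continuous_open_preimage[OF hol_continuous_on[OF hol_f] open_\<Omega>]) auto
    moreover have "{z \<in> \<Omega>. f z \<noteq> 0} = \<Omega> \<inter> f -` (- {0})" by auto
    ultimately show ?thesis by simp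
  qed
  moreover have "Z0 + t *s e \<in> {z \<in> \<Omega>. f z \<noteq> 0}" if "t \<in> ?C" for t
  proof -
    have "t \<noteq> t0" "cmod t \<le> \<eta>" using that \<zeta>(1) by auto
    moreover have "f (Z0 + t *s e) \<noteq> 0"
      using t0(1) \<open>t \<noteq> t0\<close> \<open>cmod t \<le> \<eta>\<close> boundary[OF Z0, of t] by (force simp: zeros_def)
    ultimately show ?thesis using fibre[OF Z0, of t] \<eta> by auto
  qed
  ultimately obtain \<delta> where \<delta>: "\<delta> > 0"
    "\<forall>Z t. dist Z0 Z < \<delta> \<longrightarrow> t \<in> ?C \<longrightarrow> Z + t *s e \<in> {z \<in> \<Omega>. f z \<noteq> 0}"
    by (rule fibre_tube)
  obtain \<delta>' where \<delta>': "\<delta>' > 0" "ball Z0 \<delta>' \<subseteq> B" using open_B Z0 open_contains_ball by blast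
  \<comment> \<open>The radius ensures three things for \<open>Y\<close> in \<open>U'\<close>: the
    fibre through it has its base point in \<open>B\<close>, its zero differs from \<open>t0\<close>
    by less than \<open>\<zeta>\<close>, and moving from \<open>Y\<close> to that zero does not
    leave \<open>U\<close>.\<close>
  define U' where "U' = ball q (min (\<epsilon> / 2) (min \<delta> \<delta>'))"
  have U': "open U'" "q \<in> U'" "U' \<subseteq> U" using \<epsilon> \<delta> \<delta>' unfolding U'_def by auto
  have XU': "Y \<in> X \<longleftrightarrow> g Y = 0" if Y: "Y \<in> U'" for Y
  proof -
    define Z where "Z = Y - t0 *s e"
    have YZ: "Y = Z + t0 *s e" by (simp add: Z_def)
    have "dist Z0 Z = dist q Y" by (simp add: Z_def q_def dist_norm algebra_simps)
    then have Z: "Z \<in> B" "dist Z0 Z < \<delta>" using Y \<delta>' by (auto simp: U'_def)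
    obtain t1 where t1: "zeros Z = {t1}" "Z + t1 *s e \<in> X" "cmod t1 < \<eta>" using zeros[OF Z(1)] by blast
    have "t1 \<notin> ?C" using \<delta>(2)[rule_format, OF Z(2), of t1] t1 by (auto simp: zeros_def)
    then have t1\<zeta>: "cmod (t1 - t0) < \<zeta>" using t1(3) by (auto simp: dist_norm norm_minus_commute)
    show ?thesis
    proof
      assume "Y \<in> X"
      then have "t0 \<in> zeros Z" using X t0(4) YZ by (auto simp: zeros_def)
      then show "g Y = 0" using gz[OF Z(1)] YZ by simp
    next
      \<comment> \<open>\<open>Y\<close> and the zero of \<open>f\<close> on its fibre are two zeros
        of \<open>g\<close> on one line inside \<open>U\<close>, so they coincide by the final
        property of \<open>U\<close>.\<close>
      assume gY: "g Y = 0"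
      have Y1: "Z + t1 *s e = Y + (t1 - t0) *s e" by (simp add: Z_def vector_sub_rdistrib)
      have "norm ((t1 - t0) *s e) \<le> \<epsilon> / 2"
        unfolding vector_scale_norm \<zeta>(2)[symmetric] using t1\<zeta> by (intro mult_right_mono) auto
      moreover have "dist q Y < \<epsilon> / 2" using Y by (simp add: U'_def)
      moreover have "dist q (Y + (t1 - t0) *s e) \<le> dist q Y + norm ((t1 - t0) *s e)"
        by (metis dist_norm dist_triangle add_diff_cancel_left' dist_commute)
      ultimately have "dist q (Y + (t1 - t0) *s e) < \<epsilon>" by linarith
      then have inU: "Y + (t1 - t0) *s e \<in> U" using \<epsilon>(2) by auto
      have "g (Y + (t1 - t0) *s e) = 0" using gz[OF Z(1), of t1] t1(1) Y1 by simp
      then have "(t1 - t0) *s e = 0" using U(9)[rule_format, of Y "t1 - t0"] inU gY Y U'(3) by blast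
      then have "Z + t1 *s e = Y" using Y1 by (simp only: add_0_right)
      then show "Y \<in> X" using t1(2) by simp
    qed
  qed
  have "regular_point X q (CARD('n) - 1)"
    unfolding regular_point_def
  proof (intro conjI exI)
    show "q \<in> X" using t0 q_def by simp
    show "biholomorphic_on U' \<phi>" by (rule biholomorphic_on_subset[OF U(4) U'(3,1)])
    show "\<phi> ` (X \<inter> U') = \<phi> ` U' \<inter> L" using XU' U(8) U'(3) by blast
  qed (use U' U in auto)
  then show ?thesis using Z0 t0(4) q_def by blast
qed

end

text \<open>If some fibre has several zeros, they are separated by small discs. The parts of the base over
  which \<open>X\<close> meets a given disc are closed and cover the base, so one of them has interior points;
  there the disc contains fewer zeros.\<close>

lemma regular_point_of_fibres:
  fixes f :: "complex^'n \<Rightarrow> complex"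
  assumes "fibre_zeros \<Omega> B f e \<eta> R" and X: "X \<subseteq> {z \<in> \<Omega>. f z = 0}" "open (\<Omega> - X)"
    and "connected B" "B \<noteq> {}" and "\<And>Z. Z \<in> B \<Longrightarrow> \<exists>t. cmod t < \<eta> \<and> Z + t *s e \<in> X"
  shows "\<exists>Z\<in>B. \<exists>t. cmod t < \<eta> \<and> regular_point X (Z + t *s e) (CARD('n) - 1)"
proof -
  \<comment> \<open>The induction carries a constant number of zeros instead of connectedness, since
    the open part of the base on which one disc is met need not be connected.\<close>
  have "\<exists>Z\<in>B. \<exists>t. cmod t < \<eta> \<and> regular_point X (Z + t *s e) (CARD('n) - 1)"
    if "fibre_zeros \<Omega> B f e \<eta> R" "B \<noteq> {}" "\<And>Z. Z \<in> B \<Longrightarrow> fibre_zeros.count f e \<eta> Z = k"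
      "\<And>Z. Z \<in> B \<Longrightarrow> \<exists>t. cmod t < \<eta> \<and> Z + t *s e \<in> X" for k B \<eta> R
    using that
  proof (induction k arbitrary: B \<eta> R rule: less_induct)
    case (less k)
    interpret fibre_zeros \<Omega> B f e \<eta> R by (rule less.prems(1))
    show ?case
    proof (cases "\<forall>Z\<in>B. \<forall>t\<in>zeros Z. \<forall>t'\<in>zeros Z. t = t'")
      case True
      then show ?thesis
        using less.prems by (intro regular_point_of_single_zeros[OF X(1), of k]) auto
    next
      case False
      then obtain Z1 s1 s2 where Z1: "Z1 \<in> B" "s1 \<in> zeros Z1" "s2 \<in> zeros Z1" "s1 \<noteq> s2" by blast
      define T where "T = zeros Z1"
      have T: "finite T" unfolding T_def by (rule finite_zeros[OF Z1(1)])
      have T\<eta>: "cmod t < \<eta>" if "t \<in> T" for t using that by (simp add: T_def zeros_def)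
      \<comment> \<open>A \<zeta> below these numbers makes the closed discs of radius \<zeta> about
        the zeros over \<open>Z1\<close> pairwise disjoint and keeps them inside the disc of radius
        \<eta>.\<close>
      have "finite ((\<lambda>t. \<eta> - cmod t) ` T \<union> (\<lambda>(t, t'). dist t t' / 2) ` {(t, t') \<in> T \<times> T. t \<noteq> t'})"
        using T by (intro finite_UnI finite_imageI) (auto intro: finite_subset[of _ "T \<times> T"])
      then obtain \<zeta> where \<zeta>: "\<zeta> > 0"
        "\<And>s. s \<in> (\<lambda>t. \<eta> - cmod t) ` T \<union> (\<lambda>(t, t'). dist t t' / 2) ` {(t, t') \<in> T \<times> T. t \<noteq> t'} \<Longrightarrow> \<zeta> < s"
        by (rule finite_positive_lower_bound) (use T\<eta> in auto)
      have \<zeta>1: "cmod t + \<zeta> < \<eta>" if "t \<in> T" for t using \<zeta>(2)[of "\<eta> - cmod t"] that by auto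
      have \<zeta>2: "2 * \<zeta> < dist t t'" if "t \<in> T" "t' \<in> T" "t \<noteq> t'" for t t'
      proof -
        have "dist t t' / 2 \<in> (\<lambda>(t, t'). dist t t' / 2) ` {(t, t') \<in> T \<times> T. t \<noteq> t'}"
          by (rule image_eqI[of _ _ "(t, t')"]) (use that in auto)
        then show ?thesis using \<zeta>(2)[of "dist t t' / 2"] by simp
      qed
      define C where "C = cball 0 \<eta> - (\<Union>t\<in>T. ball t \<zeta>)"
      have C: "compact C" unfolding C_def by (intro compact_diff compact_cball open_UN) auto
      have opf: "open {z \<in> \<Omega>. f z \<noteq> 0}"
      proof -
        have "open (\<Omega> \<inter> f -` (- {0}))"
          by (intro continuous_open_preimage[OF hol_continuous_on[OF hol_f] open_\<Omega>]) auto
        moreover have "{z \<in> \<Omega>. f z \<noteq> 0} = \<Omega> \<inter> f -` (- {0})" by auto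
        ultimately show ?thesis by simp
      qed
      have "Z1 + t *s e \<in> {z \<in> \<Omega>. f z \<noteq> 0}" if "t \<in> C" for t
      proof -
        have t: "cmod t \<le> \<eta>" "t \<notin> T" using that \<zeta>(1) by (auto simp: C_def)
        have "f (Z1 + t *s e) \<noteq> 0"
          using t boundary[OF Z1(1), of t] by (cases "cmod t = \<eta>") (auto simp: T_def zeros_def)
        then show ?thesis using fibre[OF Z1(1), of t] t \<eta> by auto
      qed
      then obtain \<delta>1 where \<delta>1: "\<delta>1 > 0"
        "\<forall>Z t. dist Z1 Z < \<delta>1 \<longrightarrow> t \<in> C \<longrightarrow> Z + t *s e \<in> {z \<in> \<Omega>. f z \<noteq> 0}"
        by (rule fibre_tube[OF C opf])
      obtain \<delta>2 where \<delta>2: "\<delta>2 > 0" "ball Z1 \<delta>2 \<subseteq> B" using open_B Z1(1) open_contains_ball by blast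
      define B1 where "B1 = ball Z1 (min \<delta>1 \<delta>2)"
      have B1: "open B1" "Z1 \<in> B1" "B1 \<subseteq> B" "\<And>Z t. Z \<in> B1 \<Longrightarrow> t \<in> C \<Longrightarrow> f (Z + t *s e) \<noteq> 0"
        using \<delta>1 \<delta>2 by (auto simp: B1_def)
      have sphere_C: "t + s \<in> C" if t: "t \<in> T" and s: "cmod s = \<zeta>" for t s
      proof -
        have "cmod (t + s) \<le> \<eta>" using norm_triangle_ineq[of t s] \<zeta>1[OF t] s by simp
        moreover have "t + s \<notin> ball t' \<zeta>" if t': "t' \<in> T" for t'
        proof (cases "t' = t")
          case True
          then show ?thesis using s by (simp add: dist_norm)
        next
          case False
          have "dist t t' \<le> dist t (t + s) + dist (t + s) t'" by (rule dist_triangle)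
          then have "\<zeta> < dist (t + s) t'" using \<zeta>2[OF t t'] False s by (simp add: dist_norm)
          then show ?thesis by (simp add: dist_commute)
        qed
        ultimately show ?thesis by (simp add: C_def)
      qed
      define E where "E t = {Z. \<exists>s. cmod s < \<zeta> \<and> Z + (t + s) *s e \<in> X}" for t
      have "B1 \<subseteq> (\<Union>t\<in>T. E t)"
      proof
        fix Z assume Z: "Z \<in> B1"
        then obtain s where s: "cmod s < \<eta>" "Z + s *s e \<in> X" using less.prems(4) B1(3) by blast
        then have "f (Z + s *s e) = 0" using X by auto
        then have "s \<notin> C" using B1(4)[OF Z] by blast
        then obtain t where t: "t \<in> T" "s \<in> ball t \<zeta>" using s(1) by (auto simp: C_def)
        then have "Z \<in> E t"
          unfolding E_def using s(2) by (intro CollectI exI[of _ "s - t"]) (auto simp: dist_norm norm_minus_commute)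
        then show "Z \<in> (\<Union>t\<in>T. E t)" using t(1) by blast
      qed
      moreover have "open (B1 - E t)" if t: "t \<in> T" for t
        unfolding open_contains_ball
      proof
        fix Z assume Z: "Z \<in> B1 - E t"
        \<comment> \<open>The closed disc over \<open>Z\<close> avoids \<open>X\<close>: on its
          boundary \<open>f\<close> has no zeros, in its interior this is
          \<open>Z \<notin> E t\<close>. By compactness nearby fibres avoid \<open>X\<close> over it
          as well.\<close>
        have "Z + s *s e \<in> \<Omega> - X" if s: "s \<in> cball t \<zeta>" for s
        proof -
          have sn: "cmod (s - t) \<le> \<zeta>" using s by (simp add: dist_norm norm_minus_commute)
          then have "cmod s < \<eta>" using \<zeta>1[OF t] norm_triangle_sub[of s t] by linarith
          then have "Z + s *s e \<in> \<Omega>" using fibre Z B1(3) \<eta> by (meson DiffD1 less_trans subsetD)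
          moreover have "Z + s *s e \<notin> X"
          proof (cases "cmod (s - t) = \<zeta>")
            case True
            then have "f (Z + s *s e) \<noteq> 0" using B1(4)[of Z "t + (s - t)"] Z sphere_C[OF t True] by simp
            then show ?thesis using X by auto
          next
            case False
            then have "cmod (s - t) < \<zeta>" using sn by simp
            then have "Z + (t + (s - t)) *s e \<notin> X" using Z unfolding E_def by blast
            then show ?thesis by simp
          qed
          ultimately show ?thesis by blast
        qed
        then obtain \<delta> where \<delta>: "\<delta> > 0" "\<forall>Y s. dist Z Y < \<delta> \<longrightarrow> s \<in> cball t \<zeta> \<longrightarrow> Y + s *s e \<in> \<Omega> - X"
          by (rule fibre_tube[OF compact_cball X(2)])
        obtain \<delta>' where \<delta>': "\<delta>' > 0" "ball Z \<delta>' \<subseteq> B1" using B1(1) Z open_contains_ball by blast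
        have "Y \<notin> E t" if "dist Z Y < \<delta>" for Y
        proof
          assume "Y \<in> E t"
          then obtain s where s: "cmod s < \<zeta>" "Y + (t + s) *s e \<in> X" unfolding E_def by blast
          then have "t + s \<in> cball t \<zeta>" by (simp add: dist_norm)
          then show False using \<delta>(2) that s(2) by blast
        qed
        then have "ball Z (min \<delta> \<delta>') \<subseteq> B1 - E t" using \<delta>'(2) by auto
        then show "\<exists>e>0. ball Z e \<subseteq> B1 - E t" using \<delta>(1) \<delta>'(1) by (intro exI[of _ "min \<delta> \<delta>'"]) auto
      qed
      ultimately obtain t B2 where t: "t \<in> T" and B2: "open B2" "B2 \<noteq> {}" "B2 \<subseteq> B1 \<inter> E t"
        using finite_closed_cover_open[OF T B1(1), of E] B1(2) by blast
      \<comment> \<open>The disc about \<open>t\<close> becomes a disc about 0 when the base is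
        translated by \<open>t *s e\<close>.\<close>
      let ?sh = "\<lambda>S. (\<lambda>Z. Z + t *s e) ` S"
      have shift: "fibre_zeros \<Omega> (?sh S) f e \<zeta> (R - cmod t)" if "open S" "S \<subseteq> B1" for S
      proof
        show "open (?sh S)" using that open_translation[of S "t *s e"] by (simp add: add.commute)
        show "\<zeta> < R - cmod t" using \<zeta>1[OF t] \<eta> by simp
        fix Y s assume "Y \<in> ?sh S"
        then obtain Z where Z: "Z \<in> S" "Y = Z + t *s e" by blast
        have Y: "Y + s *s e = Z + (t + s) *s e" by (simp add: Z vector_sadd_rdistrib add.assoc)
        show "Y + s *s e \<in> \<Omega>" if "cmod s < R - cmod t"
          unfolding Y using that norm_triangle_ineq[of t s] Z \<open>S \<subseteq> B1\<close> B1(3) by (intro fibre) auto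
        show "f (Y + s *s e) \<noteq> 0" if "cmod s = \<zeta>"
          unfolding Y using that Z \<open>S \<subseteq> B1\<close> sphere_C[OF t] by (intro B1(4)) auto
      qed (use open_\<Omega> hol_f \<zeta> in auto)
      interpret B1: fibre_zeros \<Omega> "?sh B1" f e \<zeta> "R - cmod t" by (rule shift) (use B1 in auto)
      have "B1.zeros (Z1 + t *s e) = {0}"
      proof -
        have "s = 0" if s: "cmod s < \<zeta>" "f (Z1 + t *s e + s *s e) = 0" for s
        proof (rule ccontr)
          assume "s \<noteq> 0"
          have "Z1 + t *s e + s *s e = Z1 + (t + s) *s e" by (simp add: vector_sadd_rdistrib add.assoc)
          then have "f (Z1 + (t + s) *s e) = 0" using s(2) by metis
          moreover have "cmod (t + s) < \<eta>" using norm_triangle_ineq[of t s] \<zeta>1[OF t] s by linarith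
          ultimately have ts: "t + s \<in> T" by (simp only: T_def zeros_def mem_Collect_eq)
          show False using \<zeta>2[OF t ts] s(1) \<zeta>(1) \<open>s \<noteq> 0\<close> by (simp add: dist_norm)
        qed
        moreover have "f (Z1 + t *s e) = 0" using t by (simp add: T_def zeros_def)
        ultimately show ?thesis using \<zeta>(1) by (auto simp: B1.zeros_def)
      qed
      moreover have "B1.mult (Z1 + t *s e) 0 = mult Z1 t"
      proof -
        have "zorder (\<lambda>s. f (Z1 + s *s e)) t = zorder (\<lambda>u. f (Z1 + (u + t) *s e)) 0" by (rule zorder_shift)
        also have "(\<lambda>u. f (Z1 + (u + t) *s e)) = (\<lambda>u. f (Z1 + t *s e + u *s e))"
          by (simp add: vector_sadd_rdistrib algebra_simps)
        finally show ?thesis by (simp add: B1.mult_def mult_def)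
      qed
      ultimately have cnt: "B1.count (Z1 + t *s e) = mult Z1 t" by (simp add: B1.count_def)
      \<comment> \<open>The count is compared with the fibre through \<open>Z1\<close> over the ball
        \<open>B1\<close>, which is connected, and only then restricted to
        \<open>B2\<close>.\<close>
      have conn: "connected (?sh B1)"
        unfolding B1_def by (intro connected_continuous_image continuous_intros convex_connected convex_ball)
      have "k = (\<Sum>s\<in>T. mult Z1 s)" using less.prems(3)[OF Z1(1)] by (simp add: count_def T_def)
      also have "\<dots> = mult Z1 t + (\<Sum>s\<in>T - {t}. mult Z1 s)" by (rule sum.remove[OF T t])
      also have "\<dots> > mult Z1 t"
      proof -
        obtain s where s: "s \<in> T" "s \<noteq> t" using Z1 T_def by blast
        have "0 < mult Z1 s" using mult_pos[OF Z1(1)] s by (simp add: T_def)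
        also have "\<dots> \<le> (\<Sum>s\<in>T - {t}. mult Z1 s)" using T s by (intro member_le_sum) auto
        finally show ?thesis by simp
      qed
      finally have lt: "mult Z1 t < k" .
      have "\<exists>Z\<in>?sh B2. \<exists>s. cmod s < \<zeta> \<and> regular_point X (Z + s *s e) (CARD('n) - 1)"
      proof (rule less.IH[OF lt shift])
        show "fibre_zeros.count f e \<zeta> Z = mult Z1 t" if "Z \<in> ?sh B2" for Z
          using B1.count_constant[OF conn, of Z "Z1 + t *s e"] that B2(3) B1(2) cnt by auto
        show "\<exists>s. cmod s < \<zeta> \<and> Z + s *s e \<in> X" if Z: "Z \<in> ?sh B2" for Z
        proof -
          obtain Y where Y: "Y \<in> B2" "Z = Y + t *s e" using Z by blast
          then obtain s where "cmod s < \<zeta>" "Y + (t + s) *s e \<in> X" using B2(3) unfolding E_def by blast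
          then show ?thesis using Y by (auto simp: vector_sadd_rdistrib add.assoc)
        qed
      qed (use B2 in auto)
      then obtain Z s where Z: "Z \<in> B2" "cmod s < \<zeta>" "regular_point X (Z + t *s e + s *s e) (CARD('n) - 1)"
        by blast
      have "Z + t *s e + s *s e = Z + (t + s) *s e" by (simp add: vector_sadd_rdistrib add.assoc)
      moreover have "cmod (t + s) < \<eta>" using norm_triangle_ineq[of t s] \<zeta>1[OF t] Z(2) by linarith
      moreover have "Z \<in> B" using Z(1) B2(3) B1(3) by blast
      ultimately show ?thesis using Z(3) by metis
    qed
  qed
  moreover obtain Z0 where "Z0 \<in> B" using \<open>B \<noteq> {}\<close> by blast
  ultimately show ?thesis
    using assms fibre_zeros.count_constant[OF assms(1) \<open>connected B\<close> _ \<open>Z0 \<in> B\<close>] by blast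
qed

section \<open>Linear algebra of the Levi form\<close>

lemma det_nonzero_iff_kernel:
  fixes A :: "complex^'m^'m"
  shows "det A \<noteq> 0 \<longleftrightarrow> (\<forall>x. A *v x = 0 \<longrightarrow> x = 0)"
  using matrix_left_invertible_ker[of A] invertible_det_nz[of A] invertible_left_inverse[of A] by metis

text \<open>The equations are listed with a repetition as the rows of a square matrix, and equal
  rows make its determinant vanish.\<close>

lemma common_kernel_nontrivial:
  fixes \<Phi> :: "(complex^'n) set"
  assumes "finite \<Phi>" "card \<Phi> < CARD('n)"
  shows "\<exists>y\<noteq>0. \<forall>a\<in>\<Phi>. (\<Sum>j\<in>UNIV. a $ j * y $ j) = 0"
proof (cases "\<Phi> = {}")
  case True
  have "(\<chi> i. 1 :: complex^'n) \<noteq> 0" by (simp add: vec_eq_iff)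
  then show ?thesis using True by (metis empty_iff zero_neq_one vec_lambda_beta zero_index)
next
  case False
  obtain k :: "complex^'n \<Rightarrow> 'n" where k: "inj_on k \<Phi>"
    using card_le_inj[of \<Phi> "UNIV :: 'n set"] assms by auto
  define h where "h i = (if i \<in> k ` \<Phi> then inv_into \<Phi> k i else (SOME a. a \<in> \<Phi>))" for i
  have h: "range h = \<Phi>"
  proof
    show "range h \<subseteq> \<Phi>"
      using False by (auto simp: h_def inv_into_into some_in_eq)
    show "\<Phi> \<subseteq> range h"
    proof
      fix a assume "a \<in> \<Phi>"
      then have "h (k a) = a" using k by (simp add: h_def inv_into_f_f)
      then show "a \<in> range h" by (metis rangeI)
    qed
  qed
  have "\<not> inj h"
    using assms(2) card_image[of h UNIV] h by auto
  then obtain i j where ij: "i \<noteq> j" "h i = h j" by (auto simp: inj_on_def)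
  define A :: "complex^'n^'n" where "A = (\<chi> i. h i)"
  have "row i A = row j A" using ij(2) by (simp add: row_def A_def)
  then have "det A = 0" using det_identical_rows[OF ij(1)] by blast
  then obtain y where y: "y \<noteq> 0" "A *v y = 0" using det_nonzero_iff_kernel by blast
  have "(\<Sum>j\<in>UNIV. h i $ j * y $ j) = 0" for i
    using arg_cong[OF y(2), of "\<lambda>v. v $ i"] by (simp add: matrix_vector_mult_def A_def)
  then show ?thesis using y(1) h by (intro exI[of _ y]) auto
qed

text \<open>While \<open>B\<close> is singular, take \<open>c\<close> in the kernel of its transpose
  and \<open>d\<close> in its kernel, and add the matrix with entries
  \<open>cnj (c $ i) * cnj (d $ j)\<close>. Pairing with \<open>d\<close> kills the old part, so a
  vector of the new kernel is orthogonal to \<open>c\<close> and lies in the old kernel. Since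
  \<open>c\<close> itself is lost, the dimension drops.\<close>

lemma rank_one_completion:
  fixes B :: "complex^'m^'m"
  assumes "vec.dim {c. transpose B *v c = 0} \<le> \<kappa>"
  shows "\<exists>k l :: nat \<Rightarrow> complex^'m. det (\<chi> i j. B $ i $ j + (\<Sum>s<\<kappa>. k s $ i * l s $ j)) \<noteq> 0"
  using assms
proof (induction \<kappa> arbitrary: B)
  case 0
  have "det (transpose B) \<noteq> 0"
    using 0 vec.dim_eq_0[of "{c. transpose B *v c = 0}"] unfolding det_nonzero_iff_kernel by auto
  then show ?case by (simp add: det_transpose)
next
  case (Suc \<kappa>)
  show ?case
  proof (cases "det B = 0")
    case False
    then show ?thesis by (intro exI[of _ "\<lambda>_. 0"]) simp
  next
    case True
    then have "det (transpose B) = 0" by (simp add: det_transpose)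
    then obtain c where c: "c \<noteq> 0" "transpose B *v c = 0" using det_nonzero_iff_kernel by blast
    obtain d where d: "d \<noteq> 0" "B *v d = 0" using True det_nonzero_iff_kernel by blast
    define B' where "B' = (\<chi> i j. B $ i $ j + cnj (c $ i) * cnj (d $ j))"
    have dd: "(\<Sum>j\<in>UNIV. cnj (d $ j) * d $ j) \<noteq> 0" if "d \<noteq> 0" for d :: "complex^'m"
    proof
      assume "(\<Sum>j\<in>UNIV. cnj (d $ j) * d $ j) = 0"
      then have "(\<Sum>j\<in>UNIV. (cmod (d $ j))\<^sup>2) = 0"
        by (simp add: complex_norm_square[symmetric] mult.commute[of "cnj _"] of_real_power[symmetric]
            of_real_sum[symmetric] del: of_real_power of_real_sum)
      then have "d = 0" by (simp add: sum_nonneg_eq_0_iff vec_eq_iff)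
      then show False using that by simp
    qed
    have B'x: "(transpose B' *v x) $ j = (transpose B *v x) $ j + cnj (d $ j) * (\<Sum>i\<in>UNIV. cnj (c $ i) * x $ i)"
      for x j
      by (simp add: matrix_vector_mult_def transpose_def B'_def algebra_simps sum.distrib sum_distrib_left)
    have Bd: "(\<Sum>j\<in>UNIV. (transpose B *v x) $ j * d $ j) = 0" for x
    proof -
      have "(\<Sum>j\<in>UNIV. (transpose B *v x) $ j * d $ j) = (\<Sum>i\<in>UNIV. x $ i * (B *v d) $ i)"
        by (simp add: matrix_vector_mult_def transpose_def sum_distrib_left sum_distrib_right)
          (subst sum.swap, simp add: algebra_simps)
      then show ?thesis using d by simp
    qed
    have sub: "transpose B *v x = 0 \<and> (\<Sum>i\<in>UNIV. cnj (c $ i) * x $ i) = 0" if x: "transpose B' *v x = 0" for x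
    proof -
      define s where "s = (\<Sum>i\<in>UNIV. cnj (c $ i) * x $ i)"
      have *: "(transpose B' *v x) $ j = (transpose B *v x) $ j + cnj (d $ j) * s" for j
        using B'x[of x j] by (simp only: s_def)
      have "(\<Sum>j\<in>UNIV. (transpose B' *v x) $ j * d $ j) = 0" using x by simp
      also have "(\<Sum>j\<in>UNIV. (transpose B' *v x) $ j * d $ j)
          = (\<Sum>j\<in>UNIV. (transpose B *v x) $ j * d $ j) + s * (\<Sum>j\<in>UNIV. cnj (d $ j) * d $ j)"
        unfolding * sum_distrib_left sum.distrib[symmetric]
        by (intro sum.cong refl) (simp only: ring_distribs mult_ac)
      finally have "s * (\<Sum>j\<in>UNIV. cnj (d $ j) * d $ j) = 0" using Bd[of x] by simp
      then have s: "(\<Sum>i\<in>UNIV. cnj (c $ i) * x $ i) = 0" using dd[OF d(1)] s_def by simp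
      then have "transpose B *v x = 0" using x B'x[of x] by (simp add: vec_eq_iff)
      then show ?thesis using s by simp
    qed
    have subsp: "vec.subspace {c. A *v c = 0}" for A :: "complex^'m^'m"
      by (auto simp: vec.subspace_def matrix_vector_right_distrib vector_scalar_commute)
    have "{x. transpose B' *v x = 0} \<subset> {x. transpose B *v x = 0}"
    proof
      show "{x. transpose B' *v x = 0} \<subseteq> {x. transpose B *v x = 0}" using sub by blast
      have "c \<notin> {x. transpose B' *v x = 0}" using sub dd[OF c(1)] by blast
      then show "{x. transpose B' *v x = 0} \<noteq> {x. transpose B *v x = 0}" using c by blast
    qed
    then have "vec.dim {x. transpose B' *v x = 0} < vec.dim {x. transpose B *v x = 0}"
      by (intro vec.dim_psubset) (simp only: vec.span_eq_iff[THEN iffD2, OF subsp])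
    then have "vec.dim {x. transpose B' *v x = 0} \<le> \<kappa>" using Suc.prems by simp
    then obtain k l :: "nat \<Rightarrow> complex^'m" where kl: "det (\<chi> i j. B' $ i $ j + (\<Sum>s<\<kappa>. k s $ i * l s $ j)) \<noteq> 0"
      using Suc.IH by blast
    define k' l' where "k' s = (if s = \<kappa> then \<chi> i. cnj (c $ i) else k s)"
      and "l' s = (if s = \<kappa> then \<chi> i. cnj (d $ i) else l s)" for s
    have eq: "(\<chi> i j. B $ i $ j + (\<Sum>s<Suc \<kappa>. k' s $ i * l' s $ j))
        = (\<chi> i j. B' $ i $ j + (\<Sum>s<\<kappa>. k s $ i * l s $ j))"
      by (simp add: vec_eq_iff B'_def k'_def l'_def)
    have "det (\<chi> i j. B $ i $ j + (\<Sum>s<Suc \<kappa>. k' s $ i * l' s $ j)) \<noteq> 0"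
      unfolding eq by (rule kl)
    then show ?thesis by (intro exI)
  qed
qed

text \<open>Adding multiples of \<open>\<nu>\<close> in either argument does not change the form on the kernel of \<open>\<nu>\<close>;
  they are chosen such that the left radical of the new form is the radical on that kernel.\<close>

lemma hyperplane_form_completion:
  fixes B :: "complex^'m^'m" and \<nu> :: "complex^'m"
  assumes "\<nu> \<noteq> 0" "CARD('m) = N + 1"
  defines "T \<equiv> {c. (\<Sum>j\<in>UNIV. \<nu> $ j * c $ j) = 0}"
    and "F \<equiv> \<lambda>c d. \<Sum>i\<in>UNIV. \<Sum>j\<in>UNIV. B $ i $ j * c $ i * cnj (d $ j)"
  shows "form_rank T F \<le> N"
    "\<exists>u u' (k :: nat \<Rightarrow> complex^'m) (l :: nat \<Rightarrow> complex^'m).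
      det (\<chi> i j. B $ i $ j + \<nu> $ i * u $ j + u' $ i * cnj (\<nu> $ j)
        + (\<Sum>s<N - form_rank T F. k s $ i * l s $ j)) \<noteq> 0"
proof -
  define Rad where "Rad = {c \<in> T. \<forall>d\<in>T. F c d = 0}"
  have subT: "vec.subspace T"
    by (auto simp: T_def vec.subspace_def distrib_left sum.distrib sum_distrib_left[symmetric] mult.left_commute)
  define \<sigma> where "\<sigma> = (\<Sum>j\<in>UNIV. \<nu> $ j * cnj (\<nu> $ j))"
  have \<sigma>: "\<sigma> \<noteq> 0"
  proof
    assume "\<sigma> = 0"
    then have "(\<Sum>j\<in>UNIV. (cmod (\<nu> $ j))\<^sup>2) = 0"
      by (simp add: \<sigma>_def complex_norm_square[symmetric] of_real_power[symmetric]
          of_real_sum[symmetric] del: of_real_power of_real_sum)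
    then have "\<nu> = 0" by (simp add: sum_nonneg_eq_0_iff vec_eq_iff)
    then show False using assms(1) by simp
  qed
  have dimT: "vec.dim T \<le> N"
  proof -
    have "(\<chi> j. cnj (\<nu> $ j)) \<notin> T" using \<sigma> by (simp add: T_def \<sigma>_def)
    then have "T \<subset> UNIV" by blast
    then have "vec.dim T < vec.dim (UNIV :: (complex^'m) set)"
      by (intro vec.dim_psubset) (simp add: vec.span_eq_iff[THEN iffD2, OF subT])
    then show ?thesis using assms(2) vec_dim_card[where 'n = 'm and 'a = complex] by linarith
  qed
  have r: "form_rank T F = vec.dim T - vec.dim Rad" by (simp add: form_rank_def Rad_def)
  then show "form_rank T F \<le> N" using dimT by simp
  have "vec.dim Rad \<le> vec.dim T" by (rule vec.dim_subset) (auto simp: Rad_def)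
  then have dR: "vec.dim Rad \<le> N - form_rank T F" using r dimT by simp
  \<comment> \<open>Tested against the conjugate of \<open>\<nu>\<close>, the term with
    \<open>u\<close> is the value of \<open>\<nu>\<close> on \<open>c\<close>, and the term with
    \<open>u'\<close> cancels \<open>F\<close>. So a left null vector \<open>c\<close> lies in
    \<open>T\<close>; tested against \<open>T\<close> it is then in \<open>Rad\<close>.\<close>
  define u :: "complex^'m" where "u = (\<chi> j. cnj (\<nu> $ j) / \<sigma>)"
  define u' :: "complex^'m" where "u' = (\<chi> i. - (\<Sum>j\<in>UNIV. B $ i $ j * \<nu> $ j) / \<sigma>)"
  define B1 where "B1 = (\<chi> i j. B $ i $ j + \<nu> $ i * u $ j + u' $ i * cnj (\<nu> $ j))"
  have form: "(\<Sum>j\<in>UNIV. (transpose B1 *v c) $ j * cnj (d $ j)) = F c d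
      + (\<Sum>i\<in>UNIV. \<nu> $ i * c $ i) * (\<Sum>j\<in>UNIV. u $ j * cnj (d $ j))
      + (\<Sum>i\<in>UNIV. u' $ i * c $ i) * cnj (\<Sum>j\<in>UNIV. \<nu> $ j * d $ j)" for c d
  proof -
    have "(\<Sum>j\<in>UNIV. (transpose B1 *v c) $ j * cnj (d $ j))
       = (\<Sum>j\<in>UNIV. \<Sum>i\<in>UNIV. B1 $ i $ j * c $ i * cnj (d $ j))"
      by (simp add: matrix_vector_mult_def transpose_def sum_distrib_right)
    also have "\<dots> = (\<Sum>i\<in>UNIV. \<Sum>j\<in>UNIV. B1 $ i $ j * c $ i * cnj (d $ j))" by (rule sum.swap)
    also have "\<dots> = (\<Sum>i\<in>UNIV. \<Sum>j\<in>UNIV. B $ i $ j * c $ i * cnj (d $ j)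
        + (\<nu> $ i * c $ i) * (u $ j * cnj (d $ j)) + (u' $ i * c $ i) * cnj (\<nu> $ j * d $ j))"
      by (intro sum.cong refl) (simp add: B1_def algebra_simps)
    finally show ?thesis by (simp add: F_def sum.distrib sum_product cnj_sum)
  qed
  have "{c. transpose B1 *v c = 0} \<subseteq> Rad"
  proof
    fix c assume "c \<in> {c. transpose B1 *v c = 0}"
    then have z: "F c d + (\<Sum>i\<in>UNIV. \<nu> $ i * c $ i) * (\<Sum>j\<in>UNIV. u $ j * cnj (d $ j))
      + (\<Sum>i\<in>UNIV. u' $ i * c $ i) * cnj (\<Sum>j\<in>UNIV. \<nu> $ j * d $ j) = 0" for d
      using form[of c d] by simp
    define lb :: "complex^'m" where "lb = (\<chi> j. cnj (\<nu> $ j))"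
    have a1: "(\<Sum>j\<in>UNIV. u $ j * cnj (lb $ j)) = 1"
      using \<sigma> by (simp add: u_def lb_def \<sigma>_def sum_divide_distrib[symmetric] mult.commute[of "cnj _"])
    have a2: "cnj (\<Sum>j\<in>UNIV. \<nu> $ j * lb $ j) = \<sigma>"
      by (simp add: lb_def \<sigma>_def cnj_sum mult.commute)
    have a3: "(\<Sum>i\<in>UNIV. u' $ i * c $ i) * \<sigma> = - F c lb"
    proof -
      have "(\<Sum>i\<in>UNIV. u' $ i * c $ i) * \<sigma> = (\<Sum>i\<in>UNIV. - (\<Sum>j\<in>UNIV. B $ i $ j * \<nu> $ j) * c $ i)"
      proof (subst sum_distrib_right, intro sum.cong refl)
        show "u' $ i * c $ i * \<sigma> = - (\<Sum>j\<in>UNIV. B $ i $ j * \<nu> $ j) * c $ i" for i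
          using \<sigma> unfolding u'_def by simp
      qed
      then show ?thesis
        by (simp add: F_def lb_def sum_distrib_right sum_distrib_left sum_negf mult_ac)
    qed
    have lc: "(\<Sum>i\<in>UNIV. \<nu> $ i * c $ i) = 0"
      using z[of lb] unfolding a1 a2 a3 by simp
    have "F c d = 0" if "d \<in> T" for d
    proof -
      have "(\<Sum>j\<in>UNIV. \<nu> $ j * d $ j) = 0" using that by (simp add: T_def)
      then show ?thesis using z[of d] unfolding lc by simp
    qed
    then show "c \<in> Rad" using lc by (simp add: Rad_def T_def)
  qed
  then have "vec.dim {c. transpose B1 *v c = 0} \<le> N - form_rank T F"
    using vec.dim_subset dR by (meson order_trans)
  then obtain k l :: "nat \<Rightarrow> complex^'m"
    where "det (\<chi> i j. B1 $ i $ j + (\<Sum>s<N - form_rank T F. k s $ i * l s $ j)) \<noteq> 0"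
    using rank_one_completion by blast
  then show "\<exists>u u' (k :: nat \<Rightarrow> complex^'m) (l :: nat \<Rightarrow> complex^'m).
      det (\<chi> i j. B $ i $ j + \<nu> $ i * u $ j + u' $ i * cnj (\<nu> $ j)
        + (\<Sum>s<N - form_rank T F. k s $ i * l s $ j)) \<noteq> 0"
    by (intro exI[of _ u] exI[of _ u'] exI[of _ k] exI[of _ l]) (simp add: B1_def)
qed

section \<open>Congruence modulo a smooth function\<close>

text \<open>The quotient \<open>h\<close> is demanded explicitly: \<open>a\<close> may vanish, and
  vanishing of a difference on the zeros of \<open>a\<close> would not make its quotient by
  \<open>a\<close> smooth.\<close>

definition smooth_cong :: "'a::real_normed_vector set \<Rightarrow> ('a \<Rightarrow> complex) \<Rightarrow> ('a \<Rightarrow> complex) \<Rightarrow> ('a \<Rightarrow> complex) \<Rightarrow> bool" where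
  "smooth_cong S a f g \<longleftrightarrow> smooth_on S g \<and> (\<exists>h. smooth_on S h \<and> (\<forall>z\<in>S. f z = g z + a z * h z))"

lemma smooth_cong_refl: "smooth_on S f \<Longrightarrow> smooth_cong S a f f"
  unfolding smooth_cong_def by (intro conjI exI[of _ "\<lambda>_. 0"]) (auto intro: smooth_on_const)

lemma smooth_cong_add:
  assumes "open S" "smooth_cong S a f g" "smooth_cong S a f' g'"
  shows "smooth_cong S a (\<lambda>z. f z + f' z) (\<lambda>z. g z + g' z)"
proof -
  obtain h h' where h: "smooth_on S h" "\<forall>z\<in>S. f z = g z + a z * h z"
    "smooth_on S h'" "\<forall>z\<in>S. f' z = g' z + a z * h' z"
    using assms by (auto simp: smooth_cong_def)
  then show ?thesis unfolding smooth_cong_def using assms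
    by (intro conjI exI[of _ "\<lambda>z. h z + h' z"]) (auto simp: smooth_cong_def algebra_simps intro!: smooth_on_add)
qed

lemma smooth_cong_mult:
  assumes "open S" "smooth_on S a" "smooth_cong S a f g" "smooth_cong S a f' g'"
  shows "smooth_cong S a (\<lambda>z. f z * f' z) (\<lambda>z. g z * g' z)"
proof -
  obtain h h' where h: "smooth_on S h" "\<forall>z\<in>S. f z = g z + a z * h z"
    "smooth_on S h'" "\<forall>z\<in>S. f' z = g' z + a z * h' z"
    using assms by (auto simp: smooth_cong_def)
  have g: "smooth_on S g" "smooth_on S g'" using assms by (auto simp: smooth_cong_def)
  show ?thesis unfolding smooth_cong_def
  proof (intro conjI exI[of _ "\<lambda>z. h z * g' z + g z * h' z + a z * (h z * h' z)"] ballI)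
    show "f z * f' z = g z * g' z + a z * (h z * g' z + g z * h' z + a z * (h z * h' z))" if "z \<in> S" for z
      using h that by (simp add: algebra_simps)
  qed (intro smooth_intros assms h g)+
qed

lemma smooth_cong_sum:
  assumes "open S" "\<And>i. i \<in> I \<Longrightarrow> smooth_cong S a (f i) (g i)"
  shows "smooth_cong S a (\<lambda>z. \<Sum>i\<in>I. f i z) (\<lambda>z. \<Sum>i\<in>I. g i z)"
  using assms(2)
proof (induction I rule: infinite_finite_induct)
  case (insert i I)
  then have "smooth_cong S a (\<lambda>z. f i z + (\<Sum>i\<in>I. f i z)) (\<lambda>z. g i z + (\<Sum>i\<in>I. g i z))"
    by (intro smooth_cong_add assms(1)) auto
  then show ?case using insert by simp
qed (auto intro: smooth_cong_refl smooth_on_const)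

lemma smooth_cong_prod:
  assumes "open S" "smooth_on S a" "\<And>i. i \<in> I \<Longrightarrow> smooth_cong S a (f i) (g i)"
  shows "smooth_cong S a (\<lambda>z. \<Prod>i\<in>I. f i z) (\<lambda>z. \<Prod>i\<in>I. g i z)"
  using assms(3)
proof (induction I rule: infinite_finite_induct)
  case (insert i I)
  then have "smooth_cong S a (\<lambda>z. f i z * (\<Prod>i\<in>I. f i z)) (\<lambda>z. g i z * (\<Prod>i\<in>I. g i z))"
    by (intro smooth_cong_mult assms(1,2)) auto
  then show ?case using insert by simp
qed (auto intro: smooth_cong_refl smooth_on_const)

lemma smooth_cong_det:
  fixes Q Q' :: "'a::real_normed_vector \<Rightarrow> complex^'m^'m"
  assumes "open S" "smooth_on S a" "\<And>i j. smooth_cong S a (\<lambda>z. Q z $ i $ j) (\<lambda>z. Q' z $ i $ j)"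
  shows "smooth_cong S a (\<lambda>z. det (Q z)) (\<lambda>z. det (Q' z))"
  unfolding det_def
  by (intro smooth_cong_sum smooth_cong_mult smooth_cong_prod assms smooth_cong_refl smooth_on_const)

lemma smooth_on_det:
  fixes Q :: "'a::real_normed_vector \<Rightarrow> complex^'m^'m"
  assumes "open S" "\<And>i j. smooth_on S (\<lambda>z. Q z $ i $ j)"
  shows "smooth_on S (\<lambda>z. det (Q z))"
  unfolding det_def by (intro smooth_intros assms)

lemma hol_det:
  fixes Q :: "complex^'n \<Rightarrow> complex^'m^'m"
  assumes "\<And>i j. hol S (\<lambda>z. Q z $ i $ j)"
  shows "hol S (\<lambda>z. det (Q z))"
  unfolding det_def by (intro hol_intros assms)

section \<open>Wirtinger calculus\<close>

lemma wirtinger_expansion: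
  fixes f :: "complex^'m \<Rightarrow> complex"
  assumes "f differentiable (at z)"
  shows "Dv f w z = (\<Sum>k\<in>UNIV. dZ k f z * w $ k + dZbar k f z * cnj (w $ k))"
proof -
  have lin: "linear (\<lambda>v. Dv f v z)" by (rule linear_frechet_derivative[OF assms])
  have "w = (\<Sum>k\<in>UNIV. Re (w $ k) *\<^sub>R axis k 1 + Im (w $ k) *\<^sub>R axis k \<i>)"
    by (simp add: vec_eq_iff axis_def if_distrib[of "\<lambda>x. _ *\<^sub>R x"] sum.distrib complex_eq_iff cong: if_cong)
  then have "Dv f w z = Dv f (\<Sum>k\<in>UNIV. Re (w $ k) *\<^sub>R axis k 1 + Im (w $ k) *\<^sub>R axis k \<i>) z"
    by metis
  also have "\<dots> = (\<Sum>k\<in>UNIV. Re (w $ k) *\<^sub>R Dv f (axis k 1) z + Im (w $ k) *\<^sub>R Dv f (axis k \<i>) z)"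
    by (simp only: linear_sum[OF lin] linear_add[OF lin] linear_scale[OF lin])
  also have "\<dots> = (\<Sum>k\<in>UNIV. dZ k f z * w $ k + dZbar k f z * cnj (w $ k))"
  proof (rule sum.cong[OF refl])
    fix k
    define x y where "x = Dv f (axis k 1) z" and "y = Dv f (axis k \<i>) z"
    have "Re (w $ k) *\<^sub>R x + Im (w $ k) *\<^sub>R y
        = (x - \<i> * y) / 2 * w $ k + (x + \<i> * y) / 2 * cnj (w $ k)"
      by (simp add: complex_eq_iff field_simps)
    then show "Re (w $ k) *\<^sub>R Dv f (axis k 1) z + Im (w $ k) *\<^sub>R Dv f (axis k \<i>) z
      = dZ k f z * w $ k + dZbar k f z * cnj (w $ k)"
      by (simp add: dZ_def dZbar_def x_def y_def)
  qed
  finally show ?thesis .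
qed

lemma dZ_cong_open:
  assumes "open S" "x \<in> S" "\<And>y. y \<in> S \<Longrightarrow> f y = g y"
  shows "dZ j f x = dZ j g x" "dZbar j f x = dZbar j g x"
  unfolding dZ_def dZbar_def by (simp_all only: Dv_cong_open[OF assms])

lemma dZ_add:
  assumes "f differentiable (at z)" "g differentiable (at z)"
  shows "dZ j (\<lambda>z. f z + g z) z = dZ j f z + dZ j g z"
  unfolding dZ_def Dv_eqI[OF has_derivative_add[OF Dv_works[OF assms(1)] Dv_works[OF assms(2)]]]
  by (simp add: field_simps)

lemma dZ_mult:
  fixes f g :: "complex^'n \<Rightarrow> complex"
  assumes "f differentiable (at z)" "g differentiable (at z)"
  shows "dZ j (\<lambda>z. f z * g z) z = dZ j f z * g z + f z * dZ j g z"
  unfolding dZ_def Dv_eqI[OF has_derivative_mult[OF Dv_works[OF assms(1)] Dv_works[OF assms(2)]]]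
  by (simp add: field_simps)

lemma dZ_sum:
  fixes f :: "'i \<Rightarrow> complex^'n \<Rightarrow> complex"
  assumes "finite I" "\<And>i. i \<in> I \<Longrightarrow> f i differentiable (at z)"
  shows "dZ j (\<lambda>z. \<Sum>i\<in>I. f i z) z = (\<Sum>i\<in>I. dZ j (f i) z)"
  using assms
proof (induction I rule: finite_induct)
  case empty
  then show ?case by (simp add: dZ_def)
next
  case (insert i I)
  have "(\<lambda>z. \<Sum>i\<in>I. f i z) differentiable (at z)"
    using insert by (intro differentiable_sum) auto
  then show ?case using insert by (simp add: dZ_add)
qed

lemma hol_dZ: "hol S f \<Longrightarrow> z \<in> S \<Longrightarrow> dZ j f z = Dv f (axis j 1) z"
  and hol_dZbar: "hol S f \<Longrightarrow> z \<in> S \<Longrightarrow> dZbar j f z = 0"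
proof -
  assume f: "hol S f" and z: "z \<in> S"
  have "axis j \<i> = \<i> *s (axis j 1 :: complex^'a)" by (simp add: vec_eq_iff axis_def)
  then have "Dv f (axis j \<i>) z = \<i> * Dv f (axis j 1) z" using hol_Dv_scale[OF f z] by metis
  then show "dZ j f z = Dv f (axis j 1) z" "dZbar j f z = 0"
    by (simp_all add: dZ_def dZbar_def)
qed

lemma dZ_cnj:
  assumes "f differentiable (at z)"
  shows "dZ j (\<lambda>z. cnj (f z)) z = cnj (dZbar j f z)"
  unfolding dZ_def dZbar_def Dv_eqI[OF has_derivative_cnj[OF Dv_works[OF assms]]]
  by simp

lemma dZbar_of_real:
  assumes "f differentiable (at z)"
  shows "dZbar j (\<lambda>z. complex_of_real (f z)) z = cnj (dZ j (\<lambda>z. complex_of_real (f z)) z)"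
  unfolding dZ_def dZbar_def Dv_eqI[OF has_derivative_of_real[OF Dv_works[OF assms]]]
  by simp

lemma smooth_on_dZ: "open S \<Longrightarrow> smooth_on S f \<Longrightarrow> smooth_on S (dZ j f)"
  and smooth_on_dZbar: "open S \<Longrightarrow> smooth_on S f \<Longrightarrow> smooth_on S (dZbar j f)"
proof -
  assume S: "open S" "smooth_on S f"
  show "smooth_on S (dZ j f)" "smooth_on S (dZbar j f)"
    unfolding dZ_def[abs_def] dZbar_def[abs_def] divide_inverse
    by (intro smooth_intros S smooth_on_Dv)+
qed

text \<open>The differential of \<open>H\<close> commutes with \<i>, so the two types of Wirtinger
  derivatives do not mix under composition.\<close>

lemma dZ_compose:
  fixes F :: "complex^'m \<Rightarrow> complex" and H :: "complex^'n \<Rightarrow> complex^'m"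
  assumes F: "F differentiable (at (H z))" and H: "holomorphic_map_on S H" "z \<in> S"
  shows "dZ i (\<lambda>z. F (H z)) z = (\<Sum>k\<in>UNIV. dZ k F (H z) * Dv (\<lambda>w. H w $ k) (axis i 1) z)"
    "dZbar i (\<lambda>z. F (H z)) z = (\<Sum>k\<in>UNIV. dZbar k F (H z) * cnj (Dv (\<lambda>w. H w $ k) (axis i 1) z))"
proof -
  obtain D where D: "(H has_derivative D) (at z)" "\<forall>c v. D (c *s v) = c *s D v"
    using holomorphic_map_onD[OF H] by blast
  define J where "J k = D (axis i 1) $ k" for k
  have J: "Dv (\<lambda>w. H w $ k) (axis i 1) z = J k" for k
    unfolding J_def by (rule Dv_eqI[OF bounded_linear.has_derivative[OF bounded_linear_vec_nth D(1)]])
  have "axis i \<i> = \<i> *s (axis i 1 :: complex^'n)" by (simp add: vec_eq_iff axis_def)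
  then have Di: "D (axis i \<i>) $ k = \<i> * J k" for k
    using D(2) by (simp add: J_def)
  have "Dv (\<lambda>z. F (H z)) v z = Dv F (D v) (H z)" for v
    by (rule Dv_eqI[OF has_derivative_compose[OF D(1) Dv_works[OF F]]])
  then have e: "Dv (\<lambda>z. F (H z)) v z = (\<Sum>k\<in>UNIV. dZ k F (H z) * D v $ k + dZbar k F (H z) * cnj (D v $ k))" for v
    using wirtinger_expansion[OF F] by simp
  have e1: "Dv (\<lambda>z. F (H z)) (axis i 1) z = (\<Sum>k\<in>UNIV. dZ k F (H z) * J k) + (\<Sum>k\<in>UNIV. dZbar k F (H z) * cnj (J k))"
    unfolding e by (simp add: J_def sum.distrib)
  have e2: "Dv (\<lambda>z. F (H z)) (axis i \<i>) z = \<i> * (\<Sum>k\<in>UNIV. dZ k F (H z) * J k) - \<i> * (\<Sum>k\<in>UNIV. dZbar k F (H z) * cnj (J k))"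
    unfolding e Di by (simp add: sum.distrib[symmetric] sum_subtractf[symmetric] sum_distrib_left algebra_simps)
  show "dZ i (\<lambda>z. F (H z)) z = (\<Sum>k\<in>UNIV. dZ k F (H z) * Dv (\<lambda>w. H w $ k) (axis i 1) z)"
    "dZbar i (\<lambda>z. F (H z)) z = (\<Sum>k\<in>UNIV. dZbar k F (H z) * cnj (Dv (\<lambda>w. H w $ k) (axis i 1) z))"
    unfolding dZ_def dZbar_def e1 e2 J by (simp_all add: algebra_simps)
qed

section \<open>Divisibility of the minors of the Jacobian\<close>

lemma det_cnj: "det (\<chi> i j. cnj (A $ i $ j)) = cnj (det (A :: complex^'m^'m))"
  by (simp add: det_def cnj_sum cnj_prod)

lemma sum_range_extension:
  fixes g :: "'m::finite \<Rightarrow> complex" and y :: "'n::finite \<Rightarrow> complex"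
  assumes "inj \<kappa>"
  shows "(\<Sum>c\<in>UNIV. g c * (if c \<in> range \<kappa> then y (inv \<kappa> c) else 0)) = (\<Sum>j\<in>UNIV. g (\<kappa> j) * y j)"
proof -
  have "(\<Sum>c\<in>UNIV. g c * (if c \<in> range \<kappa> then y (inv \<kappa> c) else 0))
      = (\<Sum>c\<in>range \<kappa>. g c * y (inv \<kappa> c))"
    by (rule sum.mono_neutral_cong_right) auto
  also have "\<dots> = (\<Sum>j\<in>UNIV. g (\<kappa> j) * y j)"
    using assms by (subst sum.reindex) auto
  finally show ?thesis .
qed

section \<open>Minors of the Jacobian and its rank\<close>

definition jac :: "(complex^'n \<Rightarrow> complex^'m) \<Rightarrow> 'n \<Rightarrow> 'm \<Rightarrow> complex^'n \<Rightarrow> complex" where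
  "jac H i k z = Dv (\<lambda>w. H w $ k) (axis i 1) z"

text \<open>For injective \<open>\<iota>\<close>, the determinant of \<open>frame H \<iota>\<close> is up to sign the minor of the Jacobian with
  rows \<open>range \<iota>\<close>: the other columns are standard basis vectors.\<close>

definition frame :: "(complex^'n \<Rightarrow> complex^'m) \<Rightarrow> ('n \<Rightarrow> 'm) \<Rightarrow> complex^'n \<Rightarrow> complex^'m^'m" where
  "frame H \<iota> z = (\<chi> k c. if c \<in> range \<iota> then jac H (inv \<iota> c) k z else if k = c then 1 else 0)"

definition minor :: "(complex^'n \<Rightarrow> complex^'m) \<Rightarrow> ('n \<Rightarrow> 'm) \<Rightarrow> complex^'n \<Rightarrow> complex" where
  "minor H \<iota> z = det (frame H \<iota> z)"

lemma hol_jac: "open S \<Longrightarrow> holomorphic_map_on S H \<Longrightarrow> hol S (jac H i k)"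
  unfolding jac_def[abs_def] by (intro hol_Dv holomorphic_map_on_nth)

lemma hol_frame: "open S \<Longrightarrow> holomorphic_map_on S H \<Longrightarrow> hol S (\<lambda>z. frame H \<iota> z $ k $ c)"
  unfolding frame_def by (cases "c \<in> range \<iota>") (auto intro: hol_jac hol_const)

lemma hol_minor: "open S \<Longrightarrow> holomorphic_map_on S H \<Longrightarrow> hol S (minor H \<iota>)"
  unfolding minor_def[abs_def] by (rule hol_det[OF hol_frame])

text \<open>If the rank is deficient, a common null vector of the rows, placed in the Jacobian
  columns and extended by zero, is in the kernel of every frame. If the rank is full, rows forming a
  basis select \<open>\<iota>\<close>: these rows force the Jacobian part of a null vector to
  vanish, and the unit columns then force the rest.\<close>

lemma rank_less_iff_minors_vanish:
  fixes H :: "complex^'n \<Rightarrow> complex^'m"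
  assumes "open S" "holomorphic_map_on S H" "z \<in> S"
  shows "rank (holomorphic_jacobian H z) < CARD('n) \<longleftrightarrow> (\<forall>\<iota>. inj \<iota> \<longrightarrow> minor H \<iota> z = 0)"
proof -
  define A where "A = holomorphic_jacobian H z"
  have A: "A $ k $ i = jac H i k z" for k i
    using hol_dZ[OF holomorphic_map_on_nth[OF assms(2)] assms(3)]
    by (simp add: A_def holomorphic_jacobian_def jac_def)
  have ker: "(\<Sum>j\<in>UNIV. v $ j * y $ j) = 0"
    if "v \<in> vec.span B" "\<And>b. b \<in> B \<Longrightarrow> (\<Sum>j\<in>UNIV. b $ j * y $ j) = 0" for v y :: "complex^'n" and B
  proof -
    have "vec.subspace {v. (\<Sum>j\<in>UNIV. v $ j * y $ j) = 0}"
      by (auto simp: vec.subspace_def distrib_right sum.distrib sum_distrib_left[symmetric] mult.assoc)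
    then have "vec.span B \<subseteq> {v. (\<Sum>j\<in>UNIV. v $ j * y $ j) = 0}"
      using that(2) by (intro vec.span_minimal) auto
    then show ?thesis using that(1) by blast
  qed
  obtain B where B: "B \<subseteq> rows A" "vec.independent B" "rows A \<subseteq> vec.span B" "card B = vec.dim (rows A)"
    by (rule vec.basis_exists)
  have rank: "rank A = card B" using B(4) by (simp add: row_rank_def_gen)
  have "rows A = range (\<lambda>i. row i A)" by (auto simp: rows_def)
  then have "finite (rows A)" by simp
  then have finB: "finite B" using B(1) finite_subset by blast
  have frame_mult: "(frame H \<iota> z *v Y) $ k = (\<Sum>j\<in>UNIV. A $ k $ j * Y $ \<iota> j) + (if k \<in> range \<iota> then 0 else Y $ k)"
    if "inj \<iota>" for \<iota> :: "'n \<Rightarrow> 'm" and Y k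
  proof -
    have "(frame H \<iota> z *v Y) $ k = (\<Sum>c\<in>UNIV. Y $ c * (if c \<in> range \<iota> then A $ k $ (inv \<iota> c) else 0)
        + (if c = k then (if k \<in> range \<iota> then 0 else Y $ k) else 0))"
      by (auto simp: matrix_vector_mult_def frame_def A intro!: sum.cong)
    also have "\<dots> = (\<Sum>j\<in>UNIV. Y $ \<iota> j * A $ k $ j) + (if k \<in> range \<iota> then 0 else Y $ k)"
      by (simp only: sum.distrib sum_range_extension[OF that, of _ "\<lambda>j. A $ k $ j"] sum.delta finite_class.finite_UNIV UNIV_I if_True)
    finally show ?thesis by (simp add: mult.commute)
  qed
  have "minor H \<iota> z = 0" if rk: "rank A < CARD('n)" and "inj \<iota>" for \<iota>
  proof -
    obtain y :: "complex^'n" where y: "y \<noteq> 0" "\<forall>b\<in>B. (\<Sum>j\<in>UNIV. b $ j * y $ j) = 0"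
      using common_kernel_nontrivial[OF finB] rk rank by auto
    have Ay: "(\<Sum>j\<in>UNIV. A $ k $ j * y $ j) = 0" for k
    proof -
      have "A $ k \<in> rows A" by (auto simp: rows_def row_def vec_eq_iff)
      then show ?thesis using ker[of "A $ k" B y] B(3) y(2) by blast
    qed
    define Y :: "complex^'m" where "Y = (\<chi> c. if c \<in> range \<iota> then y $ inv \<iota> c else 0)"
    have "frame H \<iota> z *v Y = 0"
      using Ay \<open>inj \<iota>\<close> by (simp add: vec_eq_iff frame_mult Y_def)
    moreover have "Y \<noteq> 0"
    proof -
      obtain j where "y $ j \<noteq> 0" using y(1) by (auto simp: vec_eq_iff)
      then have "Y $ \<iota> j \<noteq> 0" using \<open>inj \<iota>\<close> by (simp add: Y_def)
      then show ?thesis by auto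
    qed
    ultimately show ?thesis unfolding minor_def using det_nonzero_iff_kernel by blast
  qed
  moreover have "\<exists>\<iota>. inj \<iota> \<and> minor H \<iota> z \<noteq> 0" if "\<not> rank A < CARD('n)"
  proof -
    have "vec.dim (rows A) \<le> vec.dim (UNIV :: (complex^'n) set)" by (rule vec.dim_subset[OF subset_UNIV])
    then have cB: "card B = CARD('n)"
      using that rank B(4) vec_dim_card[where 'n = 'n and 'a = complex] by linarith
    then obtain h where h: "bij_betw h (UNIV :: 'n set) B"
      using finite_same_card_bij[of "UNIV :: 'n set" B] finB by auto
    define \<iota> where "\<iota> i = (SOME k. A $ k = h i)" for i
    have \<iota>: "A $ \<iota> i = h i" for i
    proof -
      have "h i \<in> rows A" using h B(1) by (auto simp: bij_betw_def)
      then obtain k where "h i = row k A" by (auto simp: rows_def)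
      then have "A $ k = h i" by (simp add: row_def vec_eq_iff)
      then show ?thesis unfolding \<iota>_def by (rule someI)
    qed
    have inj: "inj \<iota>"
    proof (rule injI)
      fix i j assume "\<iota> i = \<iota> j"
      then have "h i = h j" using \<iota> by metis
      then show "i = j" using h by (auto simp: bij_betw_def inj_on_def)
    qed
    have "vec.dim B = CARD('n)" using cB vec.dim_eq_card_independent[OF B(2)] by simp
    then have span: "vec.span B = UNIV"
      using vec.dim_eq_full[of B] vec_dim_card[where 'n = 'n and 'a = complex] by (simp add: vec.dimension_def)
    have "Y = 0" if Y: "frame H \<iota> z *v Y = 0" for Y
    proof -
      define y :: "complex^'n" where "y = (\<chi> j. Y $ \<iota> j)"
      have eq: "(\<Sum>j\<in>UNIV. A $ k $ j * y $ j) + (if k \<in> range \<iota> then 0 else Y $ k) = 0" for k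
        using frame_mult[OF inj, of Y k] Y by (simp add: y_def)
      have "(\<Sum>j\<in>UNIV. b $ j * y $ j) = 0" if "b \<in> B" for b
      proof -
        obtain i where "b = A $ \<iota> i" using h \<open>b \<in> B\<close> \<iota> by (metis bij_betw_def imageE)
        then show ?thesis using eq[of "\<iota> i"] by simp
      qed
      then have all: "(\<Sum>j\<in>UNIV. v $ j * y $ j) = 0" for v using ker[of v B y] span by blast
      have "y $ j = 0" for j
        using all[of "axis j 1"] by (simp add: axis_def if_distrib[of "\<lambda>x. x * _"] cong: if_cong)
      then have y0: "Y $ \<iota> j = 0" for j by (simp add: y_def)
      have "Y $ k = 0" for k
      proof (cases "k \<in> range \<iota>")
        case True
        then show ?thesis using y0 by auto
      next
        case False
        then show ?thesis using eq[of k] all[of "A $ k"] by simp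
      qed
      then show ?thesis by (simp add: vec_eq_iff)
    qed
    then show ?thesis using inj unfolding minor_def det_nonzero_iff_kernel by blast
  qed
  ultimately show ?thesis unfolding A_def by blast
qed

text \<open>The direction \<open>e\<close> serves twice. As \<open>\<rho>_e\<close> holds on all of
  \<open>U\<close>, the factor \<open>a\<close> is smooth on \<open>U\<close> and not only defined
  on the level set; and \<open>e\<close> will be the direction of the fibres, so that \<rho> has
  nonzero derivative along them.\<close>

locale hypersurface_map =
  fixes U :: "(complex^'n) set" and \<rho> :: "complex^'n \<Rightarrow> real" and e :: "complex^'n"
    and H :: "complex^'n \<Rightarrow> complex^'m" and U' :: "(complex^'m) set" and \<rho>' :: "complex^'m \<Rightarrow> real"
  assumes open_U: "open U" and smooth_\<rho>: "smooth_on U \<rho>" and \<rho>_e: "\<And>z. z \<in> U \<Longrightarrow> Dv \<rho> e z \<noteq> 0"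
    and H: "holomorphic_map_on U H" and open_U': "open U'" and smooth_\<rho>': "smooth_on U' \<rho>'"
    and HU: "H ` U \<subseteq> U'" and H_maps: "\<And>z. z \<in> U \<Longrightarrow> \<rho> z = 0 \<Longrightarrow> \<rho>' (H z) = 0"
begin

definition \<phi> :: "complex^'n \<Rightarrow> real" where "\<phi> z = \<rho>' (H z)"

text \<open>On the level set of \<open>\<rho>\<close>, the differential of \<open>\<phi>\<close> is \<open>a\<close> times that of \<open>\<rho>\<close>.\<close>

definition a :: "complex^'n \<Rightarrow> complex" where "a z = of_real (Dv \<phi> e z / Dv \<rho> e z)"

abbreviation "J \<equiv> jac H"
abbreviation "\<rho>c \<equiv> \<lambda>z. complex_of_real (\<rho> z)"
abbreviation "\<phi>c \<equiv> \<lambda>z. complex_of_real (\<phi> z)"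
abbreviation "\<rho>'c \<equiv> \<lambda>z. complex_of_real (\<rho>' z)"

section \<open>Derivatives of \<open>\<phi>\<close> on the level set of
  \<open>\<rho>\<close>\<close>

lemma hol_H: "hol U (\<lambda>w. H w $ k)"
  by (rule holomorphic_map_on_nth[OF H])

lemma hol_J: "hol U (J i k)"
  by (rule hol_jac[OF open_U H])

lemma smooth_H: "smooth_on U H"
proof -
  have "smooth_on U (\<lambda>z. \<Sum>b\<in>Basis. (H z \<bullet> b) *\<^sub>R b)"
  proof (intro smooth_on_sum[OF open_U])
    fix b :: "complex^'m" assume "b \<in> Basis"
    then obtain k c where b: "b = axis k c" by (auto simp: Basis_vec_def)
    have "smooth_on U (\<lambda>z. (\<lambda>x. (x \<bullet> c) *\<^sub>R b) (H z $ k))"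
      by (rule smooth_on_bounded_linear[OF open_U _ hol_smooth_on[OF open_U hol_H]])
        (intro bounded_linear_compose[OF bounded_linear_scaleR_left] bounded_linear_inner_left)
    then show "smooth_on U (\<lambda>z. (H z \<bullet> b) *\<^sub>R b)" by (simp add: b inner_axis)
  qed
  then show ?thesis by (simp add: euclidean_representation)
qed

lemma smooth_compose_H: "smooth_on U' F \<Longrightarrow> smooth_on U (\<lambda>z. F (H z))" for F :: "complex^'m \<Rightarrow> 'b::real_normed_vector"
  by (rule smooth_on_compose[OF open_U _ smooth_H HU])

lemma smooth_\<phi>: "smooth_on U \<phi>"
  unfolding \<phi>_def[abs_def] by (rule smooth_compose_H[OF smooth_\<rho>'])

lemma smooth_c: "smooth_on U \<rho>c" "smooth_on U \<phi>c" "smooth_on U' \<rho>'c"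
  using smooth_\<rho> smooth_\<phi> smooth_\<rho>' open_U open_U' by (auto intro: smooth_on_of_real)

lemma smooth_a: "smooth_on U a"
  unfolding a_def[abs_def] using \<rho>_e open_U by (intro smooth_intros smooth_on_Dv smooth_\<rho> smooth_\<phi>) auto

text \<open>Subtracting the right multiple of \<open>e\<close> makes \<open>v\<close> tangent to the
  level set, where the derivative of \<open>F\<close> is zero.\<close>

lemma Dv_of_vanishing:
  assumes F: "smooth_on U F" "\<And>z. z \<in> U \<Longrightarrow> \<rho> z = 0 \<Longrightarrow> F z = 0" and z: "z \<in> U" "\<rho> z = 0"
  shows "Dv F v z = (Dv \<rho> v z / Dv \<rho> e z) *\<^sub>R Dv F e z"
proof -
  let ?r = "Dv \<rho> v z / Dv \<rho> e z"
  note d\<rho> = smooth_on_has_derivative[OF smooth_\<rho> z(1)] and dF = smooth_on_has_derivative[OF F(1) z(1)]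
  have l\<rho>: "linear (\<lambda>v. Dv \<rho> v z)" and lF: "linear (\<lambda>v. Dv F v z)"
    using d\<rho> dF has_derivative_linear by blast+
  have "Dv \<rho> (v - ?r *\<^sub>R e) z = Dv \<rho> v z - ?r *\<^sub>R Dv \<rho> e z"
    by (simp only: linear_diff[OF l\<rho>] linear_scale[OF l\<rho>])
  then have "Dv \<rho> (v - ?r *\<^sub>R e) z = 0" using \<rho>_e[OF z(1)] by simp
  then have "Dv F (v - ?r *\<^sub>R e) z = 0"
    using derivative_eq_0_of_vanishing[OF open_U z(1) smooth_on_continuous_on[OF smooth_\<rho>] d\<rho> z(2)
        \<rho>_e[OF z(1)] _ dF F(2)] by blast
  moreover have "Dv F (v - ?r *\<^sub>R e) z = Dv F v z - ?r *\<^sub>R Dv F e z"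
    by (simp only: linear_diff[OF lF] linear_scale[OF lF])
  ultimately show ?thesis by simp
qed

lemma Dv_of_real: "smooth_on U f \<Longrightarrow> z \<in> U \<Longrightarrow> Dv (\<lambda>z. complex_of_real (f z)) v z = of_real (Dv f v z)"
  by (rule Dv_eqI[OF has_derivative_of_real[OF smooth_on_has_derivative]])

lemma dZ_of_vanishing:
  assumes "smooth_on U F" "\<And>z. z \<in> U \<Longrightarrow> \<rho> z = 0 \<Longrightarrow> F z = 0" and z: "z \<in> U" "\<rho> z = 0"
  shows "dZ j F z = (Dv F e z / of_real (Dv \<rho> e z)) * dZ j \<rho>c z"
    "dZbar j F z = (Dv F e z / of_real (Dv \<rho> e z)) * dZbar j \<rho>c z"
proof -
  define r x y where "r = complex_of_real (Dv \<rho> e z)"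
    and "x = complex_of_real (Dv \<rho> (axis j 1) z)" and "y = complex_of_real (Dv \<rho> (axis j \<i>) z)"
  have "Dv F (axis j 1) z = x / r * Dv F e z" "Dv F (axis j \<i>) z = y / r * Dv F e z"
    unfolding r_def x_def y_def
    by (simp_all add: Dv_of_vanishing[OF assms, where v = "axis j _"] scaleR_conv_of_real)
  moreover have "Dv \<rho>c (axis j 1) z = x" "Dv \<rho>c (axis j \<i>) z = y"
    unfolding x_def y_def by (rule Dv_of_real[OF smooth_\<rho> z(1)])+
  ultimately show "dZ j F z = (Dv F e z / of_real (Dv \<rho> e z)) * dZ j \<rho>c z"
    "dZbar j F z = (Dv F e z / of_real (Dv \<rho> e z)) * dZbar j \<rho>c z"
    unfolding r_def[symmetric] by (simp_all add: dZ_def dZbar_def algebra_simps add_divide_distrib diff_divide_distrib)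
qed

lemma dZ_\<phi>:
  assumes "z \<in> U" "\<rho> z = 0"
  shows "dZ j \<phi>c z = a z * dZ j \<rho>c z" "dZbar j \<phi>c z = a z * dZbar j \<rho>c z"
proof -
  have "\<phi>c z = 0" if "z \<in> U" "\<rho> z = 0" for z using H_maps[OF that] by (simp add: \<phi>_def)
  from dZ_of_vanishing[OF smooth_c(2) this assms]
  show "dZ j \<phi>c z = a z * dZ j \<rho>c z" "dZbar j \<phi>c z = a z * dZbar j \<rho>c z"
    by (simp_all add: a_def Dv_of_real[OF smooth_\<phi> assms(1)])
qed

text \<open>The relation between the first derivatives of \<open>\<phi>\<close> and
  \<open>\<rho>\<close> holds on the level set only. The defect \<open>\<psi> j\<close> vanishes
  there, so its differential is a multiple of that of \<open>\<rho>\<close>; this is the origin of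
  \<open>\<beta>\<close>. Modulo \<open>a\<close>, two terms of rank one remain.\<close>

lemma hessian_\<phi>:
  assumes z: "z \<in> U" "\<rho> z = 0"
  shows "\<exists>\<beta>. \<forall>i j. dZ i (dZbar j \<phi>c) z = dZ i a z * dZbar j \<rho>c z + a z * dZ i (dZbar j \<rho>c) z + \<beta> j * dZ i \<rho>c z"
proof -
  define \<psi> where "\<psi> j z = dZbar j \<phi>c z + (- a z) * dZbar j \<rho>c z" for j z
  have sm: "smooth_on U (dZbar j \<phi>c)" "smooth_on U (dZbar j \<rho>c)" "smooth_on U (\<lambda>z. - a z)" for j
    by (intro smooth_on_dZbar smooth_on_minus open_U smooth_c smooth_a)+
  have \<psi>: "smooth_on U (\<psi> j)" for j
    unfolding \<psi>_def[abs_def] by (intro smooth_on_add smooth_on_mult open_U sm)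
  have "\<psi> j z = 0" if "z \<in> U" "\<rho> z = 0" for j z
    using dZ_\<phi>(2)[OF that] by (simp add: \<psi>_def)
  then have d: "dZ i (\<psi> j) z = (Dv (\<psi> j) e z / of_real (Dv \<rho> e z)) * dZ i \<rho>c z" for i j
    by (intro dZ_of_vanishing \<psi> z) auto
  have da: "dZ i (\<lambda>z. - a z) z = - dZ i a z" for i
    unfolding dZ_def Dv_eqI[OF has_derivative_minus[OF smooth_on_has_derivative[OF smooth_a z(1)]]]
    by (simp add: algebra_simps diff_divide_distrib add_divide_distrib)
  have "dZ i (\<psi> j) z = dZ i (dZbar j \<phi>c) z + (- dZ i a z * dZbar j \<rho>c z + (- a z) * dZ i (dZbar j \<rho>c) z)" for i j
  proof -
    have dd: "dZbar j \<phi>c differentiable (at z)" "dZbar j \<rho>c differentiable (at z)" "(\<lambda>z. - a z) differentiable (at z)"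
      using smooth_on_differentiable[OF _ z(1)] sm by blast+
    have "(\<lambda>z. (- a z) * dZbar j \<rho>c z) differentiable (at z)"
      using smooth_on_differentiable[OF smooth_on_mult[OF open_U sm(3) sm(2)] z(1)] .
    then show ?thesis
      unfolding \<psi>_def[abs_def] dZ_add[OF dd(1) \<open>(\<lambda>z. (- a z) * dZbar j \<rho>c z) differentiable (at z)\<close>]
        dZ_mult[OF dd(3,2)] da by simp
  qed
  then have "\<forall>i j. dZ i (dZbar j \<phi>c) z = dZ i a z * dZbar j \<rho>c z + a z * dZ i (dZbar j \<rho>c) z
      + (Dv (\<psi> j) e z / of_real (Dv \<rho> e z)) * dZ i \<rho>c z"
    using d by (simp add: algebra_simps)
  then show ?thesis by (intro exI[of _ "\<lambda>j. Dv (\<psi> j) e z / of_real (Dv \<rho> e z)"])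
qed

lemma H_in_U': "z \<in> U \<Longrightarrow> H z \<in> U'" using HU by blast

lemma chain_rule:
  assumes z: "z \<in> U"
  shows "dZ i \<phi>c z = (\<Sum>k\<in>UNIV. dZ k \<rho>'c (H z) * J i k z)"
    "dZbar j \<phi>c z = (\<Sum>l\<in>UNIV. dZbar l \<rho>'c (H z) * cnj (J j l z))"
    "dZ i (dZbar j \<phi>c) z = (\<Sum>k\<in>UNIV. \<Sum>l\<in>UNIV. dZ k (dZbar l \<rho>'c) (H z) * J i k z * cnj (J j l z))"
proof -
  have 1: "dZ i \<phi>c z = (\<Sum>k\<in>UNIV. dZ k \<rho>'c (H z) * J i k z)"
    and 2: "dZbar j \<phi>c z = (\<Sum>l\<in>UNIV. dZbar l \<rho>'c (H z) * cnj (J j l z))" if "z \<in> U" for z i j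
    unfolding \<phi>_def jac_def
    by (rule dZ_compose[OF smooth_on_differentiable[OF smooth_c(3) H_in_U'[OF that]] H that])+
  show "dZ i \<phi>c z = (\<Sum>k\<in>UNIV. dZ k \<rho>'c (H z) * J i k z)"
    "dZbar j \<phi>c z = (\<Sum>l\<in>UNIV. dZbar l \<rho>'c (H z) * cnj (J j l z))"
    using 1 2 z by auto
  have sm1: "smooth_on U (\<lambda>z. dZbar l \<rho>'c (H z))" for l
    by (rule smooth_compose_H[OF smooth_on_dZbar[OF open_U' smooth_c(3)]])
  have sm2: "smooth_on U (\<lambda>z. cnj (J j l z))" for l
    by (rule smooth_on_cnj[OF open_U hol_smooth_on[OF open_U hol_J]])
  note diff = smooth_on_differentiable[OF _ z]
  have "dZ i (dZbar j \<phi>c) z = dZ i (\<lambda>z. \<Sum>l\<in>UNIV. dZbar l \<rho>'c (H z) * cnj (J j l z)) z"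
    by (rule dZ_cong_open(1)[OF open_U z 2])
  also have "\<dots> = (\<Sum>l\<in>UNIV. dZ i (\<lambda>z. dZbar l \<rho>'c (H z) * cnj (J j l z)) z)"
    by (intro dZ_sum finite_class.finite_UNIV diff[OF smooth_on_mult[OF open_U sm1 sm2]])
  also have "\<dots> = (\<Sum>l\<in>UNIV. \<Sum>k\<in>UNIV. dZ k (dZbar l \<rho>'c) (H z) * J i k z * cnj (J j l z))"
  proof (rule sum.cong[OF refl])
    fix l
    \<comment> \<open>The conjugated Jacobian is antiholomorphic, so no second derivatives of
      \<open>H\<close> enter the Hessian.\<close>
    have "dZ i (\<lambda>z. cnj (J j l z)) z = 0"
      using dZ_cnj[OF hol_differentiable[OF hol_J z]] hol_dZbar[OF hol_J z] by simp
    moreover have "dZ i (\<lambda>z. dZbar l \<rho>'c (H z)) z = (\<Sum>k\<in>UNIV. dZ k (dZbar l \<rho>'c) (H z) * J i k z)"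
      unfolding jac_def
      by (rule dZ_compose(1)[OF smooth_on_differentiable[OF smooth_on_dZbar[OF open_U' smooth_c(3)] H_in_U'[OF z]] H z])
    ultimately show "dZ i (\<lambda>z. dZbar l \<rho>'c (H z) * cnj (J j l z)) z
      = (\<Sum>k\<in>UNIV. dZ k (dZbar l \<rho>'c) (H z) * J i k z * cnj (J j l z))"
      unfolding dZ_mult[OF diff[OF sm1] diff[OF sm2]] by (simp add: sum_distrib_right)
  qed
  finally show "dZ i (dZbar j \<phi>c) z = (\<Sum>k\<in>UNIV. \<Sum>l\<in>UNIV. dZ k (dZbar l \<rho>'c) (H z) * J i k z * cnj (J j l z))"
    by (subst sum.swap)
qed

text \<open>The matrix \<open>B\<close> is the Hessian of \<open>\<rho>'\<close> up to a term of rank \<open>d\<close> and terms that become divisible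
  by \<open>a\<close> when pulled back by \<open>H\<close>. Modulo \<open>a\<close> its pull-back is a sum of at most \<open>d + 2\<close> matrices of
  rank one, and by the hypothesis on \<open>d\<close> the bordered pull-back is singular modulo \<open>a\<close>.\<close>

lemma minors_divisible:
  fixes u u' :: "complex^'m" and k l :: "nat \<Rightarrow> complex^'m" and d :: nat
  defines "B \<equiv> \<lambda>w. \<chi> i j. dZ i (dZbar j \<rho>'c) w + dZ i \<rho>'c w * u $ j + u' $ i * dZbar j \<rho>'c w
      + (\<Sum>s<d. k s $ i * l s $ j)"
  assumes inj: "inj \<iota>" "inj \<kappa>" and count: "d + CARD('m) + 2 < 2 * CARD('n)"
    and B: "\<And>z. z \<in> U \<Longrightarrow> det (B (H z)) \<noteq> 0"
  shows "\<exists>h. smooth_on U h \<and> (\<forall>z\<in>U. \<rho> z = 0 \<longrightarrow> minor H \<iota> z * cnj (minor H \<kappa> z) = a z * h z)"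
proof -
  define Q where "Q z = transpose (frame H \<iota> z) ** B (H z) ** (\<chi> i j. cnj (frame H \<kappa> z $ i $ j))" for z
  \<comment> \<open>This collects the multiples of \<open>a\<close> in the Jacobian block of
    \<open>Q\<close>: the Hessian of \<rho> and the two terms of \<open>B\<close> with the
    differential of \<open>\<rho>'\<close>. The matrix \<open>A\<close> extends it by zero, and
    \<open>Q0\<close> is \<open>Q\<close> freed of these multiples.\<close>
  define R where "R i j z = dZ i (dZbar j \<rho>c) z + dZ i \<rho>c z * (\<Sum>q\<in>UNIV. u $ q * cnj (J j q z))
      + (\<Sum>p\<in>UNIV. u' $ p * J i p z) * dZbar j \<rho>c z" for i j z
  define A where "A z = (\<chi> c c'. if c \<in> range \<iota> \<and> c' \<in> range \<kappa> then R (inv \<iota> c) (inv \<kappa> c') z else 0)" for z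
  define Q0 where "Q0 z = (\<chi> c c'. Q z $ c $ c' - a z * A z $ c $ c')" for z
  have detQ: "det (Q z) = minor H \<iota> z * det (B (H z)) * cnj (minor H \<kappa> z)" for z
    by (simp add: Q_def det_mul det_transpose det_cnj minor_def)
  have Q_entry: "Q z $ c $ c' = (\<Sum>p\<in>UNIV. \<Sum>q\<in>UNIV. frame H \<iota> z $ p $ c * B (H z) $ p $ q * cnj (frame H \<kappa> z $ q $ c'))"
    for z c c'
  proof -
    have "Q z $ c $ c' = (\<Sum>q\<in>UNIV. \<Sum>p\<in>UNIV. frame H \<iota> z $ p $ c * B (H z) $ p $ q * cnj (frame H \<kappa> z $ q $ c'))"
      by (simp add: Q_def matrix_matrix_mult_def transpose_def sum_distrib_right)
    then show ?thesis by (subst sum.swap)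
  qed
  have smB: "smooth_on U (\<lambda>z. B (H z) $ p $ q)" for p q
    unfolding B_def
    by (simp, intro smooth_intros open_U smooth_compose_H smooth_on_dZ smooth_on_dZbar open_U' smooth_c)
  have smJ: "smooth_on U (J i p)" for i p by (rule hol_smooth_on[OF open_U hol_J])
  have smQ: "smooth_on U (\<lambda>z. Q z $ c $ c')" for c c'
    unfolding Q_entry by (intro smooth_intros open_U smB hol_smooth_on hol_frame H)
  have smR: "smooth_on U (R i j)" for i j
    unfolding R_def[abs_def] by (intro smooth_intros open_U smJ smooth_on_dZ smooth_on_dZbar smooth_c)
  have smA: "smooth_on U (\<lambda>z. A z $ c $ c')" for c c'
    unfolding A_def by (cases "c \<in> range \<iota> \<and> c' \<in> range \<kappa>") (auto intro: smR smooth_on_const)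
  have "smooth_cong U a (\<lambda>z. det (Q z)) (\<lambda>z. det (Q0 z))"
  proof (rule smooth_cong_det[OF open_U smooth_a])
    fix c c'
    have "smooth_on U (\<lambda>z. Q0 z $ c $ c')"
      unfolding Q0_def by (simp, intro smooth_intros open_U smQ smooth_a smA)
    then show "smooth_cong U a (\<lambda>z. Q z $ c $ c') (\<lambda>z. Q0 z $ c $ c')"
      unfolding smooth_cong_def by (intro conjI exI[of _ "\<lambda>z. A z $ c $ c'"]) (auto simp: Q0_def smA)
  qed
  then obtain h where h: "smooth_on U h" "\<forall>z\<in>U. det (Q z) = det (Q0 z) + a z * h z"
    unfolding smooth_cong_def by blast
  have det0: "det (Q0 z) = 0" if z: "z \<in> U" "\<rho> z = 0" for z
  proof -
    obtain \<beta> where \<beta>: "\<And>i j. dZ i (dZbar j \<phi>c) z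
        = dZ i a z * dZbar j \<rho>c z + a z * dZ i (dZbar j \<rho>c) z + \<beta> j * dZ i \<rho>c z"
      using hessian_\<phi>[OF z] by blast
    define K where "K s i = (\<Sum>p\<in>UNIV. k s $ p * J i p z)" for s i
    define L where "L s j = (\<Sum>q\<in>UNIV. l s $ q * cnj (J j q z))" for s j
    have block: "Q0 z $ \<iota> i $ \<kappa> j = dZ i a z * dZbar j \<rho>c z + dZ i \<rho>c z * \<beta> j + (\<Sum>s<d. K s i * L s j)" for i j
    proof -
      let ?J = "\<lambda>p. J i p z" and ?C = "\<lambda>q. cnj (J j q z)"
      have "Q z $ \<iota> i $ \<kappa> j = (\<Sum>p\<in>UNIV. \<Sum>q\<in>UNIV. ?J p * B (H z) $ p $ q * ?C q)"
        unfolding Q_entry using inj by (simp add: frame_def)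
      also have "\<dots> = (\<Sum>p\<in>UNIV. \<Sum>q\<in>UNIV. dZ p (dZbar q \<rho>'c) (H z) * ?J p * ?C q
          + (dZ p \<rho>'c (H z) * ?J p) * (u $ q * ?C q) + (u' $ p * ?J p) * (dZbar q \<rho>'c (H z) * ?C q)
          + (\<Sum>s<d. (k s $ p * ?J p) * (l s $ q * ?C q)))"
        by (intro sum.cong refl) (simp add: B_def algebra_simps sum_distrib_left)
      also have "\<dots> = dZ i (dZbar j \<phi>c) z + dZ i \<phi>c z * (\<Sum>q\<in>UNIV. u $ q * ?C q)
          + (\<Sum>p\<in>UNIV. u' $ p * ?J p) * dZbar j \<phi>c z
          + (\<Sum>p\<in>UNIV. \<Sum>q\<in>UNIV. \<Sum>s<d. (k s $ p * ?J p) * (l s $ q * ?C q))"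
        unfolding chain_rule[OF z(1)] by (simp add: sum.distrib sum_product)
      also have "(\<Sum>p\<in>UNIV. \<Sum>q\<in>UNIV. \<Sum>s<d. (k s $ p * ?J p) * (l s $ q * ?C q)) = (\<Sum>s<d. K s i * L s j)"
      proof -
        have "(\<Sum>s<d. K s i * L s j) = (\<Sum>s<d. \<Sum>p\<in>UNIV. \<Sum>q\<in>UNIV. (k s $ p * ?J p) * (l s $ q * ?C q))"
          by (simp add: K_def L_def sum_product)
        also have "\<dots> = (\<Sum>p\<in>UNIV. \<Sum>s<d. \<Sum>q\<in>UNIV. (k s $ p * ?J p) * (l s $ q * ?C q))"
          by (rule sum.swap)
        also have "\<dots> = (\<Sum>p\<in>UNIV. \<Sum>q\<in>UNIV. \<Sum>s<d. (k s $ p * ?J p) * (l s $ q * ?C q))"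
          by (intro sum.cong refl sum.swap)
        finally show ?thesis by simp
      qed
      finally have "Q z $ \<iota> i $ \<kappa> j = dZ i a z * dZbar j \<rho>c z + dZ i \<rho>c z * \<beta> j + a z * R i j z + (\<Sum>s<d. K s i * L s j)"
        unfolding \<beta> dZ_\<phi>[OF z] R_def by (simp add: algebra_simps)
      moreover have "A z $ \<iota> i $ \<kappa> j = R i j z" using inj by (simp add: A_def)
      ultimately show ?thesis by (simp add: Q0_def)
    qed
    \<comment> \<open>The conditions on a null vector supported on the columns in
      \<open>range \<kappa>\<close>: two from \<open>hessian_\<phi>\<close>, \<open>d\<close> from
      the added rank-one terms, and one for each row outside \<open>range \<iota>\<close>.\<close>
    define \<Phi> where "\<Phi> = {\<chi> j. dZbar j \<rho>c z, \<chi> j. \<beta> j} \<union> (\<lambda>s. \<chi> j. L s j) ` {..<d}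
        \<union> (\<lambda>c. \<chi> j. Q0 z $ c $ \<kappa> j) ` (- range \<iota>)"
    have fin: "finite \<Phi>" unfolding \<Phi>_def by simp
    have cr: "card (- range \<iota>) + CARD('n) = CARD('m)"
    proof -
      have "card (range \<iota>) = CARD('n)" using inj(1) by (simp add: card_image)
      moreover have "card (- range \<iota>) = CARD('m) - card (range \<iota>)" by (simp add: card_Diff_subset Compl_eq_Diff_UNIV)
      moreover have "card (range \<iota>) \<le> CARD('m)" by (simp add: card_mono)
      ultimately show ?thesis by simp
    qed
    have "card \<Phi> \<le> card {\<chi> j. dZbar j \<rho>c z, \<chi> j. \<beta> j} + card ((\<lambda>s. \<chi> j. L s j) ` {..<d})
        + card ((\<lambda>c. \<chi> j. Q0 z $ c $ \<kappa> j) ` (- range \<iota>))"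
      unfolding \<Phi>_def by (meson card_Un_le add_mono order_trans order_refl)
    also have "\<dots> \<le> 2 + d + card (- range \<iota>)"
    proof (intro add_mono)
      show "card {\<chi> j. dZbar j \<rho>c z, \<chi> j. \<beta> j} \<le> 2" by (simp add: card_insert_if)
      show "card ((\<lambda>s. \<chi> j. L s j) ` {..<d}) \<le> d" using card_image_le[of "{..<d}"] by simp
      show "card ((\<lambda>c. \<chi> j. Q0 z $ c $ \<kappa> j) ` (- range \<iota>)) \<le> card (- range \<iota>)" by (rule card_image_le) simp
    qed
    also have "\<dots> < CARD('n)" using cr count by linarith
    finally have "card \<Phi> < CARD('n)" .
    then obtain y :: "complex^'n" where y: "y \<noteq> 0" "\<forall>v\<in>\<Phi>. (\<Sum>j\<in>UNIV. v $ j * y $ j) = 0"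
      using common_kernel_nontrivial[OF fin] by blast
    have y1: "(\<Sum>j\<in>UNIV. dZbar j \<rho>c z * y $ j) = 0" using y(2) unfolding \<Phi>_def by force
    have y2: "(\<Sum>j\<in>UNIV. \<beta> j * y $ j) = 0" using y(2) unfolding \<Phi>_def by force
    have y3: "(\<Sum>j\<in>UNIV. L s j * y $ j) = 0" if "s < d" for s
    proof -
      have "(\<chi> j. L s j) \<in> \<Phi>" using that unfolding \<Phi>_def by blast
      then show ?thesis using y(2) by force
    qed
    have y4: "(\<Sum>j\<in>UNIV. Q0 z $ c $ \<kappa> j * y $ j) = 0" if "c \<notin> range \<iota>" for c
    proof -
      have "(\<chi> j. Q0 z $ c $ \<kappa> j) \<in> \<Phi>" using that unfolding \<Phi>_def by blast
      then show ?thesis using y(2) by force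
    qed
    have row: "(\<Sum>j\<in>UNIV. Q0 z $ c $ \<kappa> j * y $ j) = 0" for c
    proof (cases "c \<in> range \<iota>")
      case True
      then obtain i where i: "c = \<iota> i" by blast
      have "(\<Sum>j\<in>UNIV. Q0 z $ c $ \<kappa> j * y $ j) = (\<Sum>j\<in>UNIV. dZ i a z * (dZbar j \<rho>c z * y $ j)
          + dZ i \<rho>c z * (\<beta> j * y $ j) + (\<Sum>s<d. K s i * (L s j * y $ j)))"
        unfolding i block by (intro sum.cong refl) (simp add: algebra_simps sum_distrib_left)
      also have "\<dots> = dZ i a z * (\<Sum>j\<in>UNIV. dZbar j \<rho>c z * y $ j) + dZ i \<rho>c z * (\<Sum>j\<in>UNIV. \<beta> j * y $ j)
          + (\<Sum>j\<in>UNIV. \<Sum>s<d. K s i * (L s j * y $ j))"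
        by (simp add: sum.distrib sum_distrib_left)
      also have "(\<Sum>j\<in>UNIV. \<Sum>s<d. K s i * (L s j * y $ j)) = (\<Sum>s<d. K s i * (\<Sum>j\<in>UNIV. L s j * y $ j))"
        by (subst sum.swap) (simp add: sum_distrib_left)
      also have "\<dots> = 0" using y3 by simp
      finally show ?thesis using y1 y2 by simp
    qed (rule y4)
    define Y :: "complex^'m" where "Y = (\<chi> c. if c \<in> range \<kappa> then y $ inv \<kappa> c else 0)"
    have "Q0 z *v Y = 0"
    proof (subst vec_eq_iff, intro allI)
      fix c
      have "(Q0 z *v Y) $ c = (\<Sum>c'\<in>UNIV. Q0 z $ c $ c' * (if c' \<in> range \<kappa> then y $ inv \<kappa> c' else 0))"
        by (simp add: matrix_vector_mult_def Y_def)
      also have "\<dots> = (\<Sum>j\<in>UNIV. Q0 z $ c $ \<kappa> j * y $ j)" by (rule sum_range_extension[OF inj(2)])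
      finally show "(Q0 z *v Y) $ c = 0 $ c" using row by simp
    qed
    moreover have "Y \<noteq> 0"
    proof -
      obtain j where "y $ j \<noteq> 0" using y(1) by (auto simp: vec_eq_iff)
      then have "Y $ \<kappa> j \<noteq> 0" using inj(2) by (simp add: Y_def)
      then show ?thesis by auto
    qed
    ultimately show ?thesis using det_nonzero_iff_kernel by blast
  qed
  show ?thesis
  proof (intro exI[of _ "\<lambda>z. h z / det (B (H z))"] conjI ballI impI)
    show "smooth_on U (\<lambda>z. h z / det (B (H z)))"
      using B by (intro smooth_on_divide open_U h smooth_on_det smB)
    show "minor H \<iota> z * cnj (minor H \<kappa> z) = a z * (h z / det (B (H z)))" if "z \<in> U" "\<rho> z = 0" for z
    proof -
      have "minor H \<iota> z * det (B (H z)) * cnj (minor H \<kappa> z) = a z * h z"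
        using h(2) detQ[of z] det0[OF that] that by simp
      then show ?thesis using B[OF that(1)] by (simp add: field_simps)
    qed
  qed
qed

end

section \<open>Transversality\<close>

text \<open>One image vector outside the kernel of the differential of \<open>\<rho>'\<close> spans
  a complement of it, and kernel vectors are velocities by
  \<open>tangent_curve_exists\<close>.\<close>

lemma transversal_atI:
  assumes "local_defining_function M' q U' \<rho>'" "H p = q" "q \<in> M'" "H differentiable (at p)"
    and nz: "Dv \<rho>' (Dv H w p) q \<noteq> 0"
  shows "transversal_at H M' p"
proof -
  have U': "open U'" "q \<in> U'" "smooth_on U' \<rho>'" "M' \<inter> U' = {z \<in> U'. \<rho>' z = 0}"
    using assms(1) by (auto simp: local_defining_function_def)
  note d\<rho> = smooth_on_has_derivative[OF U'(3,2)]
  have l\<rho>: "linear (\<lambda>v. Dv \<rho>' v q)" using d\<rho> has_derivative_linear by blast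
  have lH: "linear (\<lambda>v. Dv H v p)" by (rule linear_frechet_derivative[OF assms(4)])
  have "\<exists>u w. y = u + Dv H w p \<and> u \<in> tangent_space M' (H p)" for y
  proof -
    let ?c = "Dv \<rho>' y q / Dv \<rho>' (Dv H w p) q"
    define u where "u = y - ?c *\<^sub>R Dv H w p"
    have "Dv \<rho>' u q = Dv \<rho>' y q - ?c *\<^sub>R Dv \<rho>' (Dv H w p) q"
      unfolding u_def by (simp only: linear_diff[OF l\<rho>] linear_scale[OF l\<rho>])
    then have "Dv \<rho>' u q = 0" using nz by simp
    moreover have "\<rho>' q = 0" using U' assms(3) by blast
    ultimately obtain \<gamma> where \<gamma>: "\<gamma> 0 = q" "\<forall>\<^sub>F t in nhds 0. \<gamma> t \<in> U' \<and> \<rho>' (\<gamma> t) = 0"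
      "(\<gamma> has_vector_derivative u) (at 0)"
      using tangent_curve_exists[OF U'(1,2) smooth_on_continuous_on[OF U'(3)] d\<rho> _ nz] by blast
    have "\<forall>\<^sub>F t in nhds 0. \<gamma> t \<in> M'"
      using \<gamma>(2) by eventually_elim (use U'(4) in blast)
    then have "u \<in> tangent_space M' (H p)" using \<gamma> assms(2) by (auto simp: tangent_space_def)
    moreover have "y = u + Dv H (?c *\<^sub>R w) p" by (simp add: u_def linear_scale[OF lH])
    ultimately show ?thesis by blast
  qed
  then show ?thesis using assms(2,3) unfolding transversal_at_def by blast
qed

section \<open>Regular points and the codimension of a germ\<close>

lemma germ_codim_ge_2D:
  fixes A :: "(complex^'n) set"
  assumes "germ_codim A p \<ge> 2"
  obtains W where "open W" "p \<in> W" "\<forall>q\<in>W. \<forall>d. regular_point A q d \<longrightarrow> CARD('n) - d > 1"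
proof -
  let ?S = "\<lambda>U. {enat (CARD('n) - d) | q d. q \<in> U \<and> regular_point A q d}"
  have "(1 :: enat) < 2" by (simp add: one_enat_def numeral_eq_enat)
  also have "2 \<le> Sup {Inf (?S U) | U. open U \<and> p \<in> U}" using assms by (simp add: germ_codim_def)
  finally obtain U where U: "open U" "p \<in> U" "1 < Inf (?S U)" unfolding less_Sup_iff by blast
  show thesis
  proof (rule that[OF U(1,2)], intro ballI allI impI)
    fix q d assume "q \<in> U" "regular_point A q d"
    then have "Inf (?S U) \<le> enat (CARD('n) - d)" by (intro Inf_lower) blast
    then have "1 < enat (CARD('n) - d)" using U(3) by (rule less_le_trans[rotated])
    then show "CARD('n) - d > 1" by (simp add: one_enat_def)
  qed
qed

lemma regular_point_localize:
  assumes "regular_point (A \<inter> S) q d" "open S" "q \<in> S"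
  shows "regular_point A q d"
proof -
  obtain U \<phi> L where U: "q \<in> A \<inter> S" "open U" "q \<in> U" "biholomorphic_on U \<phi>" "vec.subspace L" "vec.dim L = d"
    "\<phi> q = 0" "\<phi> ` (A \<inter> S \<inter> U) = \<phi> ` U \<inter> L"
    using assms(1) unfolding regular_point_def by blast
  have inj: "inj_on \<phi> U" using U(4) by (simp add: biholomorphic_on_def)
  have "\<phi> ` (A \<inter> (U \<inter> S)) = \<phi> ` (U \<inter> S) \<inter> L"
  proof -
    have "x \<in> A" if "x \<in> U" "x \<in> S" "\<phi> x \<in> L" for x
    proof -
      have "\<phi> x \<in> \<phi> ` (A \<inter> S \<inter> U)" using U(8) that by blast
      then obtain y where "y \<in> A" "y \<in> U" "\<phi> x = \<phi> y" by blast
      then show ?thesis using inj that by (metis inj_onD)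
    qed
    moreover have "\<phi> x \<in> L" if "x \<in> A" "x \<in> U" "x \<in> S" for x using U(8) that by blast
    ultimately show ?thesis by blast
  qed
  moreover have "biholomorphic_on (U \<inter> S) \<phi>"
    using U assms by (intro biholomorphic_on_subset[OF U(4)]) auto
  ultimately show ?thesis
    unfolding regular_point_def using U assms by (intro conjI exI[of _ "U \<inter> S"] exI[of _ \<phi>] exI[of _ L]) auto
qed

text \<open>Excludes the case of codimension 0, in which all minors would vanish near
  \<open>p\<close>.\<close>

lemma regular_point_interior:
  fixes A :: "(complex^'n) set"
  assumes "open S" "p \<in> S" "S \<subseteq> A"
  shows "regular_point A p CARD('n)"
proof -
  have "biholomorphic_on S (\<lambda>z. z - p)"
    unfolding biholomorphic_on_def
  proof (intro conjI)
    show op: "open ((\<lambda>z. z - p) ` S)" using open_translation_subtract[OF assms(1)] by simp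
    show "inj_on (\<lambda>z. z - p) S" by (simp add: inj_on_def)
    show "holomorphic_map_on S (\<lambda>z. z - p)"
      by (rule holomorphic_map_onI) (auto intro!: exI[of _ "\<lambda>v. v"] derivative_eq_intros)
    show "holomorphic_map_on ((\<lambda>z. z - p) ` S) (inv_into S (\<lambda>z. z - p))"
    proof (rule holomorphic_map_onI)
      fix y assume y: "y \<in> (\<lambda>z. z - p) ` S"
      have "((\<lambda>z. z + p) has_derivative (\<lambda>v. v)) (at y)" by (auto intro!: derivative_eq_intros)
      moreover have "x + p = inv_into S (\<lambda>z. z - p) x" if x: "x \<in> (\<lambda>z. z - p) ` S" for x
      proof -
        obtain z where z: "z \<in> S" "x = z - p" using x by blast
        have "inv_into S (\<lambda>z. z - p) (z - p) = z" by (rule inv_into_f_f) (auto simp: inj_on_def z)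
        then show ?thesis using z by simp
      qed
      ultimately have "(inv_into S (\<lambda>z. z - p) has_derivative (\<lambda>v. v)) (at y)"
        using has_derivative_transform_within_open[OF _ op y] by blast
      then show "\<exists>D. (inv_into S (\<lambda>z. z - p) has_derivative D) (at y) \<and> (\<forall>c v. D (c *s v) = c *s D v)"
        by blast
    qed
  qed
  moreover have "(\<lambda>z. z - p) ` (A \<inter> S) = (\<lambda>z. z - p) ` S \<inter> UNIV" using assms(3) by blast
  moreover have "vec.subspace (UNIV :: (complex^'n) set)" by (auto simp: vec.subspace_def)
  ultimately show ?thesis
    unfolding regular_point_def using assms vec_dim_card[where 'n = 'n and 'a = complex]
    by (intro conjI exI[of _ S] exI[of _ "\<lambda>z. z - p"] exI[of _ UNIV]) auto
qed

text \<open>A combination good on \<open>T\<close> is perturbed in one coefficient that matters at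
  the new point; only finitely many perturbations are bad. This replaces all minors by one function
  \<open>G\<close> whose norm can be taken.\<close>

lemma generic_linear_combination:
  fixes D :: "'i \<Rightarrow> 'a \<Rightarrow> complex"
  assumes "finite I" "finite T" "\<And>t. t \<in> T \<Longrightarrow> \<exists>i\<in>I. D i t \<noteq> 0"
  shows "\<exists>c. \<forall>t\<in>T. (\<Sum>i\<in>I. c i * D i t) \<noteq> 0"
  using assms(2,3)
proof (induction T rule: finite_induct)
  case (insert t0 T)
  then obtain c where c: "\<forall>t\<in>T. (\<Sum>i\<in>I. c i * D i t) \<noteq> 0" by blast
  obtain i0 where i0: "i0 \<in> I" "D i0 t0 \<noteq> 0" using insert.prems by blast
  let ?s = "\<lambda>t. \<Sum>i\<in>I. c i * D i t"
  have "finite ((\<lambda>t. - ?s t / D i0 t) ` insert t0 T \<union> {0})" using insert.hyps(1) by simp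
  then obtain \<tau> where \<tau>: "\<tau> \<notin> (\<lambda>t. - ?s t / D i0 t) ` insert t0 T \<union> {0}"
    using ex_new_if_finite[OF infinite_UNIV_char_0] by blast
  have sum: "(\<Sum>i\<in>I. (c(i0 := c i0 + \<tau>)) i * D i t) = ?s t + \<tau> * D i0 t" for t
  proof -
    have "(\<Sum>i\<in>I. (c(i0 := c i0 + \<tau>)) i * D i t) = (\<Sum>i\<in>I. c i * D i t + (if i = i0 then \<tau> * D i0 t else 0))"
      by (intro sum.cong) (auto simp: algebra_simps)
    then show ?thesis using assms(1) i0 by (simp add: sum.distrib)
  qed
  have "?s t + \<tau> * D i0 t \<noteq> 0" if "t \<in> insert t0 T" for t
  proof (cases "D i0 t = 0")
    case True
    then show ?thesis using that c i0 by auto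
  next
    case False
    have "\<tau> \<noteq> - ?s t / D i0 t" using \<tau> that by blast
    show ?thesis
    proof
      assume "?s t + \<tau> * D i0 t = 0"
      then have "\<tau> * D i0 t = - ?s t" by (simp add: eq_neg_iff_add_eq_0 add.commute)
      with nonzero_eq_divide_eq[OF False, of \<tau> "- ?s t"] have "\<tau> = - ?s t / D i0 t" by (rule iffD2)
      then show False using \<open>\<tau> \<noteq> _\<close> by blast
    qed
  qed
  then show ?case using sum by (intro exI[of _ "c(i0 := c i0 + \<tau>)"]) simp
qed simp

lemma open_superlevel: "hol S f \<Longrightarrow> open S \<Longrightarrow> open {z \<in> S. f z \<noteq> 0}"
proof -
  assume f: "hol S f" and S: "open S"
  have "open (S \<inter> f -` (- {0}))"
    by (intro continuous_open_preimage[OF hol_continuous_on[OF f] S]) auto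
  moreover have "{z \<in> S. f z \<noteq> 0} = S \<inter> f -` (- {0})" by auto
  ultimately show ?thesis by simp
qed

lemma isolated_zero_disc:
  assumes f: "f holomorphic_on ball 0 R" and w: "w \<in> ball 0 R" "f w \<noteq> 0" and r: "0 < r" "r \<le> R"
  obtains \<epsilon> where "0 < \<epsilon>" "\<epsilon> < r" "\<forall>t. 0 < cmod t \<longrightarrow> cmod t \<le> \<epsilon> \<longrightarrow> f t \<noteq> 0"
proof -
  have R: "(0::complex) \<in> ball 0 R" using r by simp
  obtain s where s: "s > 0" "\<And>t. t \<in> ball 0 s - {0} \<Longrightarrow> f t \<noteq> 0"
  proof (cases "f 0 = 0")
    case True
    then show ?thesis
      using isolated_zeros[OF f open_ball convex_connected[OF convex_ball] R True w] that by metis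
  next
    case False
    have "isCont f 0" using holomorphic_on_imp_continuous_on[OF f] R continuous_on_eq_continuous_at[OF open_ball] by blast
    then obtain s where "s > 0" "\<forall>y. dist 0 y < s \<longrightarrow> f y \<noteq> 0"
      using continuous_at_avoid[of 0 f 0] False by blast
    then show ?thesis using that[of s] by auto
  qed
  show thesis
    by (rule that[of "min s r / 2"]) (use s r in auto)
qed

context hypersurface_map
begin

text \<open>If the common zeros of the minors miss a fibre near \<open>p\<close>, then some power of the coordinate \<open>x\<close> on
  the slice through this fibre lies in the ideal of the minors, so \<open>a\<close> divides
  \<open>(x cnj x)\<^sup>k\<close> on the level set of \<open>\<rho>\<close>.\<close>

lemma a_nonzero_of_empty_fibre:
  assumes fz: "fibre_zeros U B (minor H \<iota>0) e \<eta> R" and B: "convex B" "p \<in> B" "Z \<in> B"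
    and p: "\<rho> p = 0" and \<iota>0: "inj \<iota>0"
    and isolated: "\<And>t. 0 < cmod t \<Longrightarrow> cmod t < \<eta> \<Longrightarrow> minor H \<iota>0 (p + t *s e) \<noteq> 0"
    and dvd: "\<And>\<iota> \<kappa>. inj \<iota> \<Longrightarrow> inj \<kappa> \<Longrightarrow>
      \<exists>h. smooth_on U h \<and> (\<forall>z\<in>U. \<rho> z = 0 \<longrightarrow> minor H \<iota> z * cnj (minor H \<kappa> z) = a z * h z)"
    and empty: "\<And>t. cmod t < \<eta> \<Longrightarrow> \<exists>\<iota>. inj \<iota> \<and> minor H \<iota> (Z + t *s e) \<noteq> 0"
  shows "a p \<noteq> 0"
proof -
  interpret fibre_zeros U B "minor H \<iota>0" e \<eta> R by (rule fz)
  define I where "I = {\<iota> :: 'n \<Rightarrow> 'm. inj \<iota>}"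
  have finI: "finite I" by simp
  have m: "hol U (minor H \<iota>)" for \<iota> by (rule hol_minor[OF open_U H])
  define hh where "hh \<iota> \<kappa> = (SOME h. smooth_on U h \<and>
      (\<forall>z\<in>U. \<rho> z = 0 \<longrightarrow> minor H \<iota> z * cnj (minor H \<kappa> z) = a z * h z))" for \<iota> \<kappa>
  have hh: "smooth_on U (hh \<iota> \<kappa>)"
    "\<And>z. z \<in> U \<Longrightarrow> \<rho> z = 0 \<Longrightarrow> minor H \<iota> z * cnj (minor H \<kappa> z) = a z * hh \<iota> \<kappa> z"
    if "\<iota> \<in> I" "\<kappa> \<in> I" for \<iota> \<kappa>
    using someI_ex[OF dvd[of \<iota> \<kappa>]] that unfolding hh_def I_def by auto
  define v where "v = Z - p"
  define A where "A z = p + z $ 1 *s v + z $ 2 *s e" for z :: "complex^2"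
  have "\<exists>c. \<forall>t\<in>zeros Z. (\<Sum>\<iota>\<in>I. c \<iota> * minor H \<iota> (Z + t *s e)) \<noteq> 0"
    using empty by (intro generic_linear_combination finI finite_zeros B) (auto simp: I_def zeros_def)
  then obtain c where c: "\<forall>t\<in>zeros Z. (\<Sum>\<iota>\<in>I. c \<iota> * minor H \<iota> (Z + t *s e)) \<noteq> 0" by blast
  define G where "G z = (\<Sum>\<iota>\<in>I. c \<iota> * minor H \<iota> z)" for z
  have G: "hol U G" unfolding G_def[abs_def] by (intro hol_intros m)
  define D where "D = {x. p + x *s v \<in> B}"
  define V where "V = {z :: complex^2. p + z $ 1 *s v \<in> B \<and> cmod (z $ 2) < \<eta>}"
  obtain \<alpha> \<beta> r where r: "hol V \<alpha>" "hol V \<beta>" "r holomorphic_on D"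
    "\<And>x. x \<in> D \<Longrightarrow> r x \<noteq> 0 \<longleftrightarrow> (\<forall>t\<in>zeros (p + x *s v). G (p + x *s v + t *s e) \<noteq> 0)"
    "\<And>z. z \<in> V \<Longrightarrow> r (z $ 1) = minor H \<iota>0 (A z) * \<alpha> z + G (A z) * \<beta> z"
    unfolding D_def V_def A_def by (rule norm_on_slice[OF G convex_connected[OF B(1)], of p v]) blast
  have contp: "continuous_on UNIV (\<lambda>x. p + x *s v)"
    by (intro continuous_intros bounded_linear.continuous_on[OF bounded_linear_vector_scale])
  have openD: "open D"
    using continuous_on_open_vimage[of UNIV "\<lambda>x. p + x *s v"] contp open_B by (auto simp: D_def vimage_def)
  have "convex D"
    unfolding convex_def
  proof (intro ballI allI impI)
    fix x y and u w :: real
    assume x: "x \<in> D" "y \<in> D" "0 \<le> u" "0 \<le> w" "u + w = 1"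
    have "u *\<^sub>R (p + x *s v) + w *\<^sub>R (p + y *s v) = (u + w) *\<^sub>R p + (u *\<^sub>R x + w *\<^sub>R y) *s v"
      by (simp add: vec_eq_iff algebra_simps)
    then have "p + (u *\<^sub>R x + w *\<^sub>R y) *s v = u *\<^sub>R (p + x *s v) + w *\<^sub>R (p + y *s v)"
      using x(5) by simp
    also have "\<dots> \<in> B" using x by (intro convexD[OF B(1)]) (auto simp: D_def)
    finally show "u *\<^sub>R x + w *\<^sub>R y \<in> D" by (simp add: D_def)
  qed
  then have connD: "connected D" by (rule convex_connected)
  have D01: "0 \<in> D" "1 \<in> D" using B by (auto simp: D_def v_def)
  \<comment> \<open>The parameter 0 is the fibre through \<open>p\<close> and 1 the one through
    \<open>Z\<close>. Nonvanishing at 1 gives \<open>r\<close> a finite order \<open>k\<close> at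
    0.\<close>
  have "r 1 \<noteq> 0" using r(4)[OF D01(2)] c by (simp add: v_def G_def)
  then have nz: "\<exists>w\<in>D. r w \<noteq> 0" using D01 by blast
  obtain s g k where s: "s > 0" "cball 0 s \<subseteq> D" "g holomorphic_on cball 0 s"
    "\<forall>w\<in>cball 0 s. r w = g w * w ^ k \<and> g w \<noteq> 0"
    using zorder_exist_zero[OF r(3) openD connD D01(1) nz] by auto
  define W where "W = V \<inter> {z. cmod (z $ 1) < s}"
  have contA1: "continuous_on UNIV (\<lambda>z :: complex^2. p + z $ 1 *s v)"
    by (intro continuous_intros bounded_linear.continuous_on[OF bounded_linear_vector_scale])
  have openV: "open V"
  proof -
    have "open ((\<lambda>z :: complex^2. p + z $ 1 *s v) -` B)"
      using contA1 open_B by (simp add: continuous_on_open_vimage)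
    moreover have "open {z :: complex^2. cmod (z $ 2) < \<eta>}"
      by (intro open_Collect_less continuous_intros)
    moreover have "V = ((\<lambda>z. p + z $ 1 *s v) -` B) \<inter> {z. cmod (z $ 2) < \<eta>}"
      by (auto simp: V_def)
    ultimately show ?thesis by auto
  qed
  have W: "open W" "0 \<in> W" "W \<subseteq> V"
  proof -
    have "open {z :: complex^2. cmod (z $ 1) < s}"
      by (intro open_Collect_less continuous_intros)
    then show "open W" using openV by (auto simp: W_def)
    show "0 \<in> W" using B s \<eta> by (simp add: W_def V_def)
  qed (auto simp: W_def)
  have AU: "A z \<in> U" if "z \<in> W" for z
    using that \<eta> unfolding A_def by (intro fibre) (auto simp: W_def V_def)
  have smA: "smooth_on W A"
    unfolding A_def[abs_def]
    by (intro smooth_on_add smooth_on_const smooth_on_linear W bounded_linear_vector_scale_nth)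
  have cA: "smooth_on W (\<lambda>z. F (A z))" if "smooth_on U F" for F :: "complex^'n \<Rightarrow> 'b::real_normed_vector"
    using AU by (intro smooth_on_compose[OF W(1) that smA]) auto
  define g2 where "g2 z = g (z $ 1)" for z :: "complex^2"
  have g2: "hol W g2"
    unfolding hol_def
  proof
    fix z assume "z \<in> W"
    then have "z $ 1 \<in> ball 0 s" by (simp add: W_def)
    then have "(g has_field_derivative deriv g (z $ 1)) (at (z $ 1))"
      using s(3) by (meson ball_subset_cball holomorphic_derivI holomorphic_on_subset open_ball)
    then have "(g2 has_derivative (\<lambda>h. deriv g (z $ 1) * h $ 1)) (at z)"
      unfolding g2_def[abs_def] has_field_derivative_def
      by (rule has_derivative_compose[OF bounded_linear_imp_has_derivative[OF bounded_linear_vec_nth]])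
    then show "\<exists>D. (g2 has_derivative D) (at z) \<and> (\<forall>c v. D (c *s v) = c * D v)"
      by (auto intro!: exI[of _ "\<lambda>h. deriv g (z $ 1) * h $ 1"])
  qed
  \<comment> \<open>Coefficients of \<open>r\<close> in terms of all minors: \<open>G\<close>
    contributes \<open>c \<iota> * \<beta>\<close>, and \<open>\<iota>0\<close> has the additional
    \<open>\<alpha>\<close>.\<close>
  define \<gamma> where "\<gamma> \<iota> z = c \<iota> * \<beta> z + (if \<iota> = \<iota>0 then \<alpha> z else 0)" for \<iota> z
  have sm\<gamma>: "smooth_on W (\<gamma> \<iota>)" for \<iota>
  proof -
    have "smooth_on W \<alpha>" "smooth_on W \<beta>"
      using hol_smooth_on[OF W(1)] hol_subset[OF _ W(3)] r(1,2) by blast+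
    then show ?thesis
      unfolding \<gamma>_def[abs_def] by (cases "\<iota> = \<iota>0") (auto intro!: smooth_on_add smooth_on_mult smooth_on_const W)
  qed
  have r_sum: "r (z $ 1) = (\<Sum>\<iota>\<in>I. \<gamma> \<iota> z * minor H \<iota> (A z))" if "z \<in> W" for z
  proof -
    have "(\<Sum>\<iota>\<in>I. \<gamma> \<iota> z * minor H \<iota> (A z))
      = (\<Sum>\<iota>\<in>I. c \<iota> * minor H \<iota> (A z) * \<beta> z + (if \<iota> = \<iota>0 then minor H \<iota>0 (A z) * \<alpha> z else 0))"
      by (intro sum.cong) (auto simp: \<gamma>_def algebra_simps)
    also have "\<dots> = G (A z) * \<beta> z + minor H \<iota>0 (A z) * \<alpha> z"
      using finI \<iota>0 by (simp add: sum.distrib G_def sum_distrib_right I_def)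
    finally show ?thesis using r(5)[of z] that W(3) by auto
  qed
  define h where "h z = (\<Sum>\<iota>\<in>I. \<Sum>\<kappa>\<in>I. \<gamma> \<iota> z * cnj (\<gamma> \<kappa> z) * hh \<iota> \<kappa> (A z))" for z
  have h: "smooth_on W h"
    unfolding h_def[abs_def] using hh(1)
    by (intro smooth_on_sum smooth_on_mult smooth_on_cnj W sm\<gamma> cA) auto
  have ag: "a (A z) * h z = (z $ 1 * cnj (z $ 1)) ^ k * (g2 z * cnj (g2 z))"
    if z: "z \<in> W" "\<rho> (A z) = 0" for z
  proof -
    have "a (A z) * h z = (\<Sum>\<iota>\<in>I. \<Sum>\<kappa>\<in>I. (\<gamma> \<iota> z * minor H \<iota> (A z)) * cnj (\<gamma> \<kappa> z * minor H \<kappa> (A z)))"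
      unfolding h_def sum_distrib_left
    proof (intro sum.cong refl)
      fix \<iota> \<kappa> assume "\<iota> \<in> I" "\<kappa> \<in> I"
      from hh(2)[OF this AU[OF z(1)] z(2)]
      have e: "a (A z) * hh \<iota> \<kappa> (A z) = minor H \<iota> (A z) * cnj (minor H \<kappa> (A z))" by simp
      have "a (A z) * (\<gamma> \<iota> z * cnj (\<gamma> \<kappa> z) * hh \<iota> \<kappa> (A z))
          = \<gamma> \<iota> z * cnj (\<gamma> \<kappa> z) * (a (A z) * hh \<iota> \<kappa> (A z))" by (simp only: mult_ac)
      then show "a (A z) * (\<gamma> \<iota> z * cnj (\<gamma> \<kappa> z) * hh \<iota> \<kappa> (A z))
          = (\<gamma> \<iota> z * minor H \<iota> (A z)) * cnj (\<gamma> \<kappa> z * minor H \<kappa> (A z))"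
        unfolding e complex_cnj_mult by (simp only: mult_ac)
    qed
    also have "\<dots> = r (z $ 1) * cnj (r (z $ 1))"
      unfolding r_sum[OF z(1)] by (simp only: sum_product cnj_sum)
    also have "\<dots> = (z $ 1 * cnj (z $ 1)) ^ k * (g2 z * cnj (g2 z))"
      using s(4)[rule_format, of "z $ 1"] z(1) by (simp add: W_def g2_def power_mult_distrib mult_ac)
    finally show ?thesis .
  qed
  have A0: "A 0 = p" by (simp add: A_def)
  have "(\<lambda>z. a (A z)) 0 \<noteq> 0"
  proof (rule nonzero_at_0_of_dvd_coordinate_power[OF W(1,2), where \<rho> = "\<lambda>z. \<rho> (A z)" and g = h
        and u = "\<lambda>z. g2 z * cnj (g2 z)" and k = k])
    show "smooth_on W (\<lambda>z. \<rho> (A z))" by (rule cA[OF smooth_\<rho>])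
    show "\<rho> (A 0) = 0" using A0 p by simp
    show "Dv (\<lambda>z. \<rho> (A z)) (axis 2 1) z \<noteq> 0" if "z \<in> W" for z
    proof -
      have "(A has_derivative (\<lambda>h. 0 + h $ 1 *s v + h $ 2 *s e)) (at z)"
        unfolding A_def[abs_def]
        by (intro has_derivative_add has_derivative_const
            bounded_linear_imp_has_derivative[OF bounded_linear_vector_scale_nth])
      from Dv_eqI[OF has_derivative_compose[OF this smooth_on_has_derivative[OF smooth_\<rho> AU[OF that]]]]
      have "Dv (\<lambda>z. \<rho> (A z)) (axis 2 1) z = Dv \<rho> e (A z)" by (simp add: axis_def)
      then show ?thesis using \<rho>_e[OF AU[OF that]] by simp
    qed
    show "smooth_on W (\<lambda>z. a (A z))" by (rule cA[OF smooth_a])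
    show "smooth_on W (\<lambda>z. g2 z * cnj (g2 z))"
      by (intro smooth_on_mult smooth_on_cnj W hol_smooth_on g2)
    show "g2 0 * cnj (g2 0) \<noteq> 0" using s by (simp add: g2_def)
    show "a (A z) * h z = (z $ 1 * cnj (z $ 1)) ^ k * (g2 z * cnj (g2 z))" if "z \<in> W" "\<rho> (A z) = 0" for z
      by (rule ag[OF that])
    show "a (A z) \<noteq> 0" if z: "z \<in> W" "\<rho> (A z) = 0" "z $ 1 = 0" "z \<noteq> 0" for z
    proof -
      \<comment> \<open>On the fibre through \<open>p\<close> but away from \<open>p\<close> the
        minor of \<open>\<iota>0\<close> is nonzero, and its squared modulus is a multiple of
        \<open>a\<close>.\<close>
      have "z $ 2 \<noteq> 0" using z(3,4) by (auto simp: vec_eq_iff forall_2)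
      then have "minor H \<iota>0 (p + z $ 2 *s e) \<noteq> 0" using z(1) by (intro isolated) (auto simp: W_def V_def)
      then have "minor H \<iota>0 (A z) \<noteq> 0" using z(3) by (simp add: A_def)
      then show ?thesis
        using hh(2)[of \<iota>0 \<iota>0 "A z"] \<iota>0 AU[OF z(1)] z(2) by (auto simp: I_def)
    qed
  qed (rule h)
  then show ?thesis using A0 by simp
qed

end

theorem theorem1p1:
  fixes M \<Omega> :: "(complex^'n) set" and M' U' :: "(complex^'m) set"
    and H :: "complex^'n \<Rightarrow> complex^'m"
    and p :: "complex^'n" and p' :: "complex^'m"
    and \<rho>' :: "complex^'m \<Rightarrow> real"
    and n N r :: nat
  assumes "CARD('n) = n + 1" and "CARD('m) = N + 1"
    and "smooth_real_hypersurface M" and "p \<in> M"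
    and "smooth_real_hypersurface M'" and "p' \<in> M'"
    and "open \<Omega>" and "p \<in> \<Omega>" and "holomorphic_map_on \<Omega> H" and "H p = p'"
    and "\<exists>V. open V \<and> p \<in> V \<and> H ` (M \<inter> V) \<subseteq> M'"
    and "local_defining_function M' p' U' \<rho>'" and "r = levi_rank \<rho>' p'"
    and "2 * int N - int r \<le> 2 * int n - 2"
    and "germ_codim (degeneracy_locus \<Omega> H) p \<ge> 2"
  shows "transversal_at H M' p"
proof (rule ccontr)
  assume nt: "\<not> transversal_at H M' p"
  define X where "X = degeneracy_locus \<Omega> H"
  have U': "open U'" "p' \<in> U'" "smooth_on U' \<rho>'" "M' \<inter> U' = {z \<in> U'. \<rho>' z = 0}"
    "\<forall>z\<in>M' \<inter> U'. \<exists>v. Dv \<rho>' v z \<noteq> 0"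
    using assms(12) by (auto simp: local_defining_function_def)
  obtain V where V: "open V" "p \<in> V" "H ` (M \<inter> V) \<subseteq> M'" using assms(11) by blast
  obtain U1 \<rho> where "local_defining_function M p U1 \<rho>"
    using assms(3,4) unfolding smooth_real_hypersurface_def by blast
  then have U1: "open U1" "p \<in> U1" "smooth_on U1 \<rho>" "M \<inter> U1 = {z \<in> U1. \<rho> z = 0}"
    "\<forall>z\<in>M \<inter> U1. \<exists>v. Dv \<rho> v z \<noteq> 0"
    by (auto simp: local_defining_function_def)
  have \<rho>p: "\<rho> p = 0" using U1(2,4) assms(4) by blast
  obtain v0 where v0: "Dv \<rho> v0 p \<noteq> 0" using U1(2,5) assms(4) by blast
  obtain W where W: "open W" "p \<in> W" "\<forall>q\<in>W. \<forall>d. regular_point X q d \<longrightarrow> CARD('n) - d > 1"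
    by (rule germ_codim_ge_2D[OF assms(15)[folded X_def]])
  have dH: "H differentiable (at z)" if "z \<in> \<Omega>" for z
    using assms(9) that unfolding holomorphic_map_on_def differentiable_def by blast
  have contH: "continuous_on \<Omega> H"
    by (simp add: continuous_at_imp_continuous_on differentiable_imp_continuous_within dH)
  \<comment> \<open>Without transversality the image of the differential of \<open>H\<close> lies in
    the kernel of that of \<open>\<rho>'\<close>; this will give \<open>a p = 0\<close>.\<close>
  have dH0: "Dv \<rho>' (Dv H w p) p' = 0" for w
    using transversal_atI[where H = H and p = p, OF assms(12,10,6) dH[OF assms(8)]] nt by blast

  define \<nu> where "\<nu> = (\<chi> j. dZ j (\<lambda>z. of_real (\<rho>' z)) p')"
  have d\<rho>': "\<rho>' differentiable (at p')" by (rule smooth_on_differentiable[OF U'(3,2)])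
  have \<nu>bar: "dZbar j (\<lambda>z. of_real (\<rho>' z)) p' = cnj (\<nu> $ j)" for j
    by (simp add: \<nu>_def dZbar_of_real[OF d\<rho>'])
  have "\<nu> \<noteq> 0"
  proof
    assume \<nu>: "\<nu> = 0"
    obtain v where v: "Dv \<rho>' v p' \<noteq> 0" using U'(2,5) assms(6) by blast
    have diff: "(\<lambda>z. complex_of_real (\<rho>' z)) differentiable (at p')"
      using has_derivative_of_real[OF Dv_works[OF d\<rho>']] by (auto simp: differentiable_def)
    have "Dv (\<lambda>z. complex_of_real (\<rho>' z)) v p' = 0"
      using \<nu>bar \<nu> unfolding wirtinger_expansion[OF diff] by (simp add: \<nu>_def vec_eq_iff)
    moreover have "Dv (\<lambda>z. complex_of_real (\<rho>' z)) v p' = of_real (Dv \<rho>' v p')"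
      by (rule Dv_eqI[OF has_derivative_of_real[OF Dv_works[OF d\<rho>']]])
    ultimately show False using v by simp
  qed
  have rank: "levi_rank \<rho>' p' = form_rank {c. (\<Sum>j\<in>UNIV. \<nu> $ j * c $ j) = 0}
      (\<lambda>c d. \<Sum>i\<in>UNIV. \<Sum>j\<in>UNIV. complex_hessian \<rho>' p' $ i $ j * c $ i * cnj (d $ j))"
    by (simp add: levi_rank_def holomorphic_tangent_space_def \<nu>_def levi_form_def[abs_def])
  note completion = hyperplane_form_completion[OF \<open>\<nu> \<noteq> 0\<close> assms(2), of "complex_hessian \<rho>' p'",
      folded rank assms(13)]
  have rN: "r \<le> N" by (rule completion(1))
  obtain u u' :: "complex^'m" and k l :: "nat \<Rightarrow> complex^'m"
    where det: "det (\<chi> i j. complex_hessian \<rho>' p' $ i $ j + \<nu> $ i * u $ j + u' $ i * cnj (\<nu> $ j)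
      + (\<Sum>s<N - r. k s $ i * l s $ j)) \<noteq> 0"
    using completion(2) by blast
  \<comment> \<open>The completion is found at \<open>p'\<close> only. With constant
    \<open>u\<close>, \<open>u'\<close>, \<open>k\<close>, \<open>l\<close> it varies smoothly with
    \<open>w\<close> and stays invertible near \<open>p'\<close>.\<close>
  define B where "B w = (\<chi> i j. dZ i (dZbar j (\<lambda>z. of_real (\<rho>' z))) w + dZ i (\<lambda>z. of_real (\<rho>' z)) w * u $ j
      + u' $ i * dZbar j (\<lambda>z. of_real (\<rho>' z)) w + (\<Sum>s<N - r. k s $ i * l s $ j))" for w
  have Bp: "det (B p') \<noteq> 0"
    using det unfolding B_def \<nu>bar by (simp add: complex_hessian_def \<nu>_def)
  have c\<rho>': "smooth_on U' (\<lambda>z. complex_of_real (\<rho>' z))" by (rule smooth_on_of_real[OF U'(1,3)])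
  have smB: "smooth_on U' (\<lambda>w. det (B w))"
    by (rule smooth_on_det[OF U'(1)]) (simp add: B_def, intro smooth_intros U'(1) smooth_on_dZ smooth_on_dZbar c\<rho>')
  have openB: "open {w \<in> U'. det (B w) \<noteq> 0}"
  proof -
    have "open (U' \<inter> (\<lambda>w. det (B w)) -` (- {0}))"
      by (intro continuous_open_preimage[OF smooth_on_continuous_on[OF smB] U'(1)]) auto
    moreover have "{w \<in> U'. det (B w) \<noteq> 0} = U' \<inter> (\<lambda>w. det (B w)) -` (- {0})" by auto
    ultimately show ?thesis by simp
  qed

  define S0 where "S0 = W \<inter> U1 \<inter> V \<inter> (\<Omega> \<inter> H -` {w \<in> U'. det (B w) \<noteq> 0})"
  have "open S0"
    unfolding S0_def using W(1) U1(1) V(1) continuous_open_preimage[OF contH assms(7) openB] by auto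
  moreover have "p \<in> S0" using W U1 V assms(8,10) U'(2) Bp by (auto simp: S0_def)
  ultimately obtain R0 where R0: "R0 > 0" "ball p R0 \<subseteq> S0" using open_contains_ball by blast
  have hH: "holomorphic_map_on (ball p R0) H"
    using assms(9) R0(2) by (auto simp: holomorphic_map_on_def S0_def subset_iff)
  have XR0: "z \<in> X \<longleftrightarrow> (\<forall>\<iota>. inj \<iota> \<longrightarrow> minor H \<iota> z = 0)" if "z \<in> ball p R0" for z
    using rank_less_iff_minors_vanish[OF open_ball hH that] that R0(2)
    by (auto simp: X_def degeneracy_locus_def S0_def)
  have hm: "hol (ball p R0) (minor H \<iota>)" for \<iota> by (rule hol_minor[OF open_ball hH])

  have "\<exists>q\<in>ball p R0. q \<notin> X"
  proof (rule ccontr)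
    assume "\<not> (\<exists>q\<in>ball p R0. q \<notin> X)"
    then have "regular_point X p CARD('n)"
      using R0(1) by (intro regular_point_interior[OF open_ball]) auto
    then show False using W(2,3) by fastforce
  qed
  then obtain \<iota>0 q0 where \<iota>0: "inj \<iota>0" and q0: "q0 \<in> ball p R0" "minor H \<iota>0 q0 \<noteq> 0"
    using XR0 by blast
  have l\<rho>: "linear (\<lambda>v. Dv \<rho> v p)"
    using smooth_on_has_derivative[OF U1(3,2)] has_derivative_linear by blast
  \<comment> \<open>The line from \<open>p\<close> to \<open>q1\<close> has to be transversal to
    \<open>M\<close>, while the minor does not vanish identically on it. If \<open>q0 - p\<close> is
    tangent, a small shift along \<open>v0\<close> preserves the second property and achieves the
    first.\<close>
  obtain q1 where q1: "q1 \<in> ball p R0" "minor H \<iota>0 q1 \<noteq> 0" "Dv \<rho> (q1 - p) p \<noteq> 0"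
  proof (cases "Dv \<rho> (q0 - p) p = 0")
    case False
    then show ?thesis using that q0 by blast
  next
    case True
    obtain s where s: "s > 0" "ball q0 s \<subseteq> {z \<in> ball p R0. minor H \<iota>0 z \<noteq> 0}"
      using open_superlevel[OF hm open_ball] q0 open_contains_ball by blast
    define \<tau> where "\<tau> = s / (2 * (norm v0 + 1))"
    have pos: "norm v0 + 1 > 0" by (simp add: add_nonneg_pos)
    have \<tau>: "\<tau> > 0" unfolding \<tau>_def using s(1) pos by simp
    have "\<tau> * norm v0 \<le> \<tau> * (norm v0 + 1)" using \<tau> by simp
    also have "\<dots> = s / 2" unfolding \<tau>_def using pos by (simp add: field_simps)
    finally have "q0 + \<tau> *\<^sub>R v0 \<in> ball q0 s" using s(1) \<tau> by (simp add: dist_norm)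
    then have "q0 + \<tau> *\<^sub>R v0 \<in> ball p R0" "minor H \<iota>0 (q0 + \<tau> *\<^sub>R v0) \<noteq> 0" using s(2) by blast+
    moreover have "Dv \<rho> (q0 + \<tau> *\<^sub>R v0 - p) p \<noteq> 0"
    proof -
      have "q0 + \<tau> *\<^sub>R v0 - p = (q0 - p) + \<tau> *\<^sub>R v0" by simp
      then have "Dv \<rho> (q0 + \<tau> *\<^sub>R v0 - p) p = Dv \<rho> (q0 - p) p + \<tau> *\<^sub>R Dv \<rho> v0 p"
        by (simp only: linear_add[OF l\<rho>] linear_scale[OF l\<rho>])
      then show ?thesis using True \<tau> v0 by simp
    qed
    ultimately show ?thesis by (rule that)
  qed
  define e where "e = q1 - p"
  have e: "norm e > 0" "norm e < R0"
    using q1(1,3) linear_0[OF l\<rho>] by (auto simp: e_def dist_norm norm_minus_commute)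
  have "open {z \<in> ball p R0. Dv \<rho> e z \<noteq> 0}"
  proof -
    have "continuous_on (ball p R0) (Dv \<rho> e)"
      by (rule continuous_on_subset[OF smooth_on_continuous_on[OF smooth_on_Dv[OF U1(3)]]])
        (use R0(2) S0_def in auto)
    then have "open (ball p R0 \<inter> Dv \<rho> e -` (- {0}))" by (intro continuous_open_preimage) auto
    moreover have "{z \<in> ball p R0. Dv \<rho> e z \<noteq> 0} = ball p R0 \<inter> Dv \<rho> e -` (- {0})" by auto
    ultimately show ?thesis by simp
  qed
  moreover have "p \<in> {z \<in> ball p R0. Dv \<rho> e z \<noteq> 0}" using R0(1) q1(3) by (simp add: e_def)
  ultimately obtain R1 where R1: "R1 > 0" "ball p R1 \<subseteq> {z \<in> ball p R0. Dv \<rho> e z \<noteq> 0}"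
    using open_contains_ball by blast
  let ?U = "ball p R1"
  have US: "z \<in> S0" if "z \<in> ?U" for z using that R1(2) R0(2) by blast
  interpret hypersurface_map ?U \<rho> e H U' \<rho>'
  proof
    show "smooth_on ?U \<rho>" using U1(3) by (rule smooth_on_subset) (use US S0_def in auto)
    show "Dv \<rho> e z \<noteq> 0" if "z \<in> ?U" for z using that R1(2) by blast
    show "holomorphic_map_on ?U H" using hH R1(2) by (auto simp: holomorphic_map_on_def)
    show "H ` ?U \<subseteq> U'" using US S0_def by auto
    show "\<rho>' (H z) = 0" if z: "z \<in> ?U" "\<rho> z = 0" for z
    proof -
      have "z \<in> M" using US[OF z(1)] z(2) U1(4) by (auto simp: S0_def)
      then have "H z \<in> M'" "H z \<in> U'" using V(3) US[OF z(1)] by (auto simp: S0_def)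
      then show ?thesis using U'(4) by blast
    qed
  qed (use U' in auto)
  have a0: "a p = 0"
  proof -
    have "Dv (\<lambda>z. \<rho>' (H z)) e p = Dv \<rho>' (Dv H e p) p'"
      using Dv_eqI[OF has_derivative_compose[OF Dv_works[OF dH[OF assms(8)]], of \<rho>']] Dv_works[OF d\<rho>'] assms(10)
      by simp
    then show ?thesis using dH0 by (simp add: a_def \<phi>_def[abs_def])
  qed
  have dvd: "\<exists>h. smooth_on ?U h \<and> (\<forall>z\<in>?U. \<rho> z = 0 \<longrightarrow> minor H \<iota> z * cnj (minor H \<kappa> z) = a z * h z)"
    if "inj \<iota>" "inj \<kappa>" for \<iota> \<kappa>
  proof (rule minors_divisible[OF that, where d = "N - r" and u = u and u' = u' and k = k and l = l])
    \<comment> \<open>With dimensions n + 1 and N + 1 this reads 2N - r < 2n - 1, the hypothesis on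
      r.\<close>
    show "N - r + CARD('m) + 2 < 2 * CARD('n)" using assms(1,2,14) rN by linarith
    show "det (\<chi> i j. dZ i (dZbar j (\<lambda>z. of_real (\<rho>' z))) (H z) + dZ i (\<lambda>z. of_real (\<rho>' z)) (H z) * u $ j
      + u' $ i * dZbar j (\<lambda>z. of_real (\<rho>' z)) (H z) + (\<Sum>s<N - r. k s $ i * l s $ j)) \<noteq> 0" if "z \<in> ?U" for z
      using US[OF that] by (simp add: S0_def B_def)
  qed

  have hmU: "hol ?U (minor H \<iota>)" for \<iota> by (rule hol_minor[OF open_ball H])
  have hol_line: "(\<lambda>t. minor H \<iota>0 (p + t *s e)) holomorphic_on ball 0 (R0 / norm e)"
  proof (rule hol_line_holomorphic[OF hm])
    show "p + t *s e \<in> ball p R0" if "t \<in> ball 0 (R0 / norm e)" for t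
      using that e(1) by (simp add: dist_norm vector_scale_norm pos_less_divide_eq)
  qed
  have one: "(1 :: complex) \<in> ball 0 (R0 / norm e)" using e by simp
  have at_one: "minor H \<iota>0 (p + 1 *s e) \<noteq> 0" using q1(2) by (simp add: e_def)
  \<comment> \<open>The first bound keeps the line through \<open>p\<close> where the minor is
    holomorphic, in a disc containing \<open>t = 1\<close>, where it is nonzero. The second keeps
    fibres over the ball of radius \<open>R1 / 2\<close> inside \<open>?U\<close>.\<close>
  define R where "R = min (R0 / norm e) (R1 / (2 * norm e))"
  have R: "0 < R" "R \<le> R0 / norm e" using R0(1) R1(1) e(1) by (auto simp: R_def)
  obtain \<eta> where \<eta>: "0 < \<eta>" "\<eta> < R"
    "\<forall>t. 0 < cmod t \<longrightarrow> cmod t \<le> \<eta> \<longrightarrow> minor H \<iota>0 (p + t *s e) \<noteq> 0"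
    by (rule isolated_zero_disc[OF hol_line one at_one R])
  have Re: "cmod t * norm e < R1 / 2" if "cmod t < R" for t
  proof -
    have "cmod t < R1 / (2 * norm e)" using that by (simp add: R_def)
    then show ?thesis using e(1) by (simp add: field_simps)
  qed
  have "p + t *s e \<in> {z \<in> ?U. minor H \<iota>0 z \<noteq> 0}" if "t \<in> sphere 0 \<eta>" for t
  proof -
    have "cmod t * norm e < R1 / 2" using that \<eta>(2) by (intro Re) simp
    moreover have "minor H \<iota>0 (p + t *s e) \<noteq> 0"
      using \<eta>(1) \<eta>(3)[rule_format, of t] that by auto
    ultimately show ?thesis using R1(1) by (simp add: dist_norm vector_scale_norm)
  qed
  then obtain \<delta> where \<delta>: "\<delta> > 0"
    "\<forall>Z t. dist p Z < \<delta> \<longrightarrow> t \<in> sphere 0 \<eta> \<longrightarrow> Z + t *s e \<in> {z \<in> ?U. minor H \<iota>0 z \<noteq> 0}"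
    by (rule fibre_tube[OF compact_sphere open_superlevel[OF hmU open_ball]])
  let ?B = "ball p (min \<delta> (R1 / 2))"
  have fz: "fibre_zeros ?U ?B (minor H \<iota>0) e \<eta> R"
  proof
    show "Z + t *s e \<in> ?U" if "Z \<in> ?B" "cmod t < R" for Z t
    proof -
      have "dist p (Z + t *s e) \<le> dist p Z + norm (t *s e)"
        by (metis dist_norm dist_triangle add_diff_cancel_left' dist_commute)
      then show ?thesis using that Re[OF that(2)] by (simp add: vector_scale_norm)
    qed
    show "minor H \<iota>0 (Z + t *s e) \<noteq> 0" if "Z \<in> ?B" "cmod t = \<eta>" for Z t
      using \<delta>(2)[rule_format, of Z t] that by simp
  qed (use \<eta> hmU in auto)
  have meets: "\<exists>t. cmod t < \<eta> \<and> Z + t *s e \<in> X \<inter> ?U" if Z: "Z \<in> ?B" for Z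
  proof (rule ccontr)
    assume no: "\<not> (\<exists>t. cmod t < \<eta> \<and> Z + t *s e \<in> X \<inter> ?U)"
    have "a p \<noteq> 0"
    proof (rule a_nonzero_of_empty_fibre[OF fz convex_ball _ Z \<rho>p \<iota>0 _ dvd])
      show "p \<in> ?B" using \<delta>(1) R1(1) by simp
      show "minor H \<iota>0 (p + t *s e) \<noteq> 0" if "0 < cmod t" "cmod t < \<eta>" for t
        using \<eta>(3)[rule_format, of t] that by simp
      show "\<exists>\<iota>. inj \<iota> \<and> minor H \<iota> (Z + t *s e) \<noteq> 0" if "cmod t < \<eta>" for t
      proof -
        have "Z + t *s e \<in> ?U" using fibre_zeros.fibre[OF fz Z, of t] that \<eta>(2) by simp
        then show ?thesis using no that XR0[of "Z + t *s e"] R1(2) by blast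
      qed
    qed
    then show False using a0 by simp
  qed
  have XU: "X \<inter> ?U \<subseteq> {z \<in> ?U. minor H \<iota>0 z = 0}" using XR0 \<iota>0 R1(2) by blast
  have "?U - X \<inter> ?U = (\<Union>\<iota>\<in>{\<iota>. inj \<iota>}. {z \<in> ?U. minor H \<iota> z \<noteq> 0})" using XR0 R1(2) by blast
  then have opX: "open (?U - X \<inter> ?U)" using open_superlevel[OF hmU open_ball] by auto
  obtain Z t where Zt: "Z \<in> ?B" "cmod t < \<eta>" "regular_point (X \<inter> ?U) (Z + t *s e) (CARD('n) - 1)"
  proof -
    have "p \<in> ?B" using \<delta>(1) R1(1) by simp
    then have "\<exists>Z t. Z \<in> ?B \<and> cmod t < \<eta> \<and> regular_point (X \<inter> ?U) (Z + t *s e) (CARD('n) - 1)"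
      using regular_point_of_fibres[OF fz XU opX convex_connected[OF convex_ball] _ meets] by blast
    then show ?thesis using that by blast
  qed
  have "Z + t *s e \<in> ?U" using fibre_zeros.fibre[OF fz Zt(1), of t] Zt(2) \<eta>(2) by simp
  then have "regular_point X (Z + t *s e) (CARD('n) - 1)" "Z + t *s e \<in> W"
    using regular_point_localize[OF Zt(3) open_ball] US by (auto simp: S0_def)
  then show False using W(3) by fastforce
qed

end
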